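(* Let $A$ and $B$ be two $n\times n$ irreducible matrices over any field $\mathbb{F}$. Then $A$ and $B$ are principal minor equivalent if and only if there exists a sequence of $n\times n$ matrices $(A=A_0,A_1,\dots,A_k)$ with $k<2n$ such that for each $0\le i\le k-1$, $A_{i+1}=\mathrm{tw}(A_i,X_i)$ for some cut $X_i$ of $A_i$, and $A_k$ is diagonally equivalent to $B$.
   Context: For an $n\times n$ matrix $A$ and $S,T\subseteq[n]$, $A[S,T]$ is the submatrix with rows in $S$ and columns in $T$, $A[S]=A[S,S]$, and $\overline{X}=[n]\setminus X$. Two $n\times n$ matrices $A,B$ are principal minor equivalent if $\det(A[S])=\det(B[S])$ for all $S\subseteq[n]$. A matrix is reducible if, after simultaneously permuting rows and columns, it is block upper triangular with at least two diagonal blocks; equivalently the directed graph on $[n]$ with an edge $(i,j)$ for $i\ne j$ with $A[i,j]\neq0$ has more than one strongly connected component. Otherwise it is irreducible. $A$ is diagonally similar to $B$ if $B=DAD^{-1}$ for some invertible diagonal matrix $D$; $A$ and $B$ are diagonally equivalent if $A$ is diagonally similar to $B$ or to $B^T$. For $n\ge4$, a set $X\subset[n]$ is a cut of $A$ if $2\le|X|\le n-2$ and $A[X,\overline X]$ and $A[\overline X,X]$ both have rank at most one. Cut-transpose: if $A$ is irreducible and $X$ is a cut of $A$, let $q$ be the first nonzero row of $A[X,\overline X]$ and $u$ the first nonzero column of $A[\overline X,X]$, and let $p,v\in\mathbb{F}^{|X|}$ be such that $A[X,\overline X]=pq^T$ and $A[\overline X,X]=uv^T$. Then $\mathrm{tw}(A,X)$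 is the $n\times n$ matrix with $\mathrm{tw}(A,X)[X]=A[X]$, $\mathrm{tw}(A,X)[X,\overline X]=pu^T$, $\mathrm{tw}(A,X)[\overline X,X]=qv^T$, $\mathrm{tw}(A,X)[\overline X]=A[\overline X]^T$. *)

theory Defs
  imports
    "HOL-Combinatorics.Permutations"
    "Jordan_Normal_Form.DL_Rank_Submatrix"
begin

text \<open>
  Matrices are the matrices of \<open>Jordan_Normal_Form\<close>; rows and columns are numbered from 0,
  so that the index set $[n]$ is \<open>{..<n}\<close>. The library's \<open>submatrix A S T\<close> lists the rows in
  \<open>S\<close> and the columns in \<open>T\<close> in increasing order.
\<close>

definition principal_minor_equivalent :: "nat \<Rightarrow> 'a::field mat \<Rightarrow> 'a mat \<Rightarrow> bool" where
  "principal_minor_equivalent n A B \<longleftrightarrow>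
     (\<forall>S\<subseteq>{..<n}. det (submatrix A S S) = det (submatrix B S S))"

text \<open>
  The function \<open>b\<close> sends an index to the number of its diagonal block: monotonicity makes the
  blocks intervals, and surjectivity makes all \<open>m\<close> of them nonempty.
\<close>

definition block_upper_triangular :: "nat \<Rightarrow> nat \<Rightarrow> 'a::zero mat \<Rightarrow> bool" where
  "block_upper_triangular n m A \<longleftrightarrow>
     (\<exists>b :: nat \<Rightarrow> nat. mono_on {..<n} b \<and> b ` {..<n} = {..<m} \<and>
        (\<forall>i<n. \<forall>j<n. b j < b i \<longrightarrow> A $$ (i, j) = 0))"

definition reducible_mat :: "nat \<Rightarrow> 'a::zero mat \<Rightarrow> bool" where
  "reducible_mat n A \<longleftrightarrow>
     (\<exists>\<pi> m. \<pi> permutes {..<n} \<and> 2 \<le> m \<and>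
        block_upper_triangular n m (mat n n (\<lambda>(i, j). A $$ (\<pi> i, \<pi> j))))"

definition irreducible_mat :: "nat \<Rightarrow> 'a::zero mat \<Rightarrow> bool" where
  "irreducible_mat n A \<longleftrightarrow> \<not> reducible_mat n A"

text \<open>By definition of \<open>similar_mat_wit\<close>, \<open>B = D * A * E\<close> where \<open>E\<close> is the inverse of \<open>D\<close>.\<close>

definition diagonally_similar :: "'a::field mat \<Rightarrow> 'a mat \<Rightarrow> bool" where
  "diagonally_similar A B \<longleftrightarrow> (\<exists>D E. diagonal_mat D \<and> similar_mat_wit B A D E)"

definition diagonally_equivalent :: "'a::field mat \<Rightarrow> 'a mat \<Rightarrow> bool" where
  "diagonally_equivalent A B \<longleftrightarrow> diagonally_similar A B \<or> diagonally_similar A (transpose_mat B)"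

text \<open>\<open>vec_space.rank r M\<close> is the rank of a matrix \<open>M\<close> with \<open>r\<close> rows.\<close>

definition is_cut :: "nat \<Rightarrow> 'a::field mat \<Rightarrow> nat set \<Rightarrow> bool" where
  "is_cut n A X \<longleftrightarrow>
     4 \<le> n \<and> X \<subset> {..<n} \<and> 2 \<le> card X \<and> card X \<le> n - 2 \<and>
     vec_space.rank (card X) (submatrix A X ({..<n} - X)) \<le> 1 \<and>
     vec_space.rank (n - card X) (submatrix A ({..<n} - X) X) \<le> 1"

definition outer_prod :: "'a::times vec \<Rightarrow> 'a vec \<Rightarrow> 'a mat" where
  "outer_prod x y = mat (dim_vec x) (dim_vec y) (\<lambda>(i, j). x $ i * y $ j)"

definition first_nonzero_row :: "'a::zero mat \<Rightarrow> 'a vec" where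
  "first_nonzero_row M = row M (LEAST i. i < dim_row M \<and> row M i \<noteq> 0\<^sub>v (dim_col M))"

definition first_nonzero_col :: "'a::zero mat \<Rightarrow> 'a vec" where
  "first_nonzero_col M = col M (LEAST j. j < dim_col M \<and> col M j \<noteq> 0\<^sub>v (dim_row M))"

definition is_cut_transpose :: "nat \<Rightarrow> 'a::field mat \<Rightarrow> nat set \<Rightarrow> 'a mat \<Rightarrow> bool" where
  "is_cut_transpose n A X M \<longleftrightarrow>
     (let Y = {..<n} - X;
          q = first_nonzero_row (submatrix A X Y);
          u = first_nonzero_col (submatrix A Y X)
      in \<exists>p\<in>carrier_vec (card X). \<exists>v\<in>carrier_vec (card X).
           submatrix A X Y = outer_prod p q \<and>
           submatrix A Y X = outer_prod u v \<and>
           M \<in> carrier_mat n n \<and>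
           submatrix M X X = submatrix A X X \<and>
           submatrix M X Y = outer_prod p u \<and>
           submatrix M Y X = outer_prod q v \<and>
           submatrix M Y Y = transpose_mat (submatrix A Y Y))"

text \<open>
  The definite description denotes only where exactly one matrix has the required blocks, which
  is the case when \<open>A\<close> is irreducible and \<open>X\<close> is a cut of \<open>A\<close>: see \<open>cut_transpose_unique\<close>, the goal of
  the following lemmas.
\<close>

definition tw :: "nat \<Rightarrow> 'a::field mat \<Rightarrow> nat set \<Rightarrow> 'a mat" where
  "tw n A X = (THE M. is_cut_transpose n A X M)"

lemma rank_le_1_minor:
  fixes M :: "'a::field mat"
  assumes M: "M \<in> carrier_mat nr nc" and r: "vec_space.rank nr M \<le> 1"
    and i: "i < i'" "i' < nr" and j: "j < j'" "j' < nc"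
  shows "M $$ (i, j) * M $$ (i', j') = M $$ (i, j') * M $$ (i', j)"
proof -
  let ?S = "submatrix M {i, i'} {j, j'}"
  have I: "{a. a < dim_row M \<and> a \<in> {i, i'}} = {i, i'}" "{a. a < dim_col M \<and> a \<in> {j, j'}} = {j, j'}"
    using M i j by auto
  have c: "card {i, i'} = 2" "card {j, j'} = 2" using i j by auto
  have S: "?S \<in> carrier_mat 2 2"
    by (intro carrier_matI) (simp_all only: dim_submatrix I c)
  have *: "{a \<in> {x, x'}. a < x} = {}" "{a \<in> {x, x'}. a < x'} = {x}" if "x < x'" for x x' :: nat
    using that by auto
  have e: "?S $$ (0, 0) = M $$ (i, j)" "?S $$ (0, 1) = M $$ (i, j')"
    "?S $$ (1, 0) = M $$ (i', j)" "?S $$ (1, 1) = M $$ (i', j')"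
    using submatrix_index_card[of i M j "{i,i'}" "{j,j'}"] submatrix_index_card[of i M j' "{i,i'}" "{j,j'}"]
      submatrix_index_card[of i' M j "{i,i'}" "{j,j'}"] submatrix_index_card[of i' M j' "{i,i'}" "{j,j'}"]
      M i j by (simp_all add: * del: insert_iff) (simp_all add: *)
  have "det ?S = 0"
    using vec_space.rank_gt_minor[OF M, of "{i,i'}" "{j,j'}"] r I c M by auto
  moreover have "det ?S = (\<Sum>k<2. ?S $$ (k, 0) * cofactor ?S k 0)"
    using laplace_expansion_column[OF S, of 0] by simp
  moreover have "(\<Sum>k<2. ?S $$ (k, 0) * cofactor ?S k 0) = ?S $$ (0,0) * cofactor ?S 0 0 + ?S $$ (1,0) * cofactor ?S 1 0"
    by (simp add: numeral_2_eq_2)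
  moreover have "cofactor ?S 0 0 = ?S $$ (1,1)"
    unfolding cofactor_def using S by (subst det_single) (auto simp: mat_delete_def)
  moreover have "cofactor ?S 1 0 = - ?S $$ (0,1)"
    unfolding cofactor_def using S by (subst det_single) (auto simp: mat_delete_def)
  ultimately show ?thesis unfolding e by (simp add: algebra_simps)
qed

lemma rank_le_1_minor':
  fixes M :: "'a::field mat"
  assumes M: "M \<in> carrier_mat nr nc" and r: "vec_space.rank nr M \<le> 1"
    and i: "i < nr" "i' < nr" and j: "j < nc" "j' < nc"
  shows "M $$ (i, j) * M $$ (i', j') = M $$ (i, j') * M $$ (i', j)"
proof -
  consider "i = i' \<or> j = j'" | "i < i'" "j < j'" | "i < i'" "j' < j" | "i' < i" "j < j'" | "i' < i" "j' < j"
    by linarith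
  thus ?thesis
  proof cases
    case 1 thus ?thesis by (auto simp: mult.commute)
  next
    case 2 thus ?thesis using rank_le_1_minor[OF M r 2(1) i(2) 2(2) j(2)] by simp
  next
    case 3 thus ?thesis using rank_le_1_minor[OF M r 3(1) i(2) 3(2) j(1)] by simp
  next
    case 4 thus ?thesis using rank_le_1_minor[OF M r 4(1) i(1) 4(2) j(2)] by (simp add: mult.commute)
  next
    case 5 thus ?thesis using rank_le_1_minor[OF M r 5(1) i(1) 5(2) j(1)] by (simp add: mult.commute)
  qed
qed

lemma outer_row:
  fixes M :: "'a::field mat"
  assumes M: "M \<in> carrier_mat nr nc"
    and r: "\<And>i i' j j'. i < nr \<Longrightarrow> i' < nr \<Longrightarrow> j < nc \<Longrightarrow> j' < nc \<Longrightarrow> M $$ (i, j) * M $$ (i', j') = M $$ (i, j') * M $$ (i', j)"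
    and nz: "a < nr" "b < nc" "M $$ (a, b) \<noteq> 0"
  shows "\<exists>!p. p \<in> carrier_vec nr \<and> M = outer_prod p (first_nonzero_row M)"
    and "first_nonzero_row M \<in> carrier_vec nc"
proof -
  let ?P = "\<lambda>i. i < dim_row M \<and> row M i \<noteq> 0\<^sub>v (dim_col M)"
  define i0 where "i0 = (LEAST i. ?P i)"
  have "row M a $ b \<noteq> 0\<^sub>v (dim_col M) $ b" using nz M by simp
  hence "?P a" using nz M by (metis carrier_matD(1))
  hence i0: "?P i0" unfolding i0_def by (rule LeastI)
  have q: "first_nonzero_row M = row M i0" by (simp add: first_nonzero_row_def i0_def)
  show "first_nonzero_row M \<in> carrier_vec nc" unfolding q using M by (metis carrier_matD(2) row_carrier)
  obtain j0 where j0: "j0 < nc" "M $$ (i0, j0) \<noteq> 0"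
  proof (rule ccontr)
    assume "\<not> thesis"
    hence "\<And>j. j < nc \<Longrightarrow> M $$ (i0, j) = 0" using that by blast
    hence "row M i0 = 0\<^sub>v (dim_col M)" using M i0 by (intro eq_vecI) auto
    thus False using i0 by simp
  qed
  show "\<exists>!p. p \<in> carrier_vec nr \<and> M = outer_prod p (first_nonzero_row M)"
  proof (rule ex1I)
    let ?p = "vec nr (\<lambda>i. M $$ (i, j0) / M $$ (i0, j0))"
    have en: "M $$ (i, j) = M $$ (i, j0) / M $$ (i0, j0) * M $$ (i0, j)" if "i < nr" "j < nc" for i j
      using r[of i i0 j j0] that i0 j0 M by (simp add: field_simps)
    have "M = outer_prod ?p (first_nonzero_row M)" (is "_ = ?O")
    proof (rule eq_matI)
      fix i j assume "i < dim_row ?O" "j < dim_col ?O"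
      hence ij: "i < nr" "j < nc" using M by (auto simp: q outer_prod_def)
      have "?O $$ (i, j) = M $$ (i, j0) / M $$ (i0, j0) * M $$ (i0, j)"
        using ij M i0 by (simp add: q outer_prod_def)
      thus "M $$ (i, j) = ?O $$ (i, j)" using en[OF ij] by (rule trans[OF _ sym, rotated])
    qed (use M in \<open>auto simp: q outer_prod_def\<close>)
    thus "?p \<in> carrier_vec nr \<and> M = outer_prod ?p (first_nonzero_row M)" by simp
  next
    fix p assume p: "p \<in> carrier_vec nr \<and> M = outer_prod p (first_nonzero_row M)"
    show "p = vec nr (\<lambda>i. M $$ (i, j0) / M $$ (i0, j0))"
    proof (intro eq_vecI)
      fix i assume "i < dim_vec (vec nr (\<lambda>i. M $$ (i, j0) / M $$ (i0, j0)))"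
      hence i: "i < nr" by simp
      have "M $$ (i, j0) = outer_prod p (row M i0) $$ (i, j0)" using p[THEN conjunct2] unfolding q by (rule arg_cong)
      also have "\<dots> = p $ i * M $$ (i0, j0)" using p[THEN conjunct1] i M j0 i0 by (auto simp: outer_prod_def)
      finally show "p $ i = vec nr (\<lambda>i. M $$ (i, j0) / M $$ (i0, j0)) $ i" using i j0 by simp
    qed (use p[THEN conjunct1] in auto)
  qed
qed

lemma first_nonzero_col_transpose:
  assumes "a < dim_row M" "b < dim_col M" "M $$ (a, b) \<noteq> 0"
  shows "first_nonzero_col M = first_nonzero_row (transpose_mat M)"
proof -
  let ?P = "\<lambda>j. j < dim_col M \<and> col M j \<noteq> 0\<^sub>v (dim_row M)"
  have "col M b $ a \<noteq> 0\<^sub>v (dim_row M) $ a" using assms by simp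
  hence "?P b" using assms by metis
  hence "Least ?P < dim_col M" using LeastI[of ?P b] by blast
  moreover have "?P = (\<lambda>j. j < dim_col M \<and> row (transpose_mat M) j \<noteq> 0\<^sub>v (dim_row M))"
    by (auto simp: fun_eq_iff)
  ultimately show ?thesis
    unfolding first_nonzero_col_def first_nonzero_row_def by simp
qed

lemma outer_col:
  fixes M :: "'a::field mat"
  assumes M: "M \<in> carrier_mat nr nc"
    and r: "\<And>i i' j j'. i < nr \<Longrightarrow> i' < nr \<Longrightarrow> j < nc \<Longrightarrow> j' < nc \<Longrightarrow> M $$ (i, j) * M $$ (i', j') = M $$ (i, j') * M $$ (i', j)"
    and nz: "a < nr" "b < nc" "M $$ (a, b) \<noteq> 0"
  shows "\<exists>!v. v \<in> carrier_vec nc \<and> M = outer_prod (first_nonzero_col M) v"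
    and "first_nonzero_col M \<in> carrier_vec nr"
proof -
  have T: "transpose_mat M \<in> carrier_mat nc nr" using M by simp
  have *: "(transpose_mat M = outer_prod v x) \<longleftrightarrow> (M = outer_prod x v)" for v x :: "'a vec"
  proof -
    have "transpose_mat (outer_prod x v) = outer_prod v x"
      by (auto simp: outer_prod_def intro!: eq_matI)
    thus ?thesis by (metis transpose_transpose)
  qed
  have r': "transpose_mat M $$ (i, j) * transpose_mat M $$ (i', j') = transpose_mat M $$ (i, j') * transpose_mat M $$ (i', j)"
    if "i < nc" "i' < nc" "j < nr" "j' < nr" for i i' j j'
    using r[of j j' i i'] that M by (simp add: algebra_simps)
  have fc: "first_nonzero_col M = first_nonzero_row (transpose_mat M)"
    using first_nonzero_col_transpose[of a M b] nz M by auto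
  show "\<exists>!v. v \<in> carrier_vec nc \<and> M = outer_prod (first_nonzero_col M) v"
    using outer_row(1)[OF T r', of b a] nz M unfolding * fc by auto
  show "first_nonzero_col M \<in> carrier_vec nr"
    using outer_row(2)[OF T r', of b a] nz M unfolding fc by auto
qed

lemma irreducible_block_nonzero:
  assumes irr: "irreducible_mat n A" and X: "X \<subseteq> {..<n}" "X \<noteq> {}" "X \<noteq> {..<n}"
  shows "\<exists>i\<in>X. \<exists>j\<in>{..<n} - X. A $$ (i, j) \<noteq> 0"
proof (rule ccontr)
  assume "\<not> ?thesis"
  hence z: "\<And>i j. i \<in> X \<Longrightarrow> j \<in> {..<n} - X \<Longrightarrow> A $$ (i, j) = 0" by blast
  let ?Y = "{..<n} - X" and ?m = "card ({..<n} - X)"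
  have fX: "finite X" using X finite_subset by blast
  have m: "?m = n - card X" using X fX by (simp add: card_Diff_subset)
  have cX: "card X \<le> n" "card X > 0" using X fX card_mono[of "{..<n}" X] by (auto simp: card_gt_0_iff)
  have m0: "0 < ?m" using X by (auto simp: card_gt_0_iff)
  obtain f where f: "bij_betw f {..<?m} ?Y" using finite_same_card_bij[of "{..<?m}" ?Y] by auto
  have "card {?m..<n} = card X" using m cX by simp
  then obtain g where g: "bij_betw g {?m..<n} X" using finite_same_card_bij[of "{?m..<n}" X] fX by auto
  define \<pi> where "\<pi> = (\<lambda>i. if i < ?m then f i else if i < n then g i else i)"
  have 1: "bij_betw \<pi> {..<?m} ?Y" using f by (rule bij_betw_cong[THEN iffD1, rotated]) (auto simp: \<pi>_def)
  have 2: "bij_betw \<pi> {?m..<n} X" using g by (rule bij_betw_cong[THEN iffD1, rotated]) (auto simp: \<pi>_def)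
  have "bij_betw \<pi> ({..<?m} \<union> {?m..<n}) (?Y \<union> X)" by (rule bij_betw_combine[OF 1 2]) auto
  moreover have "{..<?m} \<union> {?m..<n} = {..<n}" using m by auto
  moreover have "?Y \<union> X = {..<n}" using X by auto
  ultimately have "bij_betw \<pi> {..<n} {..<n}" by simp
  hence perm: "\<pi> permutes {..<n}" by (rule bij_imp_permutes) (use m in \<open>auto simp: \<pi>_def\<close>)
  have "block_upper_triangular n 2 (mat n n (\<lambda>(i, j). A $$ (\<pi> i, \<pi> j)))"
    unfolding block_upper_triangular_def
  proof (intro exI conjI allI impI)
    let ?b = "\<lambda>i. if i < ?m then 0 else (1::nat)"
    show "mono_on {..<n} ?b" by (auto simp: mono_on_def)
    show "?b ` {..<n} = {..<2}"
    proof -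
      have "?b 0 = 0" "?b (n - 1) = 1" "0 < n" "n - 1 < n" using m m0 cX by auto
      hence "?b 0 \<in> ?b ` {..<n}" "?b (n - 1) \<in> ?b ` {..<n}" by blast+
      hence "{0, 1} \<subseteq> ?b ` {..<n}" using \<open>?b 0 = 0\<close> \<open>?b (n - 1) = 1\<close> by simp
      moreover have "?b ` {..<n} \<subseteq> {0, 1}" by (simp add: image_subset_iff)
      moreover have "{..<2} = {0, 1::nat}" by auto
      ultimately show ?thesis by (simp only: subset_antisym)
    qed
    fix i j assume "i < n" "j < n" "?b j < ?b i"
    hence ij: "j < ?m" "i \<in> {?m..<n}" by (auto split: if_splits)
    have "\<pi> i \<in> X" "\<pi> j \<in> ?Y" using 1 2 ij bij_betwE by blast+
    thus "mat n n (\<lambda>(i, j). A $$ (\<pi> i, \<pi> j)) $$ (i, j) = 0" using z \<open>i < n\<close> \<open>j < n\<close> by simp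
  qed
  hence "reducible_mat n A" unfolding reducible_mat_def using perm by blast
  thus False using irr by (simp add: irreducible_mat_def)
qed

lemma submatrix_carrier:
  assumes "M \<in> carrier_mat n n" "I \<subseteq> {..<n}" "J \<subseteq> {..<n}"
  shows "submatrix M I J \<in> carrier_mat (card I) (card J)"
proof -
  have "{i. i < n \<and> i \<in> I} = I" "{i. i < n \<and> i \<in> J} = J" using assms by auto
  thus ?thesis using assms by (intro carrier_matI) (simp_all add: dim_submatrix)
qed

abbreviation "pos_in I i \<equiv> card {a \<in> I. a < i}"

lemma pos_in_less: "finite I \<Longrightarrow> i \<in> I \<Longrightarrow> pos_in I i < card (I::nat set)"
  by (rule psubset_card_mono) auto

lemma submatrix_eqI:
  assumes M: "M \<in> carrier_mat n n" and I: "I \<subseteq> {..<n}" "J \<subseteq> {..<n}"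
    and N: "N \<in> carrier_mat (card I) (card J)"
    and e: "\<And>i j. i \<in> I \<Longrightarrow> j \<in> J \<Longrightarrow> M $$ (i, j) = N $$ (pos_in I i, pos_in J j)"
  shows "submatrix M I J = N"
proof (rule eq_matI)
  fix a b assume "a < dim_row N" "b < dim_col N"
  hence ab: "a < card I" "b < card J" using N by auto
  have "{i. i < n \<and> i \<in> I} = I" "{i. i < n \<and> i \<in> J} = J" using I by auto
  hence "submatrix M I J $$ (a, b) = M $$ (pick I a, pick J b)"
    using ab M by (subst submatrix_index) auto
  also have "\<dots> = N $$ (a, b)"
    using e[of "pick I a" "pick J b"] pick_in_set_le card_pick_le ab by metis
  finally show "submatrix M I J $$ (a, b) = N $$ (a, b)" .
qed (use submatrix_carrier[OF M I] N in auto)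

lemma cut_transpose_unique:
  fixes A :: "'a::field mat"
  assumes A: "A \<in> carrier_mat n n" and irr: "irreducible_mat n A" and cut: "is_cut n A X"
  shows "\<exists>!M. is_cut_transpose n A X M"
proof -
  define Y where "Y = {..<n} - X"
  have X: "X \<subseteq> {..<n}" "X \<noteq> {}" "X \<noteq> {..<n}" "finite X" using cut finite_subset by (auto simp: is_cut_def)
  have Y: "Y \<subseteq> {..<n}" "Y \<noteq> {}" "Y \<noteq> {..<n}" "finite Y" "{..<n} - Y = X" using X by (auto simp: Y_def)
  have cY: "card Y = n - card X" using X by (simp add: Y_def card_Diff_subset)
  define P Q where "P = submatrix A X Y" and "Q = submatrix A Y X"
  have P: "P \<in> carrier_mat (card X) (card Y)" and Q: "Q \<in> carrier_mat (card Y) (card X)"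
    unfolding P_def Q_def using submatrix_carrier A X Y by blast+
  have rk: "vec_space.rank (card X) P \<le> 1" "vec_space.rank (card Y) Q \<le> 1"
    using cut unfolding is_cut_def P_def Q_def cY unfolding Y_def by auto
  obtain i j where "i \<in> X" "j \<in> Y" "A $$ (i, j) \<noteq> 0"
    using irreducible_block_nonzero[OF irr] X Y_def by blast
  hence nzP: "pos_in X i < card X" "pos_in Y j < card Y" "P $$ (pos_in X i, pos_in Y j) \<noteq> 0"
    using pos_in_less X Y A submatrix_index_card[of i A j X Y] by (auto simp: P_def)
  obtain i' j' where "i' \<in> Y" "j' \<in> X" "A $$ (i', j') \<noteq> 0"
    using irreducible_block_nonzero[OF irr, of Y] Y by auto
  hence nzQ: "pos_in Y i' < card Y" "pos_in X j' < card X" "Q $$ (pos_in Y i', pos_in X j') \<noteq> 0"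
    using pos_in_less X Y A submatrix_index_card[of i' A j' Y X] by (auto simp: Q_def)
  define q u where "q = first_nonzero_row P" and "u = first_nonzero_col Q"
  note oP = outer_row[OF P rank_le_1_minor'[OF P rk(1)] nzP, folded q_def]
  note oQ = outer_col[OF Q rank_le_1_minor'[OF Q rk(2)] nzQ, folded u_def]
  obtain p where p: "p \<in> carrier_vec (card X)" "P = outer_prod p q" 
    and pu: "\<And>p'. p' \<in> carrier_vec (card X) \<Longrightarrow> P = outer_prod p' q \<Longrightarrow> p' = p" using oP(1) by blast
  obtain v where v: "v \<in> carrier_vec (card X)" "Q = outer_prod u v"
    and vu: "\<And>v'. v' \<in> carrier_vec (card X) \<Longrightarrow> Q = outer_prod u v' \<Longrightarrow> v' = v" using oQ(1) by blast
  have qu: "q \<in> carrier_vec (card Y)" "u \<in> carrier_vec (card Y)" using oP oQ by auto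
  let ?R = "\<lambda>M. M \<in> carrier_mat n n \<and> submatrix M X X = submatrix A X X \<and>
           submatrix M X Y = outer_prod p u \<and>
           submatrix M Y X = outer_prod q v \<and>
           submatrix M Y Y = transpose_mat (submatrix A Y Y)"
  have R: "is_cut_transpose n A X M \<longleftrightarrow> ?R M" for M
    unfolding is_cut_transpose_def Let_def Y_def[symmetric] P_def[symmetric] Q_def[symmetric] q_def[symmetric] u_def[symmetric]
    using p v pu vu by blast
  show ?thesis unfolding R
  proof (rule ex1I)
    define M where "M = mat n n (\<lambda>(i,j). if i \<in> X then (if j \<in> X then submatrix A X X $$ (pos_in X i, pos_in X j) else outer_prod p u $$ (pos_in X i, pos_in Y j))
       else (if j \<in> X then outer_prod q v $$ (pos_in Y i, pos_in X j) else transpose_mat (submatrix A Y Y) $$ (pos_in Y i, pos_in Y j)))"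
    have M: "M \<in> carrier_mat n n" by (simp add: M_def)
    have "outer_prod p u \<in> carrier_mat (card X) (card Y)" "outer_prod q v \<in> carrier_mat (card Y) (card X)"
      using p v qu by (auto simp: outer_prod_def)
    moreover have "submatrix A X X \<in> carrier_mat (card X) (card X)"
      "transpose_mat (submatrix A Y Y) \<in> carrier_mat (card Y) (card Y)"
      using submatrix_carrier[OF A] X Y by auto
    moreover have "X \<inter> Y = {}" by (auto simp: Y_def)
    ultimately show "?R M"
      using M X Y by (intro conjI submatrix_eqI[OF M]) (auto simp: M_def subset_iff disjoint_iff)
    fix N assume N: "?R N"
    show "N = M"
    proof (rule eq_matI)
      fix i j assume "i < dim_row M" "j < dim_col M"
      hence ij: "i < n" "j < n" using M by auto
      have s: "submatrix N I J $$ (pos_in I i, pos_in J j) = N $$ (i, j)" if "i \<in> I" "j \<in> J" for I J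
        using submatrix_index_card[of i N j I J] N ij that by auto
      show "N $$ (i, j) = M $$ (i, j)"
        using N s[of X X] s[of X Y] s[of Y X] s[of Y Y] ij by (auto simp: M_def Y_def)
    qed (use N M in auto)
  qed
qed

text \<open>The other common description of irreducibility, by the directed graph of nonzero entries.\<close>

lemma irreducible_iff_strongly_connected:
  "irreducible_mat n A \<longleftrightarrow>
     (\<forall>i<n. \<forall>j<n. (i, j) \<in> {(a, b). a < n \<and> b < n \<and> a \<noteq> b \<and> A $$ (a, b) \<noteq> 0}\<^sup>*)" (is "?L \<longleftrightarrow> ?R")
proof
  let ?E = "{(a, b). a < n \<and> b < n \<and> a \<noteq> b \<and> A $$ (a, b) \<noteq> 0}"
  assume L: ?L
  show ?R
  proof (intro allI impI, rule ccontr)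
    fix i j assume ij: "i < n" "j < n" "(i, j) \<notin> ?E\<^sup>*"
    let ?X = "{k. k < n \<and> (i, k) \<in> ?E\<^sup>*}"
    have "i \<in> ?X" "j \<notin> ?X" "?X \<subseteq> {..<n}" using ij by auto
    then obtain a b where "a \<in> ?X" "b \<in> {..<n} - ?X" "A $$ (a, b) \<noteq> 0"
      using irreducible_block_nonzero[OF L, of ?X] ij by blast
    moreover hence "(a, b) \<in> ?E" by auto
    ultimately show False by (auto intro: rtrancl_into_rtrancl)
  qed
next
  let ?E = "{(a, b). a < n \<and> b < n \<and> a \<noteq> b \<and> A $$ (a, b) \<noteq> 0}"
  assume R: ?R
  show ?L unfolding irreducible_mat_def
  proof
    assume "reducible_mat n A"
    then obtain \<pi> and m :: nat and b :: "nat \<Rightarrow> nat" where p: "\<pi> permutes {..<n}" and m: "2 \<le> m" and b: "b ` {..<n} = {..<m}"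
      and z: "\<And>i j. i < n \<Longrightarrow> j < n \<Longrightarrow> b j < b i \<Longrightarrow> A $$ (\<pi> i, \<pi> j) = 0"
      unfolding reducible_mat_def block_upper_triangular_def by auto
    have "0 \<in> b ` {..<n}" "1 \<in> b ` {..<n}" unfolding b using m by auto
    then obtain i j where i: "i < n" "b i = 1" and j: "j < n" "b j = 0" by (metis imageE lessThan_iff)
    have st: "(x, y) \<in> ?E \<Longrightarrow> b (inv_into UNIV \<pi> x) \<le> b (inv_into UNIV \<pi> y)" for x y
    proof (rule ccontr)
      assume e: "(x, y) \<in> ?E" "\<not> b (inv_into UNIV \<pi> x) \<le> b (inv_into UNIV \<pi> y)"
      have "inv_into UNIV \<pi> x < n" "inv_into UNIV \<pi> y < n" using e permutes_in_image[OF permutes_inv[OF p]] by auto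
      hence "A $$ (x, y) = 0" using z[of "inv_into UNIV \<pi> x" "inv_into UNIV \<pi> y"] e by (simp add: permutes_inverses[OF p])
      thus False using e by simp
    qed
    have "(x, y) \<in> ?E\<^sup>* \<Longrightarrow> b (inv_into UNIV \<pi> x) \<le> b (inv_into UNIV \<pi> y)" for x y
    proof (induction rule: rtrancl_induct)
      case (step y z) thus ?case using st[of y z] by linarith
    qed simp
    moreover have "(\<pi> i, \<pi> j) \<in> ?E\<^sup>*" using R i j permutes_in_image[OF p] by auto
    ultimately have "b (inv_into UNIV \<pi> (\<pi> i)) \<le> b (inv_into UNIV \<pi> (\<pi> j))" by blast
    thus False using i j by (simp add: permutes_inverses[OF p])
  qed
qed

end

theory Submission
  imports Defs "HOL-Computational_Algebra.Formal_Laurent_Series"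
begin

text \<open>
  A rank-one update \<open>A + c A e\<^sub>k e\<^sub>k\<^sup>T A\<close>, applied to two matrices with the same \<open>c\<close>, preserves principal
  minor equivalence, irreducibility and cuts, and commutes with diagonal similarity, transposition
  and cut-transposes; it is also invertible. After passing to an infinite field and generic updates,
  all entries in the row and the column of a base index \<open>v\<close> are nonzero. The ratios
  \<open>a i j = A i j / (A i v * A v j)\<close> then determine \<open>A\<close> up to diagonal similarity within its equivalence
  class, cuts become clans (modules) of \<open>a\<close>, a cut-transpose reverses \<open>a\<close> inside a clan, and for an
  equivalent matrix with ratios \<open>b\<close> each pair \<open>(b i j, b j i)\<close> is \<open>(a i j, a j i)\<close> or its reversal. This
  colours the pairs with \<open>a i j \<noteq> a j i\<close> blue or red. The equations between minors of orders 3 and 4 of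
  all updates force a clan of \<open>a\<close> whenever both colours occur. A smallest clan \<open>X\<close> of \<open>b\<close> is then a clan
  of \<open>a\<close>, possibly after one reversal; recursion into \<open>X\<close> and into the complement of \<open>X\<close> with one point
  of \<open>X\<close> added, together with one reversal of \<open>X\<close>, bounds the number of reversals by \<open>2 (n - 3)\<close>.
\<close>

section \<open>Clans and connectivity\<close>


text \<open>The obstacle is that a flat pair carries no colour. Minors exclude a flat side in a
  triangle with both colours, but two flat sides force twins opposite them only if flatness survives
  every update (\<open>stable\<close>). An unstable pair loses its flatness under a generic update
  and no pair becomes flat, so an induction over the number of flat pairs reaches the stable case.
  The base index \<open>v\<close> breaks the symmetry between a cut and its complement: one of the
  two avoids \<open>v\<close>, and that one is the clan. The bound is
  \<open>g m = 2 * (m - 2)\<close> for the \<open>m = n - 1\<close> remaining points. It satisfies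
  \<open>g k + g (m + 1 - k) + 2 = g m\<close>, and the 2 covers a preliminary reversal, which
  occurs only for smallest clans of two points, and a corrective one after gluing. The infinite
  field serves only to find the sets to be transposed: a cut-transpose is fixed by its set up to
  diagonal similarity, and between irreducible matrices diagonal similarity over Laurent series
  descends to the constants, so the same sets work over the given field.\<close>

definition undistinguished :: "('i \<Rightarrow> 'i \<Rightarrow> 'k) \<Rightarrow> 'i \<Rightarrow> 'i \<Rightarrow> 'i \<Rightarrow> bool" where
  "undistinguished a i j k \<longleftrightarrow> a i k = a j k \<and> a k i = a k j"

definition clan :: "'i set \<Rightarrow> ('i \<Rightarrow> 'i \<Rightarrow> 'k) \<Rightarrow> 'i set \<Rightarrow> bool" where
  "clan U a X \<longleftrightarrow> X \<subseteq> U \<and> (\<forall>i\<in>X. \<forall>j\<in>X. \<forall>k\<in>U - X. undistinguished a i j k)"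

definition primitive :: "'i set \<Rightarrow> ('i \<Rightarrow> 'i \<Rightarrow> 'k) \<Rightarrow> bool" where
  "primitive U a \<longleftrightarrow> (\<forall>X. clan U a X \<longrightarrow> 2 \<le> card X \<longrightarrow> X = U)"

text \<open>This is strong connectivity for a general relation and connectivity for a symmetric one.
  The first reading serves the supports of matrices, the second the colours.\<close>

definition connected_in :: "('i \<Rightarrow> 'i \<Rightarrow> bool) \<Rightarrow> 'i set \<Rightarrow> bool" where
  "connected_in R W \<longleftrightarrow> (\<forall>C\<subseteq>W. C \<noteq> {} \<longrightarrow> C \<noteq> W \<longrightarrow> (\<exists>x\<in>C. \<exists>y\<in>W - C. R x y))"

lemma undist_refl [simp]: "undistinguished a i i k"
  by (simp add: undistinguished_def)

lemma undist_sym: "undistinguished a i j k \<Longrightarrow> undistinguished a j i k"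
  by (simp add: undistinguished_def)

lemma undist_trans: "undistinguished a i j k \<Longrightarrow> undistinguished a j l k \<Longrightarrow> undistinguished a i l k"
  by (simp add: undistinguished_def)

lemma card_two_le:
  assumes "finite W" "x \<in> W" "y \<in> W" "x \<noteq> y" shows "2 \<le> card W"
proof -
  have "card {x, y} \<le> card W" by (rule card_mono) (use assms in auto)
  thus ?thesis using assms by simp
qed

lemma connected_in_class:
  assumes "connected_in R W" "x \<in> W" "y \<in> W" "P x"
    and step: "\<And>u v. u \<in> W \<Longrightarrow> v \<in> W \<Longrightarrow> R u v \<Longrightarrow> P u \<Longrightarrow> P v"
  shows "P y"
proof (rule ccontr)
  assume "\<not> P y"
  let ?C = "{u\<in>W. P u}"
  have "?C \<subseteq> W" "?C \<noteq> {}" "?C \<noteq> W" using assms \<open>\<not> P y\<close> by auto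
  then obtain u v where "u \<in> ?C" "v \<in> W - ?C" "R u v" using assms(1) unfolding connected_in_def by meson
  thus False using step by auto
qed

lemma connected_inE:
  assumes "connected_in R W" "C \<subseteq> W" "x \<in> C" "y \<in> W" "y \<notin> C"
  obtains u v where "u \<in> C" "v \<in> W" "v \<notin> C" "R u v"
proof -
  have "\<exists>u\<in>C. \<exists>v\<in>W - C. R u v"
    using assms(1)[unfolded connected_in_def, rule_format, of C] assms(2-5) by fast
  thus ?thesis using that by blast
qed

lemma component_exists:
  assumes "x \<in> W" and s: "\<And>x y. R x y \<Longrightarrow> R y x"
  shows "\<exists>C\<subseteq>W. x \<in> C \<and> connected_in R C \<and> (\<forall>u\<in>C. \<forall>y\<in>W - C. \<not> R u y)"
proof -
  let ?E = "{(u, y). u \<in> W \<and> y \<in> W \<and> R u y}"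
  let ?C = "{y. (x, y) \<in> ?E\<^sup>*}"
  have sub: "?C \<subseteq> W"
  proof
    fix y assume "y \<in> ?C"
    hence "(x, y) \<in> ?E\<^sup>*" by simp
    thus "y \<in> W" by (induction rule: rtrancl_induct) (simp_all add: assms(1))
  qed
  have "connected_in R ?C"
    unfolding connected_in_def
  proof (intro allI impI, rule ccontr)
    fix D assume D: "D \<subseteq> ?C" "D \<noteq> {}" "D \<noteq> ?C" and n: "\<not> (\<exists>u\<in>D. \<exists>y\<in>?C - D. R u y)"
    have "(y \<in> D) = (x \<in> D)" if "(x, y) \<in> ?E\<^sup>*" for y using that
    proof (induction rule: rtrancl_induct)
      case (step y z)
      hence "z \<in> ?C" "y \<in> ?C" using rtrancl_into_rtrancl[of x y ?E z] by simp_all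
      thus ?case using step n s[of y z] by blast
    qed simp
    thus False using D by blast
  qed
  moreover have "\<not> R u y" if "u \<in> ?C" "y \<in> W - ?C" for u y
  proof
    assume "R u y"
    hence "(u, y) \<in> ?E" using that sub by blast
    hence "y \<in> ?C" using that(1) rtrancl_into_rtrancl[of x u ?E y] by simp
    thus False using that(2) by simp
  qed
  moreover have "x \<in> ?C" by simp
  ultimately show ?thesis using sub by (intro exI[of _ ?C] conjI ballI)
qed

lemma connected_in_insert:
  assumes c: "connected_in R W" and s: "\<And>x y. R x y \<Longrightarrow> R y x" and u: "w \<in> W" "R u w"
  shows "connected_in R (insert u W)"
  unfolding connected_in_def
proof (intro allI impI)
  fix C assume C: "C \<subseteq> insert u W" "C \<noteq> {}" "C \<noteq> insert u W"
  show "\<exists>x\<in>C. \<exists>y\<in>insert u W - C. R x y"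
  proof (cases "C \<inter> W = {} \<or> W \<subseteq> C")
    case True
    thus ?thesis using C u s[OF u(2)] by blast
  next
    case False
    then obtain x y where "x \<in> C \<inter> W" "y \<in> W" "y \<notin> C \<inter> W" "R x y"
      using c unfolding connected_in_def by (metis Int_lower2 Diff_iff inf.absorb_iff2)
    thus ?thesis by auto
  qed
qed

text \<open>A partition of the quotient lifts to one of \<open>W\<close> by putting all of
  \<open>Z\<close> on the side of \<open>z\<close>; uniformity brings the crossing edge back
  down.\<close>

lemma connected_in_quotient:
  assumes c: "connected_in R W" and Z: "Z \<subseteq> W" "z \<in> Z"
    and unif: "\<And>x u. x \<in> Z \<Longrightarrow> u \<in> W - Z \<Longrightarrow> R x u \<longleftrightarrow> R z u" and s: "\<And>x y. R x y \<Longrightarrow> R y x"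
  shows "connected_in R (insert z (W - Z))"
  unfolding connected_in_def
proof (intro allI impI)
  fix C assume C: "C \<subseteq> insert z (W - Z)" "C \<noteq> {}" "C \<noteq> insert z (W - Z)"
  define C' where "C' = (if z \<in> C then C \<union> Z else C)"
  have "C' \<subseteq> W" "C' \<noteq> {}" "C' \<noteq> W" using C Z by (auto simp: C'_def split: if_splits)
  then obtain x y where xy: "x \<in> C'" "y \<in> W" "y \<notin> C'" "R x y"
    using c unfolding connected_in_def by (metis Diff_iff)
  show "\<exists>x\<in>C. \<exists>y\<in>insert z (W - Z) - C. R x y"
  proof (cases "z \<in> C")
    case True
    hence y: "y \<in> W - Z" "y \<notin> C" using xy by (auto simp: C'_def)
    show ?thesis
    proof (cases "x \<in> Z")
      case True' : True
      hence "R z y" using unif y xy by blast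
      thus ?thesis using True y by blast
    next
      case False
      hence "x \<in> C" using xy True by (auto simp: C'_def)
      thus ?thesis using y xy by blast
    qed
  next
    case False
    hence x: "x \<in> C" "x \<in> W - Z" using xy C by (auto simp: C'_def)
    show ?thesis
    proof (cases "y \<in> Z")
      case True
      hence "R z x" using unif[of y x] x xy s by blast
      thus ?thesis using False x s by blast
    next
      case False': False
      thus ?thesis using x xy False by (auto simp: C'_def)
    qed
  qed
qed

text \<open>Gallai's theorem on colourings without rainbow triangles, by deleting a vertex
  \<open>v\<close>: if all three colours are connected on \<open>W\<close>, none of them falls apart
  on \<open>W - {v}\<close>, and in the end two points cannot carry three colours.\<close>

lemma gallai_not_all_connected:
  assumes "finite W" "2 \<le> card W"
    and sym: "\<And>x y. R x y \<Longrightarrow> R y x" "\<And>x y. B x y \<Longrightarrow> B y x" "\<And>x y. G x y \<Longrightarrow> G y x"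
    and ex: "\<And>x y. x \<in> W \<Longrightarrow> y \<in> W \<Longrightarrow> x \<noteq> y \<Longrightarrow> R x y \<or> B x y \<or> G x y"
    and dis: "\<And>x y. \<not> (R x y \<and> B x y)" "\<And>x y. \<not> (R x y \<and> G x y)" "\<And>x y. \<not> (B x y \<and> G x y)"
    and rb: "\<And>x y z. x \<in> W \<Longrightarrow> y \<in> W \<Longrightarrow> z \<in> W \<Longrightarrow> R x y \<Longrightarrow> B y z \<Longrightarrow> \<not> G x z"
  shows "\<not> (connected_in R W \<and> connected_in B W \<and> connected_in G W)"
  using assms(1,2) ex rb
proof (induction "card W" arbitrary: W rule: less_induct)
  case less
  show ?case
  proof
    assume c: "connected_in R W \<and> connected_in B W \<and> connected_in G W"
    obtain v where v: "v \<in> W" using less.prems(2) by fastforce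
    let ?W = "W - {v}"
    \<comment> \<open>The names of the colours are left open, since the claim is applied to each of
      the three in turn.\<close>
    have step: "connected_in R' ?W"
      if c': "connected_in R' W" "connected_in B' W" "connected_in G' W"
        and sym': "\<And>x y. R' x y \<Longrightarrow> R' y x" "\<And>x y. B' x y \<Longrightarrow> B' y x" "\<And>x y. G' x y \<Longrightarrow> G' y x"
        and ex': "\<And>x y. x \<in> W \<Longrightarrow> y \<in> W \<Longrightarrow> x \<noteq> y \<Longrightarrow> R' x y \<or> B' x y \<or> G' x y"
        and dis': "\<And>x y. \<not> (R' x y \<and> B' x y)" "\<And>x y. \<not> (R' x y \<and> G' x y)" "\<And>x y. \<not> (B' x y \<and> G' x y)"
        and rb': "\<And>x y z. x \<in> W \<Longrightarrow> y \<in> W \<Longrightarrow> z \<in> W \<Longrightarrow> R' x y \<Longrightarrow> B' y z \<Longrightarrow> \<not> G' x z"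
      for R' B' G' :: "'a \<Rightarrow> 'a \<Rightarrow> bool"
    proof (rule ccontr)
      assume nc: "\<not> connected_in R' ?W"
      obtain w0 where "w0 \<in> ?W" using nc unfolding connected_in_def by fastforce
      obtain w where w: "w \<in> ?W" "B' v w"
        using connected_inE[OF c'(2), of "{v}" v w0] v \<open>w0 \<in> ?W\<close> by auto
      obtain w' where w': "w' \<in> ?W" "G' v w'"
        using connected_inE[OF c'(3), of "{v}" v w0] v \<open>w0 \<in> ?W\<close> by auto
      obtain C where C: "C \<subseteq> ?W" "w \<in> C" "connected_in R' C" and nC: "\<And>x y. x \<in> C \<Longrightarrow> y \<in> ?W - C \<Longrightarrow> \<not> R' x y"
        using component_exists[of w ?W R'] w sym'(1) by metis
      obtain e where e: "e \<in> ?W" "e \<notin> C"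
      proof -
        have "C \<noteq> ?W" using C(3) nc by auto
        thus ?thesis using C(1) that by blast
      qed
      \<comment> \<open>Otherwise consider the \<open>L\<close>-neighbours of \<open>w\<close> on
        the side of \<open>y\<close>. An \<open>R'\<close>-edge leaving this set can only end in
        \<open>v\<close>, and then \<open>w\<close>, \<open>z\<close>, \<open>v\<close> is a rainbow
        triangle.\<close>
      have spread: "K w y"
        if KL: "K = B' \<and> L = G' \<or> K = G' \<and> L = B'" and w: "w \<in> ?W" "K v w" and y: "y \<in> ?W" "(w \<in> C) = (y \<notin> C)"
        for K L w y
      proof (rule ccontr)
        assume n: "\<not> K w y"
        have wy: "\<not> R' w y" "w \<noteq> y" using nC[of w y] nC[of y w] w y sym'(1)[of w y] by auto
        hence L: "L w y" using n ex'[of w y] KL w y by auto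
        define P where "P z \<longleftrightarrow> z \<in> ?W \<and> (z \<in> C) = (y \<in> C) \<and> L w z" for z
        have "\<exists>z. P z \<and> R' z v"
        proof -
          have "{z. P z} \<subseteq> W" "y \<in> {z. P z}" "v \<in> W" "v \<notin> {z. P z}" using L y v by (auto simp: P_def)
          from connected_inE[OF c'(1) this] obtain z z' where z: "P z" "z' \<in> W" "\<not> P z'" "R' z z'" by auto
          have "z' = v"
          proof (rule ccontr)
            assume "z' \<noteq> v"
            hence z'W: "z' \<in> ?W" using z by auto
            hence side: "(z' \<in> C) = (y \<in> C)" using nC[of z z'] nC[of z' z] z sym'(1)[of z z'] by (auto simp: P_def)
            have "w \<noteq> z'" using side y by auto
            moreover have "\<not> R' w z'" using nC[of w z'] nC[of z' w] w z'W y side sym'(1)[of w z'] by auto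
            ultimately have "B' w z' \<or> G' w z'" using ex'[of w z'] w z'W by auto
            hence "L w z'"
              using rb'[of z' z w] rb'[of z z' w] z w z'W KL sym'(1)[of z z'] sym'(2,3)[of w z] sym'(2,3)[of w z']
                sym'(2,3)[of z' w] sym'(2,3)[of z w] by (auto simp: P_def)
            thus False using z z'W side by (auto simp: P_def)
          qed
          thus ?thesis using z by auto
        qed
        then obtain z where z: "P z" "R' z v" by auto
        show False using rb'[of z v w] rb'[of v z w] z w v KL sym'(1)[of z v] sym'(2,3)[of w z] sym'(2,3)[of z w]
          sym'(2,3)[of v w] by (auto simp: P_def)
      qed
      have we: "B' w e" using spread[of B' G' w e] w e C by auto
      \<comment> \<open>If \<open>w\<close> and \<open>w'\<close> lie on different sides, their edge
        gets two colours. On the same side, \<open>B'\<close> towards \<open>e\<close> travels from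
        \<open>w\<close> to \<open>w'\<close> along the \<open>R'\<close>-edges of \<open>C\<close>
        and collides with \<open>G'\<close>.\<close>
      show False
      proof (cases "w' \<in> C")
        case False
        have "B' w w'" using spread[of B' G' w w'] w w' C False by auto
        moreover have "G' w' w" using spread[of G' B' w' w] w w' C False by auto
        ultimately show False using dis'(3) sym'(3) by blast
      next
        case True
        have "B' w' e"
        proof (rule connected_in_class[where P="\<lambda>x. B' x e", OF C(3) C(2) True we])
          fix x y assume xy: "x \<in> C" "y \<in> C" "R' x y" "B' x e"
          have "\<not> R' y e" "y \<noteq> e" using nC[of y e] xy e by auto
          moreover have "\<not> G' y e" using rb'[of y x e] xy e C sym'(1)[of x y] by auto
          ultimately show "B' y e" using ex'[of y e] xy e C by auto
        qed
        moreover have "G' w' e" using spread[of G' B' w' e] w' e C True by auto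
        ultimately show False using dis'(3) by blast
      qed
    qed
    have "connected_in R ?W"
    proof (rule step[of R B G])
      show "connected_in R W" "connected_in B W" "connected_in G W" using c by simp_all
      fix x y
      show "R x y \<Longrightarrow> R y x" "B x y \<Longrightarrow> B y x" "G x y \<Longrightarrow> G y x" by (fact sym)+
      show "\<not> (R x y \<and> B x y)" "\<not> (R x y \<and> G x y)" "\<not> (B x y \<and> G x y)"
        using dis[of x y] by auto
      show "R x y \<or> B x y \<or> G x y" if "x \<in> W" "y \<in> W" "x \<noteq> y"
        using less.prems(3)[OF that] by auto
      show "\<not> G x z" if "x \<in> W" "y \<in> W" "z \<in> W" "R x y" "B y z" for z
        using that less.prems(4) sym by blast
    qed
    moreover have "connected_in B ?W"
    proof (rule step[of B R G])
      show "connected_in B W" "connected_in R W" "connected_in G W" using c by simp_all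
      fix x y
      show "B x y \<Longrightarrow> B y x" "R x y \<Longrightarrow> R y x" "G x y \<Longrightarrow> G y x" by (fact sym)+
      show "\<not> (B x y \<and> R x y)" "\<not> (B x y \<and> G x y)" "\<not> (R x y \<and> G x y)"
        using dis[of x y] by auto
      show "B x y \<or> R x y \<or> G x y" if "x \<in> W" "y \<in> W" "x \<noteq> y"
        using less.prems(3)[OF that] by auto
      show "\<not> G x z" if "x \<in> W" "y \<in> W" "z \<in> W" "B x y" "R y z" for z
        using that less.prems(4) sym by blast
    qed
    moreover have "connected_in G ?W"
    proof (rule step[of G R B])
      show "connected_in G W" "connected_in R W" "connected_in B W" using c by simp_all
      fix x y
      show "G x y \<Longrightarrow> G y x" "R x y \<Longrightarrow> R y x" "B x y \<Longrightarrow> B y x" by (fact sym)+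
      show "\<not> (G x y \<and> R x y)" "\<not> (G x y \<and> B x y)" "\<not> (R x y \<and> B x y)"
        using dis[of x y] by auto
      show "G x y \<or> R x y \<or> B x y" if "x \<in> W" "y \<in> W" "x \<noteq> y"
        using less.prems(3)[OF that] by auto
      show "\<not> B x z" if "x \<in> W" "y \<in> W" "z \<in> W" "G x y" "R y z" for z
        using that less.prems(4) sym by blast
    qed
    moreover have "2 \<le> card ?W"
    proof (rule ccontr)
      assume "\<not> ?thesis"
      hence "card W = 2" using less.prems(1,2) v by simp
      then obtain w where w: "W = {v, w}" "v \<noteq> w" by (metis card_2_iff doubleton_eq_iff insertE singletonD v)
      have "K v w" if "connected_in K W" for K
        using connected_inE[OF that, of "{v}" v w] w by auto
      thus False using c dis by blast
    qed
    moreover have "\<not> (connected_in R ?W \<and> connected_in B ?W \<and> connected_in G ?W)" if "2 \<le> card ?W"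
    proof (rule less.hyps)
      show "card ?W < card W" "finite ?W" using card_Diff1_less[OF less.prems(1) v] less.prems(1) by simp_all
      show "R x y \<or> B x y \<or> G x y" if "x \<in> ?W" "y \<in> ?W" "x \<noteq> y" for x y using less.prems(3) that by simp
      show "\<not> G x z" if "x \<in> ?W" "y \<in> ?W" "z \<in> ?W" "R x y" "B y z" for x y z
        using less.prems(4)[of x y z] that by simp
    qed fact
    ultimately show False by simp
  qed
qed


section \<open>Coloured pairs\<close>

text \<open>Pairs coloured by neither \<open>R\<close> nor \<open>B\<close> are the flat ones, those with \<open>a i j = a j i\<close>. Assumption \<open>T\<close>
  says that a triangle with both colours has no flat side and that the ends of the side with the
  odd colour are twins for the third vertex.\<close>

locale clan_colouring =
  fixes U :: "'i set" and a :: "'i \<Rightarrow> 'i \<Rightarrow> 'k" and R B :: "'i \<Rightarrow> 'i \<Rightarrow> bool"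
  assumes finU: "finite U"
    and R_sym: "R i j \<Longrightarrow> R j i" and B_sym: "B i j \<Longrightarrow> B j i"
    and R_irr: "\<not> R i i" and B_irr: "\<not> B i i" and RB: "\<not> (R i j \<and> B i j)"
    and nonflat: "i \<in> U \<Longrightarrow> j \<in> U \<Longrightarrow> i \<noteq> j \<Longrightarrow> a i j \<noteq> a j i \<longleftrightarrow> R i j \<or> B i j"
    and T: "i \<in> U \<Longrightarrow> j \<in> U \<Longrightarrow> k \<in> U \<Longrightarrow> R i j \<Longrightarrow> B i k \<Longrightarrow>
      (R j k \<and> undistinguished a i k j) \<or> (B j k \<and> undistinguished a i j k)"
    and S: "i \<in> U \<Longrightarrow> j \<in> U \<Longrightarrow> k \<in> U \<Longrightarrow> i \<noteq> j \<Longrightarrow> j \<noteq> k \<Longrightarrow> i \<noteq> k \<Longrightarrow>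
      a i j = a j i \<Longrightarrow> a j k = a k j \<Longrightarrow> a i k \<noteq> a k i \<Longrightarrow> undistinguished a i k j"
    and P4: "i \<in> U \<Longrightarrow> j \<in> U \<Longrightarrow> k \<in> U \<Longrightarrow> l \<in> U \<Longrightarrow>
      R i j \<Longrightarrow> R j k \<Longrightarrow> R k l \<Longrightarrow> B i k \<Longrightarrow> B i l \<Longrightarrow> B j l \<Longrightarrow>
      (a i l = a i j \<and> a l i = a j i) \<or> (a i l = a j i \<and> a l i = a i j)"
begin

lemma RBD: "R i j \<Longrightarrow> B i j \<Longrightarrow> False" "R i j \<Longrightarrow> B j i \<Longrightarrow> False"
  using RB B_sym by blast+

text \<open>The odd side of a triangle with both colours is the one whose colour occurs once: the
  first side here, the second in \<open>odd_right\<close>.\<close>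

lemma odd_left: "i \<in> U \<Longrightarrow> j \<in> U \<Longrightarrow> k \<in> U \<Longrightarrow> R i j \<Longrightarrow> B i k \<Longrightarrow> B j k \<Longrightarrow> undistinguished a i j k"
  using T[of i j k] RBD by blast

lemma odd_right: "i \<in> U \<Longrightarrow> j \<in> U \<Longrightarrow> k \<in> U \<Longrightarrow> R i j \<Longrightarrow> B i k \<Longrightarrow> R j k \<Longrightarrow> undistinguished a i k j"
  using T[of i j k] RBD by blast

lemma T3: "i \<in> U \<Longrightarrow> j \<in> U \<Longrightarrow> k \<in> U \<Longrightarrow> R i j \<Longrightarrow> B i k \<Longrightarrow> R j k \<or> B j k"
  using T by blast

text \<open>The red path \<open>i\<close>, \<open>j\<close>, \<open>k\<close>, \<open>l\<close> has
  a blue path as complement, so each of its four triangles has an odd side. This gives all red edges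
  one label in alternating directions, and likewise all blue edges; \<open>P4\<close> makes the two
  labels equal up to reversal.\<close>

lemma P4_full:
  assumes "i \<in> U" "j \<in> U" "k \<in> U" "l \<in> U" "R i j" "R j k" "R k l" "B i k" "B i l" "B j l"
  shows "a k j = a i j" "a j k = a j i" "a k l = a i j" "a l k = a j i" "a j l = a i l" "a l j = a l i"
    "a i k = a i l" "a k i = a l i" "(a i l = a i j \<and> a l i = a j i) \<or> (a i l = a j i \<and> a l i = a i j)"
proof -
  have "undistinguished a i k j" using odd_right[of i j k] assms by blast
  moreover have "undistinguished a j l k" using odd_right[of j k l] assms by blast
  moreover have "undistinguished a i j l" using odd_left[of i j l] assms by blast
  moreover have "undistinguished a k l i" using odd_left[of k l i] assms B_sym by blast
  ultimately show "a k j = a i j" "a j k = a j i" "a k l = a i j" "a l k = a j i" "a j l = a i l" "a l j = a l i"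
    "a i k = a i l" "a k i = a l i" unfolding undistinguished_def by metis+
  show "(a i l = a i j \<and> a l i = a j i) \<or> (a i l = a j i \<and> a l i = a i j)" using P4 assms by blast
qed

text \<open>The path on four vertices is isomorphic to its complement, so \<open>P4\<close> passes
  to the exchanged colours after the relabelling \<open>j\<close>, \<open>l\<close>,
  \<open>i\<close>, \<open>k\<close>.\<close>

lemma swap_colours: "clan_colouring U a B R"
proof
  show "finite U" by (rule finU)
  show "B i j \<Longrightarrow> B j i" "R i j \<Longrightarrow> R j i" "\<not> B i i" "\<not> R i i" "\<not> (B i j \<and> R i j)" for i j
    using B_sym R_sym B_irr R_irr RB by blast+
  show "a i j \<noteq> a j i \<longleftrightarrow> B i j \<or> R i j" if "i \<in> U" "j \<in> U" "i \<noteq> j" for i j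
    using nonflat that by blast
  show "B j k \<and> undistinguished a i k j \<or> R j k \<and> undistinguished a i j k"
    if "i \<in> U" "j \<in> U" "k \<in> U" "B i j" "R i k" for i j k
    using T[of i k j] that R_sym B_sym by blast
  show "undistinguished a i k j"
    if "i \<in> U" "j \<in> U" "k \<in> U" "i \<noteq> j" "j \<noteq> k" "i \<noteq> k" "a i j = a j i" "a j k = a k j" "a i k \<noteq> a k i" for i j k
    using S that by blast
  show "(a i l = a i j \<and> a l i = a j i) \<or> (a i l = a j i \<and> a l i = a i j)"
    if "i \<in> U" "j \<in> U" "k \<in> U" "l \<in> U" "B i j" "B j k" "B k l" "R i k" "R i l" "R j l" for i j k l
    using P4_full[of j l i k] that R_sym B_sym by metis
qed

lemma transpose_colouring: "clan_colouring U (\<lambda>i j. a j i) R B"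
proof
  show "finite U" by (rule finU)
  show "R i j \<Longrightarrow> R j i" "B i j \<Longrightarrow> B j i" "\<not> R i i" "\<not> B i i" "\<not> (R i j \<and> B i j)" for i j
    using B_sym R_sym B_irr R_irr RB by blast+
  show "a j i \<noteq> a i j \<longleftrightarrow> R i j \<or> B i j" if "i \<in> U" "j \<in> U" "i \<noteq> j" for i j
    using nonflat[of i j] that by metis
  show "R j k \<and> undistinguished (\<lambda>i j. a j i) i k j \<or> B j k \<and> undistinguished (\<lambda>i j. a j i) i j k"
    if "i \<in> U" "j \<in> U" "k \<in> U" "R i j" "B i k" for i j k
    using T[of i j k] that unfolding undistinguished_def by blast
  show "undistinguished (\<lambda>i j. a j i) i k j"
    if "i \<in> U" "j \<in> U" "k \<in> U" "i \<noteq> j" "j \<noteq> k" "i \<noteq> k" "a j i = a i j" "a k j = a j k" "a k i \<noteq> a i k" for i j k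
    using S[of i j k] that unfolding undistinguished_def by metis
  show "(a l i = a j i \<and> a i l = a i j) \<or> (a l i = a i j \<and> a i l = a j i)"
    if "i \<in> U" "j \<in> U" "k \<in> U" "l \<in> U" "R i j" "R j k" "R k l" "B i k" "B i l" "B j l" for i j k l
    using P4[of i j k l] that by blast
qed

lemma restrict_colouring: "W \<subseteq> U \<Longrightarrow> clan_colouring W a R B"
  by (unfold_locales; (meson subsetD finite_subset finU R_sym B_sym R_irr B_irr RB nonflat T S P4)?)

section \<open>Primitive structures in which both colours occur\<close>

text \<open>A red component \<open>C\<close> is a clan: for a red edge \<open>x\<close>,
  \<open>y\<close> in it and \<open>k\<close> outside, the pairs with \<open>k\<close> are both blue
  or both flat, and then the odd side or \<open>S\<close> makes \<open>x\<close> and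
  \<open>y\<close> twins for \<open>k\<close>.\<close>

lemma red_connected:
  assumes prim: "primitive U a" and r: "r \<in> U" "r' \<in> U" "R r r'"
  shows "connected_in R U"
proof -
  obtain C where C: "C \<subseteq> U" "r \<in> C" "connected_in R C" and nC: "\<And>x y. x \<in> C \<Longrightarrow> y \<in> U - C \<Longrightarrow> \<not> R x y"
    using component_exists[of r U R] r R_sym by metis
  have "clan U a C" unfolding clan_def
  proof (intro conjI ballI)
    fix i j k assume i: "i \<in> C" and j: "j \<in> C" and k: "k \<in> U - C"
    show "undistinguished a i j k"
    proof (rule connected_in_class[where P = "\<lambda>x. undistinguished a i x k", OF C(3) i j])
      fix x y assume xy: "x \<in> C" "y \<in> C" "R x y" "undistinguished a i x k"
      have U: "x \<in> U" "y \<in> U" "k \<in> U" using xy C k by auto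
      have n: "\<not> R x k" "\<not> R y k" "x \<noteq> k" "y \<noteq> k" "x \<noteq> y" using nC k xy R_irr by auto
      have "undistinguished a x y k"
      proof (cases "B x k")
        case True
        thus ?thesis using odd_left[of x y k] T3[of x y k] U xy n by blast
      next
        case False
        hence fx: "a x k = a k x" using nonflat[of x k] U n by blast
        have "\<not> B y k" using T3[of y x k] U xy n False R_sym by blast
        hence fy: "a k y = a y k" using nonflat[of y k] U n by metis
        have "a x y \<noteq> a y x" using nonflat[of x y] U n xy by blast
        thus ?thesis using S[of x k y] U n fx fy by metis
      qed
      thus "undistinguished a i y k" using xy undist_trans by metis
    qed simp
  qed (rule C)
  moreover have "r' \<in> C" using nC[OF C(2), of r'] r by blast
  hence "2 \<le> card C" using card_two_le[of C r r'] C r R_irr finU finite_subset by metis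
  ultimately have "C = U" using prim unfolding primitive_def by blast
  thus ?thesis using C by simp
qed

text \<open>A flat edge inside \<open>G\<close> cannot be a side of a triangle with both colours, so
  the colour towards \<open>k\<close> is constant along flat edges.\<close>

lemma flat_component_uniform:
  assumes G: "G \<subseteq> U" "connected_in (\<lambda>x y. x \<noteq> y \<and> a x y = a y x) G"
    and nG: "\<And>x y. x \<in> G \<Longrightarrow> y \<in> U - G \<Longrightarrow> a x y \<noteq> a y x"
    and k: "k \<in> U - G" and g: "g \<in> G" "g' \<in> G" "R g k"
  shows "R g' k"
proof (rule connected_in_class[where P = "\<lambda>x. R x k", OF G(2) g])
  fix u v assume uv: "u \<in> G" "v \<in> G" "u \<noteq> v \<and> a u v = a v u" "R u k"
  have U: "u \<in> U" "v \<in> U" "k \<in> U" "v \<noteq> k" using uv G k by auto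
  have "\<not> B v k"
    using T3[of k u v] U uv R_sym B_sym nonflat[of u v] by blast
  thus "R v k" using nonflat[of v k] nG[of v k] U uv k by blast
qed

text \<open>Were \<open>i\<close> and \<open>i'\<close> distinguished by \<open>k\<close>, the set \<open>P\<close> below would be a proper clan containing them.\<close>

lemma flat_component_undistinguished:
  assumes prim: "primitive U a" and conn: "connected_in B U"
    and G: "G \<subseteq> U" "connected_in (\<lambda>x y. x \<noteq> y \<and> a x y = a y x) G"
    and nG: "\<And>x y. x \<in> G \<Longrightarrow> y \<in> U - G \<Longrightarrow> a x y \<noteq> a y x"
    and i: "i \<in> G" "i' \<in> G" and k: "k \<in> U - G" and Rik: "R i k"
  shows "undistinguished a i i' k"
proof (rule ccontr)
  assume nd: "\<not> undistinguished a i i' k"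
  interpret sw: clan_colouring U a B R by (rule swap_colours)
  have Runi: "R x l \<Longrightarrow> R y l" if "x \<in> G" "y \<in> G" "l \<in> U - G" for x y l
    using flat_component_uniform[OF G nG that(3,1,2)] by blast
  have Buni: "B x l \<Longrightarrow> B y l" if "x \<in> G" "y \<in> G" "l \<in> U - G" for x y l
    using sw.flat_component_uniform[OF G nG that(3,1,2)] by blast
  have iU: "i \<in> U" "i' \<in> U" "k \<in> U" using i k G by auto
  have Rk: "R g k" if "g \<in> G" for g using Runi[OF i(1) that k Rik] .
  \<comment> \<open>By uniformity these points are blue to all of \<open>G\<close>; blue
    connectivity provides at least one.\<close>
  define Bn where "Bn = {b\<in>U - G. B i b}"
  obtain b0 where b0: "b0 \<in> Bn"
  proof -
    obtain g b where "g \<in> G" "b \<in> U" "b \<notin> G" "B g b"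
      using connected_inE[OF conn G(1) i(1) iU(3)] k by auto
    hence "b \<in> Bn" using Buni[of g i b] i by (auto simp: Bn_def)
    thus ?thesis by (rule that)
  qed
  have kb: "B k b \<and> (\<forall>g\<in>G. undistinguished a g k b)" if b: "b \<in> Bn" for b
  proof -
    have bU: "b \<in> U" "b \<in> U - G" "B i b" using b by (auto simp: Bn_def)
    have Bg: "B g b" if "g \<in> G" for g using Buni[OF i(1) that bU(2,3)] .
    \<comment> \<open>Otherwise \<open>i\<close> and \<open>i'\<close> would both be twins of
      \<open>b\<close> for \<open>k\<close>, hence of each other.\<close>
    have "\<not> R k b"
    proof
      assume "R k b"
      hence "undistinguished a i b k" "undistinguished a i' b k"
        using odd_right[of i k b] odd_right[of i' k b] iU bU Rk i Bg by blast+
      thus False using nd undist_trans undist_sym by metis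
    qed
    hence kb: "B k b" using T3[of i k b] iU bU Rk i by blast
    moreover have "undistinguished a g k b" if "g \<in> G" for g
      using odd_left[of g k b] that G iU bU Rk Bg kb by blast
    ultimately show ?thesis by blast
  qed
  \<comment> \<open>The points which \<open>Bn\<close> sees as it sees \<open>i\<close>. They
    include \<open>G\<close>, and whatever lies outside \<open>F\<close> and \<open>Bn\<close> is
    red to \<open>i\<close> and to some point of \<open>Bn\<close>.\<close>
  define F where "F = {f\<in>U - Bn. \<forall>b\<in>Bn. B f b \<and> undistinguished a f i b}"
  have GF: "g \<in> F" if "g \<in> G" for g
  proof -
    have "g \<notin> Bn" using that by (auto simp: Bn_def)
    moreover have "B g b" if "b \<in> Bn" for b using that Buni[OF i(1) \<open>g \<in> G\<close>] by (auto simp: Bn_def)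
    moreover have "undistinguished a g i b" if "b \<in> Bn" for b
      using kb[OF that] \<open>g \<in> G\<close> i undist_trans undist_sym by metis
    ultimately show ?thesis using that G by (auto simp: F_def)
  qed
  have out: "R i l \<and> l \<notin> G \<and> (\<exists>b\<in>Bn. R l b)" if l: "l \<in> U - F - Bn" for l
  proof -
    have lG: "l \<notin> G" "l \<noteq> i" "l \<in> U" using l GF i by auto
    have il: "R i l"
      using nG[OF i(1), of l] nonflat[of i l] lG iU l by (auto simp: Bn_def)
    obtain b where b: "b \<in> Bn" "\<not> (B l b \<and> undistinguished a l i b)" using l lG by (auto simp: F_def)
    have bU: "b \<in> U" "B i b" using b by (auto simp: Bn_def)
    have "R l b" using T[of i l b] iU lG bU il b undist_sym[of a i l b] by blast
    thus ?thesis using il lG b by blast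
  qed
  \<comment> \<open>The points outside \<open>F\<close> and \<open>Bn\<close> may still split
    \<open>F\<close>; \<open>P\<close> keeps the part which they see as they see
    \<open>i\<close>.\<close>
  define P where "P = {n\<in>F. \<forall>l\<in>U - F - Bn. undistinguished a n i l}"
  have PF: "P \<subseteq> U" by (auto simp: P_def F_def)
  have "clan U a P" unfolding clan_def
  proof (intro conjI ballI, rule PF, rule ccontr)
    fix n1 n2 n assume n12: "n1 \<in> P" "n2 \<in> P" and n: "n \<in> U - P" and d: "\<not> undistinguished a n1 n2 n"
    have nBn: "n \<notin> Bn"
    proof
      assume "n \<in> Bn"
      hence "undistinguished a n1 i n" "undistinguished a n2 i n" using n12 by (auto simp: P_def F_def)
      thus False using d undist_trans undist_sym by metis
    qed
    have nF: "n \<in> F"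
    proof (rule ccontr)
      assume "n \<notin> F"
      hence "undistinguished a n1 i n" "undistinguished a n2 i n" using n nBn n12 by (auto simp: P_def)
      thus False using d undist_trans undist_sym by metis
    qed
    have "\<forall>l\<in>U - F - Bn. undistinguished a n i l"
    proof
      fix l assume l: "l \<in> U - F - Bn"
      obtain b where il: "R i l" "l \<notin> G" and b: "b \<in> Bn" "R l b" using out[OF l] by blast
      have U: "n \<in> U" "l \<in> U" "b \<in> U" "i \<in> U" using n l b iU by (auto simp: Bn_def)
      have nb: "B n b" "undistinguished a n i b" and ib: "B i b" using nF b by (auto simp: F_def Bn_def)
      have ibl: "undistinguished a i b l" using odd_right[of i l b] U il b ib by blast
      have "R l n \<or> B l n" using T3[of b l n] U b nb R_sym B_sym by blast
      thus "undistinguished a n i l"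
      proof
        assume "R l n"
        hence "undistinguished a n b l" using odd_right[of n l b] U nb b R_sym by blast
        thus ?thesis using ibl undist_trans undist_sym by metis
      next
        assume nl: "B l n"
        have nonG: "R i m" if "m \<in> F" "B l m" for m
        proof -
          have mU: "m \<in> U" "m \<notin> Bn" using that by (auto simp: F_def)
          have "m \<notin> G" using Runi[OF i(1), of m l] il U that RBD R_sym by blast
          hence "a i m \<noteq> a m i" "i \<noteq> m" using nG[OF i(1), of m] mU i by auto
          thus ?thesis using nonflat[of i m] mU U \<open>m \<notin> G\<close> by (auto simp: Bn_def)
        qed
        \<comment> \<open>The red path \<open>m\<close>, \<open>i\<close>, \<open>l\<close>,
          \<open>b\<close> has a blue complement, so \<open>P4_full\<close> reduces all its labels
          to one label and its reversal.\<close>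
        have p4: "a i m = a i l \<and> a m i = a l i"
            "a m b = a i b \<and> a b m = a b i" "a m l = a i b \<and> a l m = a b i"
            "a i b = a l i \<and> a b i = a i l \<or> a i b = a i l \<and> a b i = a l i" if "m \<in> F" "B l m" for m
        proof -
          have "m \<in> U" "B m b" using that b by (auto simp: F_def)
          note p = P4_full[of m i l b]
          show "a i m = a i l \<and> a m i = a l i"
            "a m b = a i b \<and> a b m = a b i" "a m l = a i b \<and> a l m = a b i"
            "a i b = a l i \<and> a b i = a i l \<or> a i b = a i l \<and> a b i = a l i"
            using p U \<open>m \<in> U\<close> \<open>B m b\<close> that nonG[OF that] il b ib R_sym B_sym by metis+
        qed
        have ne: "a i l \<noteq> a l i" using nonflat[of i l] U il R_irr by metis
        show ?thesis
        proof (cases "a i b = a i l \<and> a b i = a l i")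
          case True
          thus ?thesis using p4(3)[OF nF nl] unfolding undistinguished_def by metis
        next
          case False
          \<comment> \<open>In the reversed case \<open>n\<close> is not shown to be a twin of
            \<open>i\<close> for \<open>l\<close>. Instead all \<open>m\<close> in \<open>P\<close>
            have the same label towards \<open>n\<close>, although \<open>n\<close> separates
            \<open>n1\<close> from \<open>n2\<close>.\<close>
          hence rev: "a i b = a l i" "a b i = a i l" using p4(4)[OF nF nl] by auto
          have "a m n = a i l \<and> a n m = a l i" if m: "m \<in> P" for m
          proof -
            have mF: "m \<in> F" "m \<in> U" and ml: "a m l = a i l" "a l m = a l i"
              using m l by (auto simp: P_def F_def undistinguished_def)
            have "\<not> B l m" using p4(3)[of m] mF ml ne rev by metis
            moreover have "m \<noteq> l" using mF l by auto
            ultimately have Rml: "R l m" using nonflat[of l m] U mF ml ne by metis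
            have "R m n \<or> B m n" using T3[of l m n] U mF Rml nl by blast
            thus ?thesis
            proof
              assume "R m n"
              hence "undistinguished a l n m" using odd_right[of l m n] U mF Rml nl by blast
              thus ?thesis using ml unfolding undistinguished_def by metis
            next
              assume "B m n"
              hence "undistinguished a l m n" using odd_left[of l m n] U mF Rml nl by blast
              thus ?thesis using p4(3)[OF nF nl] rev unfolding undistinguished_def by metis
            qed
          qed
          thus ?thesis using d n12 unfolding undistinguished_def by metis
        qed
      qed
    qed
    thus False using nF n by (simp add: P_def)
  qed
  moreover have "2 \<le> card P"
  proof (rule card_two_le)
    show "finite P" using PF finU finite_subset by blast
    show "i \<noteq> i'" using nd by auto
    show "i \<in> P" using i GF by (auto simp: P_def)
    show "i' \<in> P"
    proof -
      have "undistinguished a i' i l" if "l \<in> U - F - Bn" for l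
      proof -
        obtain b where il: "R i l" "l \<notin> G" and b: "b \<in> Bn" "R l b" using out \<open>l \<in> U - F - Bn\<close> by blast
        have "l \<in> U" "b \<in> U" "b \<in> U - G" "B i b" using that b by (auto simp: Bn_def)
        moreover hence "R i' l" "B i' b" using Runi[OF i(1,2), of l] Buni[OF i(1,2), of b] il by auto
        ultimately have "undistinguished a i b l" "undistinguished a i' b l"
          using odd_right[of i l b] odd_right[of i' l b] iU il b by blast+
        thus ?thesis using undist_trans undist_sym by metis
      qed
      thus ?thesis using i GF by (auto simp: P_def)
    qed
  qed
  ultimately have "P = U" using prim unfolding primitive_def by blast
  thus False using b0 by (auto simp: P_def F_def Bn_def)
qed

text \<open>The flat component of \<open>i\<close> contains \<open>j\<close>. If it is proper, it is
  a clan of at least two points; if it is \<open>U\<close>, then flat, red and blue are all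
  connected, against Gallai's theorem, as a triangle with both colours has no flat side.\<close>

lemma no_flat_pair:
  assumes prim: "primitive U a" and c: "connected_in R U" "connected_in B U" and ij: "i \<in> U" "j \<in> U" "i \<noteq> j"
  shows "R i j \<or> B i j"
proof (rule ccontr)
  assume n: "\<not> (R i j \<or> B i j)"
  interpret sw: clan_colouring U a B R by (rule swap_colours)
  let ?F = "\<lambda>x y. x \<noteq> y \<and> a x y = a y x"
  obtain G where G: "G \<subseteq> U" "i \<in> G" "connected_in ?F G" and nG': "\<And>x y. x \<in> G \<Longrightarrow> y \<in> U - G \<Longrightarrow> \<not> ?F x y"
    using component_exists[of i U ?F] ij by (metis (mono_tags, lifting))
  have nG: "a x y \<noteq> a y x" if "x \<in> G" "y \<in> U - G" for x y using nG'[OF that] that by blast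
  have jG: "j \<in> G" using nG[OF G(2), of j] nonflat[of i j] ij n by auto
  have "G \<noteq> U"
  proof
    assume "G = U"
    moreover have "\<not> (connected_in R U \<and> connected_in B U \<and> connected_in (\<lambda>x y. x \<in> U \<and> y \<in> U \<and> ?F x y) U)"
    proof (rule gallai_not_all_connected[OF finU card_two_le[OF finU ij]])
      show "R x y \<or> B x y \<or> x \<in> U \<and> y \<in> U \<and> ?F x y" if "x \<in> U" "y \<in> U" "x \<noteq> y" for x y
        using nonflat[of x y] that by blast
      show "\<not> (R x y \<and> B x y)" for x y by (rule RB)
      show "\<not> (R x y \<and> x \<in> U \<and> y \<in> U \<and> ?F x y)" "\<not> (B x y \<and> x \<in> U \<and> y \<in> U \<and> ?F x y)" for x y
        using nonflat[of x y] by blast+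
      show "\<not> (x \<in> U \<and> z \<in> U \<and> ?F x z)" if "x \<in> U" "y \<in> U" "z \<in> U" "R x y" "B y z" for x y z
        using T3[of y x z] nonflat[of x z] that R_sym by blast
    qed (use R_sym B_sym in auto)
    moreover have "connected_in (\<lambda>x y. x \<in> U \<and> y \<in> U \<and> ?F x y) U" if "connected_in ?F U"
      using that unfolding connected_in_def by (meson DiffD1 subsetD)
    ultimately show False using c G by simp
  qed
  moreover have "clan U a G" unfolding clan_def
  proof (intro conjI ballI)
    fix x y k assume x: "x \<in> G" and y: "y \<in> G" and k: "k \<in> U - G"
    have "R x k \<or> B x k" using nG[OF x k] nonflat[of x k] x k G by blast
    thus "undistinguished a x y k"
      using flat_component_undistinguished[OF prim c(2) G(1,3) nG x y k]
        sw.flat_component_undistinguished[OF prim c(1) G(1,3) nG x y k] by blast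
  qed (rule G)
  moreover have "2 \<le> card G" using card_two_le[OF _ G(2) jG ij(3)] G finU finite_subset by blast
  ultimately show False using prim unfolding primitive_def by blast
qed

end


section \<open>Linear cuts and the theorem of Hartfiel and Loewy\<close>

text \<open>All pairs across the cut have the same label, so \<open>I\<close> and its complement are
  both clans. A primitive structure with at least three points therefore has no linear cut.\<close>

definition linear_cut :: "'i set \<Rightarrow> ('i \<Rightarrow> 'i \<Rightarrow> 'k) \<Rightarrow> 'k \<Rightarrow> 'k \<Rightarrow> 'i set \<Rightarrow> bool" where
  "linear_cut W a x y I \<longleftrightarrow> I \<noteq> {} \<and> I \<subset> W \<and> (\<forall>i\<in>I. \<forall>j\<in>W - I. a i j = x \<and> a j i = y)"

context clan_colouring
begin

text \<open>The elements of \<open>M\<close> that are not \<open>good\<close> form a linear cut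
  which contains \<open>w0\<close> but not \<open>i0\<close>, against the minimality of
  \<open>M\<close>. The point \<open>j0\<close> outside \<open>M\<close> is where labels at
  \<open>u\<close> and labels inside \<open>M\<close> are compared.\<close>

lemma linear_cut_core:
  assumes u: "u \<in> U" and gf: "\<And>i j. i \<in> U \<Longrightarrow> j \<in> U \<Longrightarrow> i \<noteq> j \<Longrightarrow> R i j \<or> B i j" and xy: "x \<noteq> y"
    and M: "linear_cut (U - {u}) a x y M" and min: "\<And>I. linear_cut (U - {u}) a x y I \<Longrightarrow> \<not> I \<subset> M"
    and j0: "j0 \<in> U - {u}" "\<And>i. i \<in> M \<Longrightarrow> a i j0 = x \<and> a j0 i = y" "\<not> (a u j0 = x \<and> a j0 u = y)" "B j0 u"
      and Rj0: "\<And>w. w \<in> M \<Longrightarrow> R w u \<Longrightarrow> R w j0 \<and> a w u = x \<and> a u w = y"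
    and i0: "i0 \<in> M" "\<not> (a i0 u = x \<and> a u i0 = y)"
    and Q: "\<And>i. i \<in> M \<Longrightarrow> \<not> (a i u = x \<and> a u i = y) \<Longrightarrow> B i u"
    and w0: "w0 \<in> M" "R w0 u"
  shows False
proof -
  have MU: "m \<in> U" "m \<noteq> u" if "m \<in> M" for m using M that unfolding linear_cut_def by blast+
  have j0M: "j0 \<notin> M" "j0 \<in> U"
    using j0(1) j0(2)[of j0] xy by auto
  \<comment> \<open>Modelled on \<open>i0\<close>: blue to \<open>u\<close>, and receiving red edges
    with the label \<open>x\<close>, \<open>y\<close> from the red neighbours of \<open>u\<close> in
    \<open>M\<close>.\<close>
  define good where "good q \<longleftrightarrow> q \<in> M \<and> B q u \<and> (\<forall>w\<in>M. R w u \<longrightarrow> R w q \<and> a w q = x \<and> a q w = y)" for q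
  have base: "good i" if i: "i \<in> M" "\<not> (a i u = x \<and> a u i = y)" for i
    unfolding good_def
  proof (intro conjI ballI impI)
    show "i \<in> M" "B i u" using i Q by auto
    fix w assume w: "w \<in> M" "R w u"
    note U = MU[OF i(1)] MU[OF w(1)] u j0M
    have iu: "B i u" using Q i by blast
    have wi: "w \<noteq> i" using w iu RBD by blast
    have wj: "R w j0" "a w u = x" "a u w = y" using Rj0[OF w] by auto
    have ij: "a i j0 = x" "a j0 i = y" using j0(2) i by auto
    have "R w i"
    proof (rule ccontr)
      assume "\<not> R w i"
      hence wiB: "B w i" using gf[of w i] U wi by blast
      have "undistinguished a w u i" using odd_left[of w u i] U w wiB iu B_sym by blast
      hence e1: "a w i = a u i" "a i w = a i u" by (auto simp: undistinguished_def)
      have "R j0 i \<or> B j0 i" using T3[of w j0 i] U wj wiB by blast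
      thus False
      proof
        assume "B j0 i"
        hence "undistinguished a w j0 i" using odd_left[of w j0 i] U wj wiB by blast
        thus False using e1 ij i by (auto simp: undistinguished_def)
      next
        assume "R j0 i"
        \<comment> \<open>The blue label of this path is the red one or its reversal; one
          alternative contradicts the choice of \<open>i\<close>, the other that of
          \<open>j0\<close>.\<close>
        note p = P4_full[of u w j0 i]
        have "a u j0 = a u i" "a j0 u = a i u" "(a u i = a u w \<and> a i u = a w u) \<or> (a u i = a w u \<and> a i u = a u w)"
          using p U w wj wiB iu j0(4) \<open>R j0 i\<close> R_sym B_sym by metis+
        thus False using wj i j0(3) by auto
      qed
    qed
    thus "R w i" .
    have "undistinguished a i u w" using odd_right[of i w u] U w iu \<open>R w i\<close> R_sym by blast
    thus "a w i = x" "a i w = y" using wj by (auto simp: undistinguished_def)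
  qed
  \<comment> \<open>By \<open>base\<close> such a \<open>p\<close> has the label \<open>x\<close>,
    \<open>y\<close> towards \<open>u\<close>. If its label towards \<open>q\<close> were different,
    all that makes \<open>q\<close> good would carry over to \<open>p\<close>.\<close>
  have closed: "a p q = x \<and> a q p = y" if p: "p \<in> M" "\<not> good p" and q: "good q" for p q
  proof (rule ccontr)
    assume n: "\<not> (a p q = x \<and> a q p = y)"
    note U = MU[OF p(1)] u
    have qM: "q \<in> M" "q \<in> U" "B q u" "q \<noteq> u" using q MU by (auto simp: good_def)
    have pu: "a p u = x" "a u p = y" using base p by blast+
    have "\<not> R p u" using q p n by (auto simp: good_def)
    hence pB: "B p u" using gf[of p u] U by blast
    have pq: "p \<noteq> q" using p q by auto
    have "R w p \<and> a w p = x \<and> a p w = y" if w: "w \<in> M" "R w u" for w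
    proof -
      note wU = MU[OF w(1)]
      have wq: "R w q" "a w q = x" "a q w = y" using q w by (auto simp: good_def)
      have wu: "a w u = x" "a u w = y" using Rj0[OF w] by auto
      have wp: "w \<noteq> p" using w \<open>\<not> R p u\<close> by auto
      have "R w p"
      proof (rule ccontr)
        assume "\<not> R w p"
        hence wpB: "B w p" using gf[of w p] U wU wp by blast
        have "undistinguished a w u p" using odd_left[of w u p] U wU w wpB pB B_sym by blast
        hence e: "a w p = y" "a p w = x" using pu by (auto simp: undistinguished_def)
        have "R q p \<or> B q p" using T3[of w q p] U wU qM wq wpB by blast
        thus False
        proof
          assume "R q p"
          hence "undistinguished a w p q" using odd_right[of w q p] U wU qM wq wpB by blast
          thus False using n wq by (auto simp: undistinguished_def)
        next
          assume "B q p"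
          hence "undistinguished a w q p" using odd_left[of w q p] U wU qM wq wpB by blast
          thus False using n e by (auto simp: undistinguished_def)
        qed
      qed
      moreover have "undistinguished a p u w" using odd_right[of p w u] U wU w pB \<open>R w p\<close> R_sym by blast
      ultimately show ?thesis using wu by (auto simp: undistinguished_def)
    qed
    hence "good p" using p pB by (auto simp: good_def)
    thus False using p by simp
  qed
  define I where "I = {p\<in>M. \<not> good p}"
  have "w0 \<in> I" using w0 RBD by (auto simp: I_def good_def)
  moreover have "i0 \<in> M - I" using base i0 by (auto simp: I_def)
  moreover have "linear_cut (U - {u}) a x y I"
    unfolding linear_cut_def
  proof (intro conjI ballI)
    show "I \<noteq> {}" using \<open>w0 \<in> I\<close> by auto
    show "I \<subset> U - {u}" using \<open>i0 \<in> M - I\<close> MU by (auto simp: I_def)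
    fix i j assume ij: "i \<in> I" "j \<in> U - {u} - I"
    have "a i j = x \<and> a j i = y"
    proof (cases "j \<in> M")
      case True thus ?thesis using closed[of i j] ij by (auto simp: I_def)
    next
      case False thus ?thesis using M ij unfolding linear_cut_def I_def by blast
    qed
    thus "a i j = x" "a j i = y" by auto
  qed
  ultimately show False using min[of I] by (auto simp: I_def)
qed

lemma linear_cut_transpose:
  "linear_cut W (\<lambda>i j. a j i) x y (W - I) \<longleftrightarrow> linear_cut W a x y I" if "I \<subseteq> W" for W I x y
proof -
  have "W - (W - I) = I" using that by blast
  thus ?thesis using that unfolding linear_cut_def by blast
qed

text \<open>\<open>M\<close> and \<open>N\<close> are minimal cuts from the two ends, each with a
  point whose label to \<open>u\<close> is wrong. All wrong points have the same colour to
  \<open>u\<close>, here blue. A red neighbour \<open>r\<close> of \<open>u\<close> must then lie in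
  \<open>M\<close> or in \<open>N\<close>, and \<open>linear_cut_core\<close> refutes both, for
  \<open>N\<close> in the transpose.\<close>

lemma linear_cut_extend_aux:
  assumes u: "u \<in> U" and gf: "\<And>i j. i \<in> U \<Longrightarrow> j \<in> U \<Longrightarrow> i \<noteq> j \<Longrightarrow> R i j \<or> B i j" and xy: "x \<noteq> y"
    and M: "linear_cut (U - {u}) a x y M" and min: "\<And>I. linear_cut (U - {u}) a x y I \<Longrightarrow> \<not> I \<subset> M"
    and N: "linear_cut (U - {u}) (\<lambda>i j. a j i) x y N"
      and min': "\<And>I. linear_cut (U - {u}) (\<lambda>i j. a j i) x y I \<Longrightarrow> \<not> I \<subset> N"
    and disj: "M \<inter> N = {}"
    and i0: "i0 \<in> M" "\<not> (a i0 u = x \<and> a u i0 = y)" and j0: "j0 \<in> N" "\<not> (a u j0 = x \<and> a j0 u = y)" 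
    and col: "B i0 u" and red: "r \<in> U" "R r u"
  shows False
proof -
  interpret tr: clan_colouring U "\<lambda>i j. a j i" R B by (rule transpose_colouring)
  have MU: "m \<in> U" "m \<noteq> u" if "m \<in> M" for m using M that unfolding linear_cut_def by blast+
  have NU: "m \<in> U" "m \<noteq> u" if "m \<in> N" for m using N that unfolding linear_cut_def by blast+
  have Ma: "a i j = x" "a j i = y" if "i \<in> M" "j \<in> U" "j \<noteq> u" "j \<notin> M" for i j
    using M that unfolding linear_cut_def by blast+
  have Na: "a i j = x" "a j i = y" if "j \<in> N" "i \<in> U" "i \<noteq> u" "i \<notin> N" for i j
    using N that unfolding linear_cut_def by blast+
  \<comment> \<open>The pair \<open>i\<close>, \<open>j\<close> has the label \<open>x\<close>,
    \<open>y\<close>. If its ends had different colours to \<open>u\<close>, a twin relation would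
    hand this label on to one of the two pairs with \<open>u\<close>.\<close>
  have same: "\<not> (R i u \<and> B j u)" "\<not> (B i u \<and> R j u)"
    if i: "i \<in> M" "\<not> (a i u = x \<and> a u i = y)" and j: "j \<in> N" "\<not> (a u j = x \<and> a j u = y)" for i j
  proof -
    have ij: "a i j = x" "a j i = y" "i \<noteq> j" using Ma[of i j] i j disj NU by auto
    have *: False if "R' i u" "B' j u" "clan_colouring U a R' B'" for R' B'
    proof -
      interpret c: clan_colouring U a R' B' by fact
      note U = MU[OF i(1)] NU[OF j(1)] u
      from c.T[of u i j] have "undistinguished a u j i \<or> undistinguished a u i j"
        using U that c.R_sym c.B_sym by blast
      thus False using i j ij by (auto simp: undistinguished_def)
    qed
    show "\<not> (R i u \<and> B j u)" using *[of R B] clan_colouring_axioms by blast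
    show "\<not> (B i u \<and> R j u)" using *[of B R] swap_colours by blast
  qed
  have col': "B j u" if "j \<in> N" "\<not> (a u j = x \<and> a j u = y)" for j
    using same(2)[OF i0 that] col gf[of j u] NU[OF that(1)] u by blast
  have col2: "B i u" if "i \<in> M" "\<not> (a i u = x \<and> a u i = y)" for i
    using same(1)[OF that j0] col'[OF j0] gf[of i u] MU[OF that(1)] u by blast
  have ra: "a u w = x \<and> a w u = y \<and> R i0 w" if w: "w \<in> U" "w \<noteq> u" "w \<notin> M" "R w u" for w
  proof -
    note U = MU[OF i0(1)] u w(1,2)
    have iw: "a i0 w = x" "a w i0 = y" using Ma[of i0 w] i0 w by auto
    have "R w i0 \<or> B w i0" using T3[of u w i0] U w col R_sym B_sym by blast
    moreover have "\<not> B w i0"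
    proof
      assume "B w i0"
      hence "undistinguished a w u i0" using odd_left[of w u i0] U w col B_sym by blast
      thus False using iw i0 by (auto simp: undistinguished_def)
    qed
    ultimately have "R w i0" by blast
    hence "undistinguished a i0 u w" using odd_right[of i0 w u] U w col R_sym by blast
    thus ?thesis using iw \<open>R w i0\<close> R_sym by (auto simp: undistinguished_def)
  qed
  have rb: "a w u = x \<and> a u w = y \<and> R j0 w" if w: "w \<in> U" "w \<noteq> u" "w \<notin> N" "R w u" for w
  proof -
    note U = NU[OF j0(1)] u w(1,2)
    have jw: "a w j0 = x" "a j0 w = y" using Na[of j0 w] j0 w by auto
    have ju: "B j0 u" using col' j0 by blast
    have "R w j0 \<or> B w j0" using T3[of u w j0] U w ju R_sym B_sym by blast
    moreover have "\<not> B w j0"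
    proof
      assume "B w j0"
      hence "undistinguished a w u j0" using odd_left[of w u j0] U w ju B_sym by blast
      thus False using jw j0 by (auto simp: undistinguished_def)
    qed
    ultimately have "R w j0" by blast
    hence "undistinguished a j0 u w" using odd_right[of j0 w u] U w ju R_sym by blast
    thus ?thesis using jw \<open>R w j0\<close> R_sym by (auto simp: undistinguished_def)
  qed
  have ru: "r \<noteq> u" using red R_irr by auto
  \<comment> \<open>Outside \<open>M\<close> the label from \<open>u\<close> to \<open>r\<close>
    would be \<open>x\<close>, outside \<open>N\<close> it would be \<open>y\<close>.\<close>
  have "r \<in> M \<or> r \<in> N" using ra[of r] rb[of r] red ru xy by auto
  thus False
  proof
    assume r: "r \<in> M"
    show False
    proof (rule linear_cut_core[OF u gf xy M min _ _ j0(2) col'[OF j0] _ i0 col2 r red(2)])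
      show "j0 \<in> U - {u}" using NU j0 by auto
      show "a i j0 = x \<and> a j0 i = y" if "i \<in> M" for i using Ma[of i j0] that j0 NU disj by auto
      show "R w j0 \<and> a w u = x \<and> a u w = y" if "w \<in> M" "R w u" for w
        using rb[of w] that MU[of w] disj R_sym by blast
    qed
  next
    assume r: "r \<in> N"
    show False
    proof (rule tr.linear_cut_core[of u x y N i0 j0 r])
      show "u \<in> U" "x \<noteq> y" "r \<in> N" "R r u" "j0 \<in> N" "B i0 u" by fact+
      show "R i j \<or> B i j" if "i \<in> U" "j \<in> U" "i \<noteq> j" for i j using gf that by blast
      show "linear_cut (U - {u}) (\<lambda>i j. a j i) x y N" by (rule N)
      show "\<not> I \<subset> N" if "linear_cut (U - {u}) (\<lambda>i j. a j i) x y I" for I using min' that by blast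
      show "\<not> (a i0 u = x \<and> a u i0 = y)" by (rule i0(2))
      show "i0 \<in> U - {u}" using MU i0 by auto
      show "a i0 i = x \<and> a i i0 = y" if "i \<in> N" for i using Na[of i i0] that i0 MU disj by auto
      show "R w i0 \<and> a u w = x \<and> a w u = y" if "w \<in> N" "R w u" for w
        using ra[of w] that NU[of w] disj R_sym by blast
      show "\<not> (a u j0 = x \<and> a j0 u = y)" by (rule j0(2))
      show "B i u" if "i \<in> N" "\<not> (a u i = x \<and> a i u = y)" for i using col' that by blast
    qed
  qed
qed

text \<open>If \<open>U\<close> has no cut, neither a smallest cut \<open>M\<close> from one end nor
  a smallest \<open>N\<close> from the other can take \<open>u\<close> into its complement, so each
  contains a point with a wrong label to \<open>u\<close>.\<close>

lemma linear_cut_extend: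
  assumes u: "u \<in> U" and gf: "\<And>i j. i \<in> U \<Longrightarrow> j \<in> U \<Longrightarrow> i \<noteq> j \<Longrightarrow> R i j \<or> B i j"
    and L: "linear_cut (U - {u}) a x y L"
    and rs: "r \<in> U" "R r u" "s \<in> U" "B s u"
  shows "\<exists>I. linear_cut U a x y I"
proof (rule ccontr)
  assume n: "\<nexists>I. linear_cut U a x y I"
  let ?W = "U - {u}" and ?a' = "\<lambda>i j. a j i"
  have xy: "x \<noteq> y"
  proof -
    obtain i j where "i \<in> L" "j \<in> ?W - L" using L unfolding linear_cut_def by blast
    moreover from this have "i \<in> U" "j \<in> U" "i \<noteq> j" "a i j = x" "a j i = y" using L unfolding linear_cut_def by blast+
    ultimately show ?thesis using gf[of i j] nonflat[of i j] by auto
  qed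
  obtain M where M: "linear_cut ?W a x y M" and Mmin: "\<And>I. linear_cut ?W a x y I \<Longrightarrow> card M \<le> card I"
    using L ex_has_least_nat[of "linear_cut ?W a x y" L card] by blast
  have L': "linear_cut ?W ?a' x y (?W - L)" using L linear_cut_transpose[of L ?W x y] unfolding linear_cut_def by blast
  obtain N where N: "linear_cut ?W ?a' x y N" and Nmin: "\<And>I. linear_cut ?W ?a' x y I \<Longrightarrow> card N \<le> card I"
    using L' ex_has_least_nat[of "linear_cut ?W ?a' x y" "?W - L" card] by blast
  have fin: "finite M" "finite N" using M N finU unfolding linear_cut_def by (meson finite_Diff finite_subset psubset_imp_subset)+
  have min: "\<not> I \<subset> M" if "linear_cut ?W a x y I" for I
    using Mmin[OF that] psubset_card_mono[OF fin(1), of I] by (meson leD)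
  have min': "\<not> I \<subset> N" if "linear_cut ?W ?a' x y I" for I
    using Nmin[OF that] psubset_card_mono[OF fin(2), of I] by (meson leD)
  have disj: "M \<inter> N = {}"
  proof (rule ccontr)
    assume "M \<inter> N \<noteq> {}"
    \<comment> \<open>The complement of \<open>M\<close> is a cut for the transpose. Two such cuts
      are nested because \<open>x\<close> and \<open>y\<close> differ, and by minimality it is
      \<open>N\<close> that lies inside.\<close>
    define K where "K = ?W - M"
    have K: "linear_cut ?W ?a' x y K" using M linear_cut_transpose[of M ?W x y] unfolding K_def linear_cut_def by blast
    obtain c where c: "c \<in> N" "c \<notin> K" using \<open>M \<inter> N \<noteq> {}\<close> by (auto simp: K_def)
    have "\<not> K \<subset> N" using min' K by blast
    then obtain d where d: "d \<in> K" "d \<notin> N" using c by blast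
    have "a d c = x" "a c d = y" using N c d K unfolding linear_cut_def by blast+
    moreover have "a c d = x" using K c d N unfolding linear_cut_def by blast
    ultimately show False using xy by simp
  qed
  have "\<exists>i\<in>M. \<not> (a i u = x \<and> a u i = y)"
  proof (rule ccontr)
    assume "\<not> ?thesis"
    hence "linear_cut U a x y M" using M u unfolding linear_cut_def by blast
    thus False using n by blast
  qed
  then obtain i0 where i0: "i0 \<in> M" "\<not> (a i0 u = x \<and> a u i0 = y)" by blast
  have "\<exists>i\<in>N. \<not> (a u i = x \<and> a i u = y)"
  proof (rule ccontr)
    assume "\<not> ?thesis"
    hence "linear_cut U ?a' x y N" using N u unfolding linear_cut_def by blast
    moreover have "U - (U - N) = N" using N unfolding linear_cut_def by blast
    ultimately have "linear_cut U a x y (U - N)" using linear_cut_transpose[of "U - N" U x y] by simp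
    thus False using n by blast
  qed
  then obtain j0 where j0: "j0 \<in> N" "\<not> (a u j0 = x \<and> a j0 u = y)" by blast
  interpret sw: clan_colouring U a B R by (rule swap_colours)
  have "R i0 u \<or> B i0 u" using gf[of i0 u] i0 M u unfolding linear_cut_def by blast
  thus False
  proof
    assume "B i0 u"
    thus False using linear_cut_extend_aux[OF u gf xy M min N min' disj i0 j0] rs by blast
  next
    assume R: "R i0 u"
    have gf': "B i j \<or> R i j" if "i \<in> U" "j \<in> U" "i \<noteq> j" for i j using gf[OF that] by blast
    show False using sw.linear_cut_extend_aux[OF u gf' xy M min N min' disj i0 j0 R] rs by blast
  qed
qed

text \<open>Along red edges the label \<open>a i j\<close> leads from \<open>i\<close> and
  \<open>k\<close> to \<open>j\<close> and \<open>l\<close>. If it also leads from \<open>i\<close>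
  to \<open>l\<close>, then \<open>i\<close> is cut off from the rest, otherwise \<open>k\<close>
  is.\<close>

lemma P4_linear_cut:
  assumes "i \<in> U" "j \<in> U" "k \<in> U" "l \<in> U" and U: "U = {i, j, k, l}"
    and c: "R i j" "R j k" "R k l" "B i k" "B i l" "B j l"
  shows "\<exists>I x y. linear_cut U a x y I"
proof -
  note p = P4_full[OF assms(1-4) c]
  have d: "i \<noteq> j" "i \<noteq> k" "i \<noteq> l" "j \<noteq> k" "j \<noteq> l" "k \<noteq> l" using c R_irr B_irr by auto
  from p(9) show ?thesis
  proof
    assume e: "a i l = a i j \<and> a l i = a j i"
    have "linear_cut U a (a i j) (a j i) {i}" unfolding linear_cut_def U using d p e by auto
    thus ?thesis by blast
  next
    assume e: "a i l = a j i \<and> a l i = a i j"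
    have "linear_cut U a (a i j) (a j i) {k}" unfolding linear_cut_def U using d p e by auto
    thus ?thesis by blast
  qed
qed

text \<open>Removing \<open>u\<close> leaves two parts without red edges between them, so blue joins
  them completely. A red edge leaving the blue neighbours of \<open>u\<close> inside one part
  supplies \<open>c\<close> and \<open>d\<close>; a red neighbour of \<open>u\<close> in the other
  part is \<open>e\<close>.\<close>

lemma P4_exists:
  assumes gf: "\<And>i j. i \<in> U \<Longrightarrow> j \<in> U \<Longrightarrow> i \<noteq> j \<Longrightarrow> R i j \<or> B i j"
    and c: "connected_in R U" "connected_in B U" and u: "u \<in> U" and n: "\<not> connected_in R (U - {u})"
  shows "\<exists>e\<in>U. \<exists>c\<in>U. \<exists>d\<in>U. R e u \<and> R u c \<and> R c d \<and> B e c \<and> B e d \<and> B u d"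
proof -
  let ?W = "U - {u}"
  obtain C0 where C0: "C0 \<subseteq> ?W" "C0 \<noteq> {}" "C0 \<noteq> ?W" and nC0: "\<And>x y. x \<in> C0 \<Longrightarrow> y \<in> ?W - C0 \<Longrightarrow> \<not> R x y"
    using n unfolding connected_in_def by blast
  obtain v where v: "v \<in> ?W" using C0 by blast
  obtain d0 where d0: "d0 \<in> ?W" "B u d0" 
    using connected_inE[OF c(2), of "{u}" u v] u v by auto
  obtain C where C: "C \<subseteq> ?W" "d0 \<in> C" "?W - C \<noteq> {}" and nC: "\<And>x y. x \<in> C \<Longrightarrow> y \<in> ?W - C \<Longrightarrow> \<not> R x y"
  proof (cases "d0 \<in> C0")
    case True thus ?thesis using that[of C0] C0 nC0 by blast
  next
    case False
    show ?thesis
    proof (rule that[of "?W - C0"])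
      show "\<not> R x y" if "x \<in> ?W - C0" "y \<in> ?W - (?W - C0)" for x y
        using nC0[of y x] that R_sym[of x y] by blast
    qed (use False d0 C0 in auto)
  qed
  obtain e where e: "e \<in> ?W - C" "R e u"
  proof -
    obtain y where "y \<in> ?W - C" using C by blast
    moreover have "?W - C \<subseteq> U" "u \<notin> ?W - C" by auto
    ultimately obtain e f where ef: "e \<in> ?W - C" "f \<in> U" "f \<notin> ?W - C" "R e f"
      using connected_inE[OF c(1), of "?W - C" y u] u by auto
    have "f = u" using nC[of f e] ef R_sym[of e f] by blast
    thus ?thesis using ef that by blast
  qed
  obtain d f where df: "d \<in> C" "B u d" "f \<in> C" "R u f" "R f d"
  proof -
    have "{x\<in>C. B u x} \<subseteq> U" "d0 \<in> {x\<in>C. B u x}" "u \<notin> {x\<in>C. B u x}" using C d0 by auto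
    from connected_inE[OF c(1) this(1,2) u this(3)]
    obtain d f where f: "d \<in> {x\<in>C. B u x}" "f \<in> U" "f \<notin> {x\<in>C. B u x}" "R d f" by auto
    have fu: "f \<noteq> u" using f RBD(2)[of d u] by blast
    have fC: "f \<in> C" using nC[of d f] f C fu by blast
    have "\<not> B u f" using f fC by blast
    hence "R u f" using gf[of u f] u f fu by blast
    thus ?thesis using that[of d f] f fC R_sym[of d f] by blast
  qed
  have "B e x" if "x \<in> C" for x using gf[of e x] nC[of x e] that e C R_sym[of e x] by blast
  thus ?thesis using e df C by blast
qed

text \<open>Induction over sets on which both colours are connected. Without a smaller such set
  \<open>U\<close> is a path on four points. Otherwise a largest one, \<open>Z\<close>, either lacks
  a single point, by which its cut is extended, or is a clan and can be contracted.\<close>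

lemma linear_cut_exists:
  assumes "2 \<le> card U" "connected_in R U" "connected_in B U"
    and "\<And>i j. i \<in> U \<Longrightarrow> j \<in> U \<Longrightarrow> i \<noteq> j \<Longrightarrow> R i j \<or> B i j"
  shows "\<exists>I x y. linear_cut U a x y I"
  using assms clan_colouring_axioms
proof (induction "card U" arbitrary: U rule: less_induct)
  case less
  interpret c: clan_colouring U a R B by fact
  interpret sw: clan_colouring U a B R by (rule c.swap_colours)
  note c2 = less.prems(1) and cR = less.prems(2) and cB = less.prems(3) and gf = less.prems(4)
  have gf': "B i j \<or> R i j" if "i \<in> U" "j \<in> U" "i \<noteq> j" for i j using gf[OF that] by blast
  have c3: "3 \<le> card U"
  proof (rule ccontr)
    assume "\<not> ?thesis"
    hence "card U = 2" using c2 by simp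
    then obtain p q where pq: "U = {p, q}" "p \<noteq> q" by (meson card_2_iff)
    have "K p q" if "connected_in K U" for K
      using connected_inE[OF that, of "{p}" p q] pq by auto
    thus False using cR cB c.RBD by blast
  qed
  define good where "good Z \<longleftrightarrow> Z \<subset> U \<and> 2 \<le> card Z \<and> connected_in R Z \<and> connected_in B Z" for Z
  have IH: "\<exists>I x y. linear_cut Z a x y I" if "good Z" for Z
    using less.hyps[of Z] that c.restrict_colouring[of Z] gf psubset_card_mono[OF c.finU, of Z]
    unfolding good_def by (meson psubset_imp_subset subsetD)
  show ?case
  proof (cases "\<exists>Z. good Z")
    case False
    obtain u where u: "u \<in> U" using c2 by fastforce
    have "U - {u} \<subset> U" "2 \<le> card (U - {u})" using u c3 c.finU by auto
    hence nd: "\<not> connected_in R (U - {u}) \<or> \<not> connected_in B (U - {u})" using False unfolding good_def by blast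
    have res: "\<exists>I x y. linear_cut U a x y I"
      if "clan_colouring U a R' B'" "e \<in> U" "u \<in> U" "f \<in> U" "d \<in> U"
        "R' e u" "R' u f" "R' f d" "B' e f" "B' e d" "B' u d" "(R' = R \<and> B' = B) \<or> (R' = B \<and> B' = R)" for R' B' e f d
    proof -
      interpret k: clan_colouring U a R' B' by fact
      let ?Z = "{e, u, f, d}"
      interpret kz: clan_colouring ?Z a R' B' by (rule k.restrict_colouring) (use that in auto)
      have "connected_in R' ?Z"
      proof -
        have "connected_in R' {e}" unfolding connected_in_def by (simp add: subset_singleton_iff)
        hence "connected_in R' {u, e}" using connected_in_insert[of R' "{e}" e u] that k.R_sym by blast
        hence "connected_in R' {f, u, e}" using connected_in_insert[of R' "{u, e}" u f] that k.R_sym by blast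
        hence "connected_in R' {d, f, u, e}" using connected_in_insert[of R' "{f, u, e}" f d] that k.R_sym by blast
        thus ?thesis by (simp add: insert_commute)
      qed
      moreover have "connected_in B' ?Z"
      proof -
        have "connected_in B' {u}" unfolding connected_in_def by (simp add: subset_singleton_iff)
        hence "connected_in B' {d, u}" using connected_in_insert[of B' "{u}" u d] that k.B_sym by blast
        hence "connected_in B' {e, d, u}" using connected_in_insert[of B' "{d, u}" d e] that k.B_sym by blast
        hence "connected_in B' {f, e, d, u}" using connected_in_insert[of B' "{e, d, u}" e f] that k.B_sym by blast
        thus ?thesis by (simp add: insert_commute)
      qed
      moreover have "2 \<le> card ?Z" by (rule card_two_le[of _ e u]) (use that k.R_irr in auto)
      moreover have "?Z \<subseteq> U" using that by auto
      ultimately have ZU: "U = ?Z" using False that(12) unfolding good_def by blast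
      show ?thesis using k.P4_linear_cut[OF that(2,3,4,5) ZU that(6-11)] .
    qed
    from nd show ?thesis
    proof
      assume "\<not> connected_in R (U - {u})"
      then obtain e f d where "e \<in> U" "f \<in> U" "d \<in> U" "R e u" "R u f" "R f d" "B e f" "B e d" "B u d"
        using c.P4_exists[OF gf cR cB u] by blast
      thus ?thesis using res[of R B e f d] u c.clan_colouring_axioms by blast
    next
      assume "\<not> connected_in B (U - {u})"
      then obtain e f d where "e \<in> U" "f \<in> U" "d \<in> U" "B e u" "B u f" "B f d" "R e f" "R e d" "R u d"
        using sw.P4_exists[OF gf' cB cR u] by blast
      thus ?thesis using res[of B R e f d] u sw.clan_colouring_axioms by blast
    qed
  next
    case True
    then obtain Z where Z: "good Z" and Zmax: "\<And>Y. good Y \<Longrightarrow> card Y \<le> card Z"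
      using ex_has_greatest_nat[of good _ card "card U"] psubset_card_mono[OF c.finU] unfolding good_def
      by (metis less_imp_le_nat)
    have ZU: "Z \<subset> U" "2 \<le> card Z" and cZ: "connected_in R Z" "connected_in B Z" using Z by (auto simp: good_def)
    have finZ: "finite Z" using ZU c.finU finite_subset by blast
    show ?thesis
    proof (cases "\<exists>u\<in>U - Z. (\<exists>r\<in>Z. R r u) \<and> (\<exists>s\<in>Z. B s u)")
      case True
      then obtain u r s where u: "u \<in> U" "u \<notin> Z" and rs: "r \<in> Z" "R r u" "s \<in> Z" "B s u" by blast
      have "connected_in R (insert u Z)" "connected_in B (insert u Z)"
        using connected_in_insert[OF cZ(1) c.R_sym rs(1)] connected_in_insert[OF cZ(2) c.B_sym rs(3)] rs c.R_sym c.B_sym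
        by blast+
      hence "good (insert u Z) \<or> insert u Z = U" using u ZU finZ unfolding good_def by auto
      moreover have "\<not> good (insert u Z)" using Zmax[of "insert u Z"] u finZ by auto
      ultimately have "insert u Z = U" by blast
      hence Ueq: "U - {u} = Z" using u by auto
      obtain L x y where "linear_cut Z a x y L" using IH[OF Z] by blast
      hence "linear_cut (U - {u}) a x y L" using Ueq by simp
      thus ?thesis using c.linear_cut_extend[OF u(1) gf, of x y L r s] rs ZU by blast
    next
      case False
      obtain z where z: "z \<in> Z" using ZU(2) by fastforce
      have mono: "(\<forall>x\<in>Z. R x u) \<or> (\<forall>x\<in>Z. B x u)" if "u \<in> U - Z" for u
        using False that gf ZU by blast
      \<comment> \<open>As \<open>u\<close> sees \<open>Z\<close> in one colour, every edge of
        \<open>Z\<close> in the other colour is an odd side, and that other colour is connected on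
        \<open>Z\<close>.\<close>
      have und: "undistinguished a i j u" if i: "i \<in> Z" "j \<in> Z" and u: "u \<in> U - Z" for i j u
      proof -
        have U: "x \<in> Z \<Longrightarrow> x \<in> U" for x using ZU by blast
        from mono[OF u] show ?thesis
        proof
          assume A: "\<forall>x\<in>Z. R x u"
          show ?thesis
          proof (rule connected_in_class[where P = "\<lambda>x. undistinguished a i x u", OF cZ(2) i])
            fix p q assume pq: "p \<in> Z" "q \<in> Z" "B p q" "undistinguished a i p u"
            have "undistinguished a p q u" using sw.odd_left[of p q u] pq A u U by blast
            thus "undistinguished a i q u" using pq undist_trans by metis
          qed simp
        next
          assume A: "\<forall>x\<in>Z. B x u"
          show ?thesis
          proof (rule connected_in_class[where P = "\<lambda>x. undistinguished a i x u", OF cZ(1) i])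
            fix p q assume pq: "p \<in> Z" "q \<in> Z" "R p q" "undistinguished a i p u"
            have "undistinguished a p q u" using c.odd_left[of p q u] pq A u U by blast
            thus "undistinguished a i q u" using pq undist_trans by metis
          qed simp
        qed
      qed
      \<comment> \<open>\<open>Z\<close> is contracted to \<open>z\<close>; a cut of
        \<open>W\<close> lifts by putting \<open>Z\<close> on the side of \<open>z\<close>.\<close>
      define W where "W = insert z (U - Z)"
      have WU: "W \<subseteq> U" using z ZU by (auto simp: W_def)
      have "connected_in R W" unfolding W_def
        by (rule connected_in_quotient[OF cR _ z _ c.R_sym]) (use ZU z mono c.RBD in blast)+
      moreover have "connected_in B W" unfolding W_def
        by (rule connected_in_quotient[OF cB _ z _ c.B_sym]) (use ZU z mono c.RBD in blast)+
      moreover have "2 \<le> card W"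
      proof -
        obtain u where "u \<in> U - Z" using ZU by blast
        thus ?thesis using card_two_le[of W z u] z c.finU by (auto simp: W_def)
      qed
      moreover have "W \<subset> U"
      proof -
        obtain z' where "z' \<in> Z" "z' \<noteq> z"
          using ZU(2) z finZ by (metis One_nat_def Suc_1 card.empty card_1_singleton_iff is_singletonI' is_singleton_altdef not_less_eq_eq order.refl empty_iff le_numeral_extra(4))
        thus ?thesis using WU ZU by (auto simp: W_def)
      qed
      ultimately obtain I x y where I: "linear_cut W a x y I" using IH[of W] unfolding good_def by blast
      define I' where "I' = (if z \<in> I then I \<union> Z else I)"
      have "linear_cut U a x y I'"
        unfolding linear_cut_def
      proof (intro conjI ballI)
        show "I' \<noteq> {}" using I by (auto simp: I'_def linear_cut_def)
        show "I' \<subset> U" using I z ZU unfolding I'_def linear_cut_def W_def by (auto split: if_splits)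
        fix i j assume ij: "i \<in> I'" "j \<in> U - I'"
        define i1 where "i1 = (if i \<in> Z then z else i)"
        define j1 where "j1 = (if j \<in> Z then z else j)"
        have i1: "i1 \<in> I" using ij z I unfolding i1_def I'_def linear_cut_def W_def by (auto split: if_splits)
        have j1: "j1 \<in> W - I" using ij z I unfolding j1_def I'_def linear_cut_def W_def by (auto split: if_splits)
        have e: "a i1 j1 = x" "a j1 i1 = y" using I i1 j1 unfolding linear_cut_def by blast+
        have nz: "\<not> (i \<in> Z \<and> j \<in> Z)" using i1 j1 unfolding i1_def j1_def by auto
        have "a i j = x \<and> a j i = y"
        proof (cases "j \<in> Z")
          case False
          hence "undistinguished a i i1 j" using und[of i z j] ij z by (auto simp: i1_def)
          thus ?thesis using e False by (simp add: undistinguished_def j1_def)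
        next
          case True
          hence "i \<notin> Z" using nz by blast
          moreover hence "i \<in> U" using i1 I WU unfolding i1_def linear_cut_def by auto
          ultimately have "undistinguished a j j1 i" using und[of j z i] True z by (auto simp: j1_def)
          thus ?thesis using e \<open>i \<notin> Z\<close> by (simp add: undistinguished_def i1_def)
        qed
        thus "a i j = x" "a j i = y" by auto
      qed
      thus ?thesis by blast
    qed
  qed
qed

text \<open>The theorem of Hartfiel and Loewy (a matrix without cuts is determined by its principal minors
  up to diagonal equivalence) in the language of clans.\<close>

theorem primitive_monochromatic:
  assumes prim: "primitive U a" and "3 \<le> card U"
    and "i \<in> U" "j \<in> U" "R i j" and "k \<in> U" "l \<in> U" "B k l"
  shows False
proof -
  interpret sw: clan_colouring U a B R by (rule swap_colours)
  have c: "connected_in R U" "connected_in B U" using red_connected sw.red_connected assms by blast+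
  have gf: "R i j \<or> B i j" if "i \<in> U" "j \<in> U" "i \<noteq> j" for i j
    using no_flat_pair[OF prim c that] .
  obtain I x y where I: "linear_cut U a x y I"
    using linear_cut_exists[OF _ c gf] assms(2) by auto
  have IU: "I \<subset> U" "I \<noteq> {}" using I by (auto simp: linear_cut_def)
  have e: "a i j = x" "a j i = y" if "i \<in> I" "j \<in> U - I" for i j
    using I that unfolding linear_cut_def by blast+
  have "clan U a I" unfolding clan_def undistinguished_def using IU e by simp
  moreover have "clan U a (U - I)" unfolding clan_def undistinguished_def
    using IU e by (simp add: double_diff psubset_imp_subset)
  ultimately have cl: "clan U a I" "clan U a (U - I)" .
  have "card I + card (U - I) = card U" using IU finU by (metis card_Diff_subset card_mono finite_subset le_add_diff_inverse psubset_imp_subset)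
  hence "2 \<le> card I \<or> 2 \<le> card (U - I)" using assms(2) by linarith
  thus False using cl prim IU unfolding primitive_def by blast
qed

end


section \<open>Colourings from principal minors\<close>

lemma poly_eventually_nonzero:
  fixes p :: "'k::field poly"
  assumes "p \<noteq> 0" shows "\<forall>\<^sub>F t in cofinite. poly p t \<noteq> 0"
  using poly_roots_finite[OF assms] by (simp add: eventually_cofinite)

lemma cubic_coeffs_zero:
  fixes c0 c1 c2 c3 :: "'k::field"
  assumes inf: "infinite (UNIV :: 'k set)"
    and "\<forall>\<^sub>F t in cofinite. c0 + t * c1 + t^2 * c2 + t^3 * c3 = 0"
  shows "c0 = 0" "c1 = 0" "c2 = 0" "c3 = 0"
proof -
  have "[:c0, c1, c2, c3:] = 0"
  proof (rule ccontr)
    assume "[:c0, c1, c2, c3:] \<noteq> 0"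
    from poly_eventually_nonzero[OF this] assms(2) have "\<forall>\<^sub>F t::'k in cofinite. False"
      by eventually_elim (simp add: algebra_simps power2_eq_square power3_eq_cube)
    thus False using inf by (simp add: eventually_cofinite)
  qed
  thus "c0 = 0" "c1 = 0" "c2 = 0" "c3 = 0" by simp_all
qed

lemma cofinite_ex:
  assumes "infinite (UNIV :: 'k set)" "\<forall>\<^sub>F t::'k in cofinite. P t" shows "\<exists>t. P t"
  using assms by (metis (mono_tags, lifting) Collect_cong UNIV_def eventually_cofinite)

lemma linear_eventually_nonzero: "\<forall>\<^sub>F t in cofinite. 1 + t * (c::'k::field) \<noteq> 0"
  using poly_eventually_nonzero[of "[:1, c:]"] by simp

text \<open>Both sides are rational functions of \<open>t\<close> which differ at
  \<open>t = 0\<close>, so only roots of a nonzero polynomial and of the denominators are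
  excluded.\<close>

lemma fraction_eventually_neq:
  fixes x0 x1 x2 x3 y0 y1 y2 y3 :: "'k::field"
  assumes "x0 \<noteq> y0"
  shows "\<forall>\<^sub>F t in cofinite. (x0 + t * x1) / ((1 + t * x2) * (1 + t * x3)) \<noteq> (y0 + t * y1) / ((1 + t * y2) * (1 + t * y3))"
proof -
  let ?p = "[:x0, x1:] * [:1, y2:] * [:1, y3:] - [:y0, y1:] * [:1, x2:] * [:1, x3:]"
  have "poly ?p 0 \<noteq> 0" using assms by simp
  hence "?p \<noteq> 0" by auto
  from poly_eventually_nonzero[OF this] linear_eventually_nonzero[of x2] linear_eventually_nonzero[of x3]
    linear_eventually_nonzero[of y2] linear_eventually_nonzero[of y3]
  show ?thesis
  proof eventually_elim
    case (elim t)
    show ?case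
    proof
      assume "(x0 + t * x1) / ((1 + t * x2) * (1 + t * x3)) = (y0 + t * y1) / ((1 + t * y2) * (1 + t * y3))"
      hence "(x0 + t * x1) * ((1 + t * y2) * (1 + t * y3)) = (y0 + t * y1) * ((1 + t * x2) * (1 + t * x3))"
        using elim(2-5) by (simp add: frac_eq_eq)
      moreover have "poly ?p t = (x0 + t * x1) * ((1 + t * y2) * (1 + t * y3)) - (y0 + t * y1) * ((1 + t * x2) * (1 + t * x3))"
        by (simp add: algebra_simps)
      ultimately show False using elim(1) by (simp del: poly_diff poly_mult)
    qed
  qed
qed

text \<open>The effect of a rank-one update at \<open>k\<close> on the ratios of a matrix; see \<open>alpha_shift\<close>.\<close>

definition psi :: "'i \<Rightarrow> 'k::field \<Rightarrow> ('i \<Rightarrow> 'i \<Rightarrow> 'k) \<Rightarrow> 'i \<Rightarrow> 'i \<Rightarrow> 'k" where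
  "psi k t a i j = (if i = k then a k j / (1 + t * a k j) else if j = k then a i k / (1 + t * a i k)
     else (a i j + t * (a i k * a k j)) / ((1 + t * a i k) * (1 + t * a k j)))"

definition psi_ok :: "'i set \<Rightarrow> 'i \<Rightarrow> 'k::field \<Rightarrow> ('i \<Rightarrow> 'i \<Rightarrow> 'k) \<Rightarrow> bool" where
  "psi_ok U k t a \<longleftrightarrow> (\<forall>i\<in>U - {k}. 1 + t * a i k \<noteq> 0 \<and> 1 + t * a k i \<noteq> 0)"

definition flip :: "'i set \<Rightarrow> ('i \<Rightarrow> 'i \<Rightarrow> 'k) \<Rightarrow> 'i \<Rightarrow> 'i \<Rightarrow> 'k" where
  "flip X a i j = (if i \<in> X \<and> j \<in> X then a j i else a i j)"

definition red :: "('i \<Rightarrow> 'i \<Rightarrow> 'k) \<Rightarrow> ('i \<Rightarrow> 'i \<Rightarrow> 'k) \<Rightarrow> 'i \<Rightarrow> 'i \<Rightarrow> bool" where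
  "red a b i j \<longleftrightarrow> a i j \<noteq> a j i \<and> b i j = a j i \<and> b j i = a i j"

definition blue :: "('i \<Rightarrow> 'i \<Rightarrow> 'k) \<Rightarrow> ('i \<Rightarrow> 'i \<Rightarrow> 'k) \<Rightarrow> 'i \<Rightarrow> 'i \<Rightarrow> bool" where
  "blue a b i j \<longleftrightarrow> a i j \<noteq> a j i \<and> b i j = a i j \<and> b j i = a j i"

text \<open>Flat pairs remain flat under every \<open>psi k t\<close>, with the denominators cleared.\<close>

definition stable :: "'i set \<Rightarrow> ('i \<Rightarrow> 'i \<Rightarrow> 'k::field) \<Rightarrow> bool" where
  "stable U a \<longleftrightarrow> (\<forall>i\<in>U. \<forall>j\<in>U. \<forall>k\<in>U. i \<noteq> j \<longrightarrow> j \<noteq> k \<longrightarrow> i \<noteq> k \<longrightarrow> a i j = a j i \<longrightarrow>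
     (\<forall>t. (a i j + t * (a i k * a k j)) * ((1 + t * a j k) * (1 + t * a k i)) =
          (a j i + t * (a j k * a k i)) * ((1 + t * a i k) * (1 + t * a k j))))"

definition flat_pairs :: "'i set \<Rightarrow> ('i \<Rightarrow> 'i \<Rightarrow> 'k) \<Rightarrow> ('i \<times> 'i) set" where
  "flat_pairs U a = {(i, j). i \<in> U \<and> j \<in> U \<and> i \<noteq> j \<and> a i j = a j i}"

lemma psi_ok_eventually: "finite U \<Longrightarrow> \<forall>\<^sub>F t in cofinite. psi_ok U k t a"
  unfolding psi_ok_def
  by (intro eventually_ball_finite ballI eventually_conj linear_eventually_nonzero) auto

lemma two_roots:
  fixes x y u v :: "'k::field"
  assumes "x + y = u + v" "x * y = u * v"
  shows "(u = x \<and> v = y) \<or> (u = y \<and> v = x)"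
proof -
  have "(u - x) * (u - y) = u * u - u * (x + y) + x * y" by (simp add: algebra_simps)
  also have "\<dots> = 0" unfolding assms by (simp add: algebra_simps)
  finally have "u = x \<or> u = y" by simp
  thus ?thesis using assms(1) by (auto simp: algebra_simps)
qed

text \<open>Abstracts from \<open>pm_alpha\<close>, which relates the ratios of principal minor equivalent matrices.\<close>

locale pm_relation =
  fixes H :: "'i set \<Rightarrow> ('i \<Rightarrow> 'i \<Rightarrow> 'k::field) \<Rightarrow> ('i \<Rightarrow> 'i \<Rightarrow> 'k) \<Rightarrow> bool"
  assumes inf: "infinite (UNIV :: 'k set)"
    and H_fin: "H U a b \<Longrightarrow> finite U"
    and H_pair: "H U a b \<Longrightarrow> i \<in> U \<Longrightarrow> j \<in> U \<Longrightarrow> i \<noteq> j \<Longrightarrow>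
      a i j + a j i = b i j + b j i \<and> a i j * a j i = b i j * b j i"
    and H_psi: "H U a b \<Longrightarrow> k \<in> U \<Longrightarrow> psi_ok U k t a \<Longrightarrow> H U (psi k t a) (psi k t b)"
    and H_sym: "H U a b \<Longrightarrow> H U b a"
    and H_mono: "H U a b \<Longrightarrow> W \<subseteq> U \<Longrightarrow> H W a b"
    and H_flip: "H U a b \<Longrightarrow> clan U a X \<Longrightarrow> H U (flip X a) b"
begin

lemma pair_cases:
  assumes "H U a b" "i \<in> U" "j \<in> U" "i \<noteq> j"
  shows "(b i j = a i j \<and> b j i = a j i) \<or> (b i j = a j i \<and> b j i = a i j)"
  using two_roots H_pair[OF assms] by metis

text \<open>The sum of a pair is the same for \<open>a\<close> and \<open>b\<close> after every
  update at \<open>k\<close>. The denominators depend on pair sums and products only, so the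
  numerators agree as polynomials in \<open>t\<close>, and comparing coefficients gives the sums
  over the six directed Hamiltonian paths and over the two directed cycles of the triangle.\<close>

lemma triple_identities:
  assumes h: "H U a b" and U: "i \<in> U" "j \<in> U" "k \<in> U" "i \<noteq> j" "j \<noteq> k" "i \<noteq> k"
  shows "a i j * (a j k + a k i) + a i k * a k j + a j i * (a i k + a k j) + a j k * a k i =
         b i j * (b j k + b k i) + b i k * b k j + b j i * (b i k + b k j) + b j k * b k i" (is ?Q)
    and "a i j * a j k * a k i + a j i * a i k * a k j = b i j * b j k * b k i + b j i * b i k * b k j" (is ?C)
proof -
  let ?N = "\<lambda>c t. (c i j + t * (c i k * c k j)) * ((1 + t * c j k) * (1 + t * c k i)) +
    (c j i + t * (c j k * c k i)) * ((1 + t * c i k) * (1 + t * c k j))"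
  note pij = H_pair[OF h U(1,2,4)] and pjk = H_pair[OF h U(2,3,5)] and pik = H_pair[OF h U(1,3,6)]
  have frac: "u / (d1 * d2) + v / (d3 * d4) = (u * (d3 * d4) + v * (d1 * d2)) / (d1 * d2 * (d3 * d4))"
    if "d1 \<noteq> 0" "d2 \<noteq> 0" "d3 \<noteq> 0" "d4 \<noteq> 0" for u v d1 d2 d3 d4 :: 'k
    using that by (simp add: add_frac_eq)
  have D: "(1 + t * b i k) * (1 + t * b k j) * ((1 + t * b j k) * (1 + t * b k i)) =
     (1 + t * a i k) * (1 + t * a k j) * ((1 + t * a j k) * (1 + t * a k i))" for t
  proof -
    have "(1 + t * c i k) * (1 + t * c k j) * ((1 + t * c j k) * (1 + t * c k i)) =
      (1 + t * (c i k + c k i) + t^2 * (c i k * c k i)) * (1 + t * (c j k + c k j) + t^2 * (c j k * c k j))" for c :: "'i \<Rightarrow> 'i \<Rightarrow> 'k"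
      by (simp add: algebra_simps power2_eq_square)
    thus ?thesis using pjk pik by metis
  qed
  have N: "?N c t = (c i j + c j i)
      + t * (c i j * (c j k + c k i) + c i k * c k j + c j i * (c i k + c k j) + c j k * c k i)
      + t^2 * ((c i j * c j k * c k i + c j i * c i k * c k j) + (c j k * c k j) * (c i k + c k i) + (c i k * c k i) * (c j k + c k j))
      + t^3 * ((c i k * c k i) * (c j k * c k j) + (c i k * c k i) * (c j k * c k j))" for c :: "'i \<Rightarrow> 'i \<Rightarrow> 'k" and t
    by (simp add: algebra_simps power2_eq_square power3_eq_cube)
  have "\<forall>\<^sub>F t in cofinite. ?N a t = ?N b t"
    using psi_ok_eventually[OF H_fin[OF h], of k a] psi_ok_eventually[OF H_fin[OF h], of k b]
  proof eventually_elim
    case (elim t)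
    have nz: "1 + t * a i k \<noteq> 0" "1 + t * a k i \<noteq> 0" "1 + t * a j k \<noteq> 0" "1 + t * a k j \<noteq> 0"
      "1 + t * b i k \<noteq> 0" "1 + t * b k i \<noteq> 0" "1 + t * b j k \<noteq> 0" "1 + t * b k j \<noteq> 0"
      using elim U unfolding psi_ok_def by auto
    have "psi k t a i j + psi k t a j i = psi k t b i j + psi k t b j i"
      using H_pair[OF H_psi[OF h U(3) elim(1)] U(1,2,4)] by simp
    hence "?N a t / ((1 + t * a i k) * (1 + t * a k j) * ((1 + t * a j k) * (1 + t * a k i))) =
           ?N b t / ((1 + t * b i k) * (1 + t * b k j) * ((1 + t * b j k) * (1 + t * b k i)))"
      using U by (simp only: psi_def if_False frac nz refl not_False_eq_True)
    thus ?case unfolding D using nz by simp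
  qed
  hence "\<forall>\<^sub>F t in cofinite. ((a i j + a j i) - (b i j + b j i))
      + t * ((a i j * (a j k + a k i) + a i k * a k j + a j i * (a i k + a k j) + a j k * a k i)
         - (b i j * (b j k + b k i) + b i k * b k j + b j i * (b i k + b k j) + b j k * b k i))
      + t^2 * (((a i j * a j k * a k i + a j i * a i k * a k j) + (a j k * a k j) * (a i k + a k i) + (a i k * a k i) * (a j k + a k j))
         - ((b i j * b j k * b k i + b j i * b i k * b k j) + (b j k * b k j) * (b i k + b k i) + (b i k * b k i) * (b j k + b k j)))
      + t^3 * (((a i k * a k i) * (a j k * a k j) + (a i k * a k i) * (a j k * a k j)) - ((b i k * b k i) * (b j k * b k j) + (b i k * b k i) * (b j k * b k j))) = 0"
    unfolding N by eventually_elim (simp add: algebra_simps)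
  note c = cubic_coeffs_zero[OF inf this]
  show ?Q using c(2) by simp
  show ?C using c(3) pjk pik by simp
qed

text \<open>After cancelling \<open>u - v\<close>, the pairs \<open>(p, q)\<close> and
  \<open>(p', q')\<close> have equal cross products and equal differences, and \<open>p - q\<close>
  is not zero.\<close>

lemma odd_pair_algebra:
  fixes u v p q p' q' :: 'k
  assumes "u \<noteq> v" "p \<noteq> q" "(u - v) * (p' * q - p * q') = 0" "(u - v) * (p' + q - p - q') = 0"
  shows "p' = p" "q' = q"
proof -
  have "p' * q - p * q' = 0" "p' + q - p - q' = 0" using assms by simp_all
  hence 1: "p' * q = p * q'" "q' = p' + q - p" by (auto simp: algebra_simps)
  hence "(p - q) * (p' - p) = 0" by (simp add: algebra_simps)
  thus "p' = p" using assms by simp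
  thus "q' = q" using 1 by simp
qed

text \<open>Up to transposing the triangle, \<open>b\<close> only exchanges the two labels of the
  odd pair. Each identity of the triple thus becomes \<open>a i j - a j i\<close> times a relation
  between the other two pairs.\<close>

lemma odd_pair:
  assumes h: "H U a b" and U: "i \<in> U" "j \<in> U" "k \<in> U"
    and c: "(red a b i j \<and> blue a b i k \<and> blue a b j k) \<or> (blue a b i j \<and> red a b i k \<and> red a b j k)"
  shows "undistinguished a i j k"
proof -
  have d: "i \<noteq> j" "j \<noteq> k" "i \<noteq> k" using c by (auto simp: red_def blue_def)
  note t = triple_identities[OF h U d]
  have nf: "a i j \<noteq> a j i" "a i k \<noteq> a k i" using c by (auto simp: red_def blue_def)
  have "(a i j - a j i) * (a j k + a k i - a i k - a k j) = 0"
    using c t(1) by (auto simp: red_def blue_def algebra_simps)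
  moreover have "(a i j - a j i) * (a j k * a k i - a i k * a k j) = 0"
    using c t(2) by (auto simp: red_def blue_def algebra_simps)
  ultimately show ?thesis using odd_pair_algebra[OF nf, of "a j k" "a k j"]
    by (simp add: undistinguished_def)
qed

lemma no_rainbow:
  assumes h: "H U a b" and U: "i \<in> U" "j \<in> U" "k \<in> U" and c: "red a b i j" "blue a b i k"
  shows "a j k \<noteq> a k j"
proof
  assume f: "a j k = a k j"
  have d: "i \<noteq> j" "i \<noteq> k" using c by (auto simp: red_def blue_def)
  moreover have "j \<noteq> k" using c by (auto simp: red_def blue_def)
  ultimately have t: "a i j * (a j k + a k i) + a i k * a k j + a j i * (a i k + a k j) + a j k * a k i =
         b i j * (b j k + b k i) + b i k * b k j + b j i * (b i k + b k j) + b j k * b k i"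
    using triple_identities(1)[OF h U] by blast
  have "b j k = a j k" "b k j = a j k" using pair_cases[OF h U(2,3) \<open>j \<noteq> k\<close>] f by auto
  hence "(a i j - a j i) * (a k i - a i k) = 0"
    using t c f by (simp add: red_def blue_def algebra_simps)
  thus False using c by (auto simp: red_def blue_def)
qed

text \<open>A colour amounts to an inequality between a label of \<open>b\<close> and one of
  \<open>a\<close>, and inequalities survive generic updates.\<close>

lemma colour_persists:
  assumes h: "H U a b" and U: "i \<in> U" "j \<in> U" "l \<in> U" "i \<noteq> l" "j \<noteq> l"
  shows "red a b i j \<Longrightarrow> \<forall>\<^sub>F t in cofinite. red (psi l t a) (psi l t b) i j"
    and "blue a b i j \<Longrightarrow> \<forall>\<^sub>F t in cofinite. blue (psi l t a) (psi l t b) i j"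
proof -
  note ok = psi_ok_eventually[OF H_fin[OF h], of l a]
  show "\<forall>\<^sub>F t in cofinite. red (psi l t a) (psi l t b) i j" if c: "red a b i j"
  proof -
    have "b i j \<noteq> a i j" "i \<noteq> j" using c by (auto simp: red_def)
    from fraction_eventually_neq[OF this(1), of "b i l * b l j" "b i l" "b l j" "a i l * a l j" "a i l" "a l j"] ok
    show ?thesis
    proof eventually_elim
      case (elim t)
      have "psi l t b i j \<noteq> psi l t a i j" using elim(1) U by (simp add: psi_def)
      thus ?case using pair_cases[OF H_psi[OF h U(3) elim(2)] U(1,2) \<open>i \<noteq> j\<close>] by (auto simp: red_def)
    qed
  qed
  show "\<forall>\<^sub>F t in cofinite. blue (psi l t a) (psi l t b) i j" if c: "blue a b i j"
  proof -
    have "b i j \<noteq> a j i" "i \<noteq> j" using c by (auto simp: blue_def)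
    from fraction_eventually_neq[OF this(1), of "b i l * b l j" "b i l" "b l j" "a j l * a l i" "a j l" "a l i"] ok
    show ?thesis
    proof eventually_elim
      case (elim t)
      have "psi l t b i j \<noteq> psi l t a j i" using elim(1) U by (simp add: psi_def)
      thus ?case using pair_cases[OF H_psi[OF h U(3) elim(2)] U(1,2) \<open>i \<noteq> j\<close>] by (auto simp: blue_def)
    qed
  qed
qed

text \<open>The twin relation of \<open>i\<close> and \<open>k\<close> for \<open>j\<close> also
  holds after a generic update at \<open>l\<close>. Its coefficient of \<open>t\<close> says that
  \<open>a i j\<close> and \<open>a j i\<close> both occur among \<open>a i l\<close> and
  \<open>a l i\<close>.\<close>

lemma P4_labels:
  assumes h: "H U a b" and U: "i \<in> U" "j \<in> U" "k \<in> U" "l \<in> U"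
    and c: "red a b i j" "red a b j k" "red a b k l" "blue a b i k" "blue a b i l" "blue a b j l"
  shows "(a i l = a i j \<and> a l i = a j i) \<or> (a i l = a j i \<and> a l i = a i j)"
proof -
  have rs: "red a b x y \<Longrightarrow> red a b y x" and bs: "blue a b x y \<Longrightarrow> blue a b y x" for x y
    by (auto simp: red_def blue_def)
  have und: "undistinguished a i k j" "undistinguished a j l k" "undistinguished a i j l"
    using odd_pair[OF h] U c rs bs by metis+
  have d: "i \<noteq> l" "j \<noteq> l" "k \<noteq> l" using c by (auto simp: red_def blue_def)
  have "\<forall>\<^sub>F t in cofinite. (a i j + t * (a i l * a l j)) * (1 + t * a k l) = (a k j + t * (a k l * a l j)) * (1 + t * a i l) \<and>
     (a j i + t * (a j l * a l i)) * (1 + t * a l k) = (a j k + t * (a j l * a l k)) * (1 + t * a l i)"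
    using colour_persists(1)[OF h U(1,2,4) d(1,2) c(1)] colour_persists(1)[OF h U(2,3,4) d(2,3) c(2)]
      colour_persists(2)[OF h U(1,3,4) d(1,3) c(4)] psi_ok_eventually[OF H_fin[OF h], of l a]
  proof eventually_elim
    case (elim t)
    note h' = H_psi[OF h U(4) elim(4)]
    have "red (psi l t a) (psi l t b) k j" using elim(2) by (auto simp: red_def)
    hence "undistinguished (psi l t a) i k j" using odd_pair[OF h' U(1,3,2)] elim by blast
    moreover have "1 + t * a i l \<noteq> 0" "1 + t * a l i \<noteq> 0" "1 + t * a j l \<noteq> 0" "1 + t * a l j \<noteq> 0"
       "1 + t * a k l \<noteq> 0" "1 + t * a l k \<noteq> 0"
      using elim(4) U d by (auto simp: psi_ok_def)
    ultimately show ?case using d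
      by (simp add: undistinguished_def psi_def frac_eq_eq)
  qed
  hence ev: "\<forall>\<^sub>F t in cofinite. (a i j - a k j) + t * ((a i l * a l j + a i j * a k l) - (a k l * a l j + a k j * a i l))
        + t^2 * (a i l * a l j * a k l - a k l * a l j * a i l) + t^3 * 0 = 0"
     "\<forall>\<^sub>F t in cofinite. (a j i - a j k) + t * ((a j l * a l i + a j i * a l k) - (a j l * a l k + a j k * a l i))
        + t^2 * (a j l * a l i * a l k - a j l * a l k * a l i) + t^3 * 0 = 0"
    by (eventually_elim, simp add: algebra_simps)+
  note c1 = cubic_coeffs_zero(2)[OF inf ev(1)] and c2 = cubic_coeffs_zero(2)[OF inf ev(2)]
  have "(a i j - a i l) * (a i j - a l i) = 0" "(a j i - a i l) * (a j i - a l i) = 0"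
    using c1 c2 und unfolding undistinguished_def by (simp_all add: algebra_simps)
  moreover have "a i j \<noteq> a j i" "a i l \<noteq> a l i" using c by (auto simp: red_def blue_def)
  ultimately show ?thesis by auto
qed

text \<open>\<open>T\<close> comes from the triangle identities and \<open>P4\<close> from
  \<open>P4_labels\<close>. Stability enters in \<open>S\<close>, as the coefficient of
  \<open>t\<close> in the equation that it provides for the flat pair.\<close>

lemma colouring:
  assumes h: "H U a b" and st: "stable U a"
  shows "clan_colouring U a (red a b) (blue a b)"
proof
  show "finite U" using H_fin[OF h] .
  show "red a b i j \<Longrightarrow> red a b j i" "blue a b i j \<Longrightarrow> blue a b j i" "\<not> red a b i i" "\<not> blue a b i i"
    "\<not> (red a b i j \<and> blue a b i j)" for i j by (auto simp: red_def blue_def)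
  show nf: "a i j \<noteq> a j i \<longleftrightarrow> red a b i j \<or> blue a b i j" if "i \<in> U" "j \<in> U" "i \<noteq> j" for i j
    using pair_cases[OF h that] by (auto simp: red_def blue_def)
  show "red a b j k \<and> undistinguished a i k j \<or> blue a b j k \<and> undistinguished a i j k"
    if "i \<in> U" "j \<in> U" "k \<in> U" "red a b i j" "blue a b i k" for i j k
  proof -
    have "j \<noteq> k" using that by (auto simp: red_def blue_def)
    hence "red a b j k \<or> blue a b j k" using nf[of j k] no_rainbow[OF h that] that by blast
    thus ?thesis using odd_pair[OF h that(1,3,2)] odd_pair[OF h that(1,2,3)] that
      by (auto simp: red_def blue_def)
  qed
  show "undistinguished a i k j"
    if U: "i \<in> U" "j \<in> U" "k \<in> U" "i \<noteq> j" "j \<noteq> k" "i \<noteq> k" and e: "a i j = a j i" "a j k = a k j" "a i k \<noteq> a k i" for i j k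
  proof -
    have "(a i j + t * (a i k * a k j)) * ((1 + t * a j k) * (1 + t * a k i)) =
          (a j i + t * (a j k * a k i)) * ((1 + t * a i k) * (1 + t * a k j))" for t
      using st U e(1) unfolding stable_def by blast
    hence "\<forall>\<^sub>F t in cofinite. 0 + t * ((a i j * (a j k + a k i) + a i k * a k j) - (a j i * (a i k + a k j) + a j k * a k i))
      + t^2 * ((a i j * (a j k * a k i) + a i k * a k j * (a j k + a k i)) - (a j i * (a i k * a k j) + a j k * a k i * (a i k + a k j)))
      + t^3 * 0 = 0"
      using e by (intro always_eventually allI) (simp add: algebra_simps power2_eq_square power3_eq_cube)
    from cubic_coeffs_zero(2)[OF inf this] have "(a i k - a k i) * (a k j - a i j) = 0"
      using e by (simp add: algebra_simps)
    thus ?thesis using e by (simp add: undistinguished_def)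
  qed
  show "(a i l = a i j \<and> a l i = a j i) \<or> (a i l = a j i \<and> a l i = a i j)"
    if "i \<in> U" "j \<in> U" "k \<in> U" "l \<in> U" "red a b i j" "red a b j k" "red a b k l" "blue a b i k" "blue a b i l" "blue a b j l"
    for i j k l using P4_labels[OF h that] .
qed

text \<open>A violation of stability is a nonzero polynomial in \<open>t\<close>, so a generic
  \<open>t\<close> makes the pair nonflat. It also keeps every nonflat pair nonflat, those at
  \<open>k\<close> because \<open>x / (1 + t * x)\<close> is injective.\<close>

lemma fewer_flat_pairs:
  assumes h: "H U a b" and n: "\<not> stable U a"
  shows "\<exists>k\<in>U. \<exists>t. psi_ok U k t a \<and> card (flat_pairs U (psi k t a)) < card (flat_pairs U a)"
proof -
  note fin = H_fin[OF h]
  obtain i j k t0 where U: "i \<in> U" "j \<in> U" "k \<in> U" "i \<noteq> j" "j \<noteq> k" "i \<noteq> k" and e: "a i j = a j i"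
    and t0: "(a i j + t0 * (a i k * a k j)) * ((1 + t0 * a j k) * (1 + t0 * a k i)) \<noteq>
          (a j i + t0 * (a j k * a k i)) * ((1 + t0 * a i k) * (1 + t0 * a k j))"
    using n unfolding stable_def by blast
  let ?p = "[:a i j, a i k * a k j:] * ([:1, a j k:] * [:1, a k i:]) - [:a j i, a j k * a k i:] * ([:1, a i k:] * [:1, a k j:])"
  have pp: "poly ?p t = (a i j + t * (a i k * a k j)) * ((1 + t * a j k) * (1 + t * a k i)) -
     (a j i + t * (a j k * a k i)) * ((1 + t * a i k) * (1 + t * a k j))" for t
    by (simp add: algebra_simps)
  have "poly ?p t0 \<noteq> 0" using t0 unfolding pp by simp
  hence p0: "?p \<noteq> 0" by auto
  have ev: "\<forall>\<^sub>F t in cofinite. \<forall>i'\<in>U. \<forall>j'\<in>U. a i' j' \<noteq> a j' i' \<longrightarrow> i' \<noteq> k \<longrightarrow> j' \<noteq> k \<longrightarrow> psi k t a i' j' \<noteq> psi k t a j' i'"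
  proof (intro eventually_ball_finite[OF fin] ballI)
    fix i' j' assume "i' \<in> U" "j' \<in> U"
    show "\<forall>\<^sub>F t in cofinite. a i' j' \<noteq> a j' i' \<longrightarrow> i' \<noteq> k \<longrightarrow> j' \<noteq> k \<longrightarrow> psi k t a i' j' \<noteq> psi k t a j' i'"
    proof (cases "a i' j' \<noteq> a j' i' \<and> i' \<noteq> k \<and> j' \<noteq> k")
      case True
      hence "a i' j' \<noteq> a j' i'" by blast
      from fraction_eventually_neq[OF this, of "a i' k * a k j'" "a i' k" "a k j'" "a j' k * a k i'" "a j' k" "a k i'"]
      show ?thesis by eventually_elim (use True in \<open>simp add: psi_def\<close>)
    next
      case False
      thus ?thesis by (intro always_eventually) blast
    qed
  qed
  have "\<forall>\<^sub>F t in cofinite. psi_ok U k t a \<and> poly ?p t \<noteq> 0 \<and> (\<forall>i'\<in>U. \<forall>j'\<in>U. a i' j' \<noteq> a j' i' \<longrightarrow> i' \<noteq> k \<longrightarrow> j' \<noteq> k \<longrightarrow> psi k t a i' j' \<noteq> psi k t a j' i')"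
    using psi_ok_eventually[OF fin] poly_eventually_nonzero[OF p0] ev by (intro eventually_conj)
  from cofinite_ex[OF inf this] obtain t where t: "psi_ok U k t a" "poly ?p t \<noteq> 0"
    and nf: "\<And>i' j'. i' \<in> U \<Longrightarrow> j' \<in> U \<Longrightarrow> a i' j' \<noteq> a j' i' \<Longrightarrow> i' \<noteq> k \<Longrightarrow> j' \<noteq> k \<Longrightarrow> psi k t a i' j' \<noteq> psi k t a j' i'" by blast
  have ok: "1 + t * a x k \<noteq> 0" "1 + t * a k x \<noteq> 0" if "x \<in> U" "x \<noteq> k" for x
    using t(1) that by (auto simp: psi_ok_def)
  have nfk: "psi k t a x k \<noteq> psi k t a k x" if "x \<in> U" "x \<noteq> k" "a x k \<noteq> a k x" for x
    using ok[OF that(1,2)] that by (simp add: psi_def frac_eq_eq algebra_simps)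
  have "flat_pairs U (psi k t a) \<subseteq> flat_pairs U a"
    using nf nfk unfolding flat_pairs_def by (auto, metis)
  moreover have "(i, j) \<in> flat_pairs U a" using U e by (simp add: flat_pairs_def)
  moreover have "(i, j) \<notin> flat_pairs U (psi k t a)"
  proof
    assume "(i, j) \<in> flat_pairs U (psi k t a)"
    hence "psi k t a i j = psi k t a j i" by (simp add: flat_pairs_def)
    hence "(a i j + t * (a i k * a k j)) * ((1 + t * a j k) * (1 + t * a k i)) =
          (a j i + t * (a j k * a k i)) * ((1 + t * a i k) * (1 + t * a k j))"
      using ok[OF U(1,6)] ok[OF U(2,5)] U by (simp add: psi_def frac_eq_eq)
    thus False using t(2) unfolding pp by simp
  qed
  moreover have "finite (flat_pairs U a)"
    by (rule finite_subset[of _ "U \<times> U"]) (use fin in \<open>auto simp: flat_pairs_def\<close>)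
  ultimately have "card (flat_pairs U (psi k t a)) < card (flat_pairs U a)"
    by (intro psubset_card_mono) auto
  thus ?thesis using t(1) U(3) by blast
qed

end


section \<open>Reversing clans\<close>

definition agree :: "'i set \<Rightarrow> ('i \<Rightarrow> 'i \<Rightarrow> 'k) \<Rightarrow> ('i \<Rightarrow> 'i \<Rightarrow> 'k) \<Rightarrow> bool" where
  "agree U a b \<longleftrightarrow> (\<forall>i\<in>U. \<forall>j\<in>U. i \<noteq> j \<longrightarrow> a i j = b i j)"

abbreviation (input) transposed :: "('i \<Rightarrow> 'i \<Rightarrow> 'k) \<Rightarrow> 'i \<Rightarrow> 'i \<Rightarrow> 'k" where
  "transposed a \<equiv> \<lambda>i j. a j i"

text \<open>The counter bounds the number of reversals, hence the free \<open>m\<close> in the base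
  rules. The two possible ends correspond to the two cases of diagonal equivalence.\<close>

inductive reach :: "'i set \<Rightarrow> ('i \<Rightarrow> 'i \<Rightarrow> 'k) \<Rightarrow> ('i \<Rightarrow> 'i \<Rightarrow> 'k) \<Rightarrow> nat \<Rightarrow> bool" for U b where
  reach_eq: "agree U a b \<Longrightarrow> reach U b a m"
| reach_transp: "agree U a (transposed b) \<Longrightarrow> reach U b a m"
| reach_flip: "clan U a X \<Longrightarrow> 2 \<le> card X \<Longrightarrow> X \<noteq> U \<Longrightarrow> reach U b (flip X a) m \<Longrightarrow> reach U b a (Suc m)"

lemma agree_refl [simp]: "agree U a a" by (simp add: agree_def)

lemma agree_sym: "agree U a b \<Longrightarrow> agree U b a" by (simp add: agree_def)

lemma agree_trans: "agree U a b \<Longrightarrow> agree U b c \<Longrightarrow> agree U a c" by (simp add: agree_def)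

lemma agree_mono: "agree U a b \<Longrightarrow> W \<subseteq> U \<Longrightarrow> agree W a b" by (auto simp: agree_def)

lemma agree_transp: "agree U (transposed a) (transposed b) \<longleftrightarrow> agree U a b" by (auto simp: agree_def)

lemma agree_flip: "agree U a b \<Longrightarrow> agree U (flip X a) (flip X b)" by (simp add: agree_def flip_def)

lemma clan_agree: "clan U a X \<Longrightarrow> agree U a b \<Longrightarrow> clan U b X"
  unfolding clan_def agree_def undistinguished_def by (metis DiffE subsetD)

lemma clan_transp: "clan U (transposed a) X \<longleftrightarrow> clan U a X"
  unfolding clan_def undistinguished_def by auto

lemma clanD: "clan U a X \<Longrightarrow> i \<in> X \<Longrightarrow> j \<in> X \<Longrightarrow> k \<in> U \<Longrightarrow> k \<notin> X \<Longrightarrow> undistinguished a i j k"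
  by (simp add: clan_def)

lemma clan_subset: "clan U a X \<Longrightarrow> X \<subseteq> U" by (simp add: clan_def)

lemma clan_eq:
  assumes "clan U a X" "i \<in> X" "j \<in> X" "k \<in> U" "k \<notin> X" shows "a i k = a j k" "a k i = a k j"
  using clanD[OF assms] by (auto simp: undistinguished_def)

lemma clan_flip:
  assumes "clan U a X" "X \<subseteq> Z \<or> X \<inter> Z = {} \<or> Z \<subseteq> X" shows "clan U (flip Z a) X"
  unfolding clan_def
proof (intro conjI ballI, rule clan_subset[OF assms(1)])
  fix i j k assume ijk: "i \<in> X" "j \<in> X" "k \<in> U - X"
  have e: "a i k = a j k" "a k i = a k j" using clan_eq[OF assms(1) ijk(1,2), of k] ijk(3) by auto
  have "k \<in> Z \<Longrightarrow> i \<in> Z \<longleftrightarrow> j \<in> Z" using assms(2) ijk by (auto simp: subset_iff disjoint_iff)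
  thus "undistinguished (flip Z a) i j k" using e by (auto simp: undistinguished_def flip_def)
qed

lemma reach_agree: "reach U b a m \<Longrightarrow> agree U a a' \<Longrightarrow> reach U b a' m"
proof (induction arbitrary: a' rule: reach.induct)
  case (reach_eq a m) thus ?case using agree_sym agree_trans reach.reach_eq by metis
next
  case (reach_transp a m) thus ?case using agree_sym agree_trans reach.reach_transp by metis
next
  case (reach_flip a X m) thus ?case using clan_agree agree_flip reach.reach_flip by metis
qed

lemma reach_agree_target: "reach U b a m \<Longrightarrow> agree U b b' \<Longrightarrow> reach U b' a m"
proof (induction rule: reach.induct)
  case (reach_eq a m) thus ?case using agree_trans reach.reach_eq by metis
next
  case (reach_transp a m)
  hence "agree U a (transposed b')" using agree_trans[of U a "transposed b" "transposed b'"] agree_transp[of U b b'] by blast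
  thus ?case by (rule reach.reach_transp)
next
  case (reach_flip a X m) thus ?case using reach.reach_flip by metis
qed

lemma reach_mono: "reach U b a m \<Longrightarrow> m \<le> m' \<Longrightarrow> reach U b a m'"
proof (induction arbitrary: m' rule: reach.induct)
  case (reach_flip a X m)
  then obtain m'' where "m' = Suc m''" "m \<le> m''" by (cases m') auto
  thus ?case using reach_flip reach.reach_flip by metis
qed (auto intro: reach.intros)

section \<open>Updates commute with reversals\<close>

lemma psi_agree: "agree U a b \<Longrightarrow> k \<in> U \<Longrightarrow> agree U (psi k t a) (psi k t b)"
  unfolding agree_def psi_def by simp

lemma psi_transp: "psi k t (transposed a) = transposed (psi k t a)"
  by (auto simp: psi_def fun_eq_iff mult.commute)

text \<open>Outside the clan \<open>a i l\<close> equals \<open>a k l\<close>, so the factor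
  \<open>1 + t * a i k\<close> cancels and \<open>i\<close> looks to \<open>l\<close> exactly as
  \<open>k\<close> does.\<close>

lemma psi_clan_mem:
  assumes c: "clan U a X" and k: "k \<in> X" and ok: "psi_ok U k t a" and i: "i \<in> X" and l: "l \<in> U" "l \<notin> X"
  shows "psi k t a i l = a k l / (1 + t * a k l)" "psi k t a l i = a l k / (1 + t * a l k)"
proof -
  have e: "a i l = a k l" "a l i = a l k" using clan_eq[OF c i k l] by auto
  have lk: "l \<noteq> k" using l k by auto
  have o: "1 + t * a i k \<noteq> 0" "1 + t * a k i \<noteq> 0" if "i \<noteq> k"
    using ok i that clan_subset[OF c] by (auto simp: psi_ok_def)
  have f: "a k l + t * (a i k * a k l) = (1 + t * a i k) * a k l" "a l k + t * (a l k * a k i) = (1 + t * a k i) * a l k"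
    by (simp_all add: algebra_simps)
  show "psi k t a i l = a k l / (1 + t * a k l)"
    using o e f lk by (cases "i = k") (auto simp: psi_def)
  show "psi k t a l i = a l k / (1 + t * a l k)"
    using o e f lk by (cases "i = k") (auto simp: psi_def mult.commute[of "1 + t * a l k"])
qed

lemma clan_psi:
  assumes c: "clan U a X" and k: "k \<in> U" and ok: "psi_ok U k t a"
  shows "clan U (psi k t a) X"
  unfolding clan_def
proof (intro conjI ballI, rule clan_subset[OF c])
  fix i j l assume ij: "i \<in> X" "j \<in> X" "l \<in> U - X"
  show "undistinguished (psi k t a) i j l"
  proof (cases "k \<in> X")
    case True
    thus ?thesis using psi_clan_mem[OF c True ok] ij by (simp add: undistinguished_def)
  next
    case False
    have "a i l = a j l" "a l i = a l j" "a i k = a j k" "a k i = a k j" "i \<noteq> k" "j \<noteq> k"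
      using clan_eq[OF c ij(1,2)] ij k False by auto
    thus ?thesis by (simp add: undistinguished_def psi_def)
  qed
qed

text \<open>Inside \<open>X\<close>, an update at \<open>k\<close> in \<open>X\<close> commutes with
  transposing, and for \<open>k\<close> outside both orders of a pair receive the same correction,
  since all of \<open>X\<close> has the same labels with \<open>k\<close>. Across the boundary
  \<open>psi_clan_mem\<close> shows that labels inside \<open>X\<close> do not matter.\<close>

lemma psi_flip:
  assumes c: "clan U a X" and k: "k \<in> U" and ok: "psi_ok U k t a"
  shows "agree U (psi k t (flip X a)) (flip X (psi k t a))"
  unfolding agree_def
proof (intro ballI impI)
  fix i j assume ij: "i \<in> U" "j \<in> U" "i \<noteq> j"
  have ok': "psi_ok U k t (flip X a)" using ok by (auto simp: psi_ok_def flip_def)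
  have cf: "clan U (flip X a) X" using clan_flip[OF c] by blast
  consider "i \<in> X" "j \<in> X" | "i \<notin> X" "j \<notin> X" | "i \<in> X" "j \<notin> X" | "i \<notin> X" "j \<in> X" by blast
  thus "psi k t (flip X a) i j = flip X (psi k t a) i j"
  proof cases
    case 1
    show ?thesis
    proof (cases "k \<in> X")
      case True
      thus ?thesis using 1 by (auto simp: psi_def flip_def mult.commute)
    next
      case False
      have "a i k = a j k" "a k i = a k j" using clan_eq[OF c 1 k False] by auto
      thus ?thesis using 1 False by (auto simp: psi_def flip_def)
    qed
  next
    case 2
    thus ?thesis by (auto simp: psi_def flip_def)
  next
    case 3
    show ?thesis
    proof (cases "k \<in> X")
      case True
      thus ?thesis using psi_clan_mem(1)[OF c True ok, of i j] psi_clan_mem(1)[OF cf True ok', of i j] 3 ij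
        by (simp add: flip_def)
    qed (use 3 in \<open>auto simp: psi_def flip_def\<close>)
  next
    case 4
    show ?thesis
    proof (cases "k \<in> X")
      case True
      thus ?thesis using psi_clan_mem(2)[OF c True ok, of j i] psi_clan_mem(2)[OF cf True ok', of j i] 4 ij
        by (simp add: flip_def)
    qed (use 4 in \<open>auto simp: psi_def flip_def\<close>)
  qed
qed

lemma psi_ok_flip: "psi_ok U k t a \<Longrightarrow> psi_ok U k t (flip X a)"
  by (auto simp: psi_ok_def flip_def)

text \<open>Rests on \<open>1 - t * (x / (1 + t * x)) = 1 / (1 + t * x)\<close>.\<close>

lemma psi_inverse:
  assumes ok: "psi_ok U k t a" and k: "k \<in> U"
  shows "agree U (psi k (- t) (psi k t a)) a" "psi_ok U k (- t) (psi k t a)"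
proof -
  have o: "1 + t * a i k \<noteq> 0" "1 + t * a k i \<noteq> 0" if "i \<in> U" "i \<noteq> k" for i
    using ok that by (auto simp: psi_ok_def)
  have inv: "1 + - t * (x / (1 + t * x)) = 1 / (1 + t * x)" if "1 + t * x \<noteq> 0" for x :: 'b
    using that by (simp add: field_simps)
  have pk: "psi k t a i k = a i k / (1 + t * a i k)" "psi k t a k i = a k i / (1 + t * a k i)" if "i \<noteq> k" for i
    using that by (auto simp: psi_def)
  show "psi_ok U k (- t) (psi k t a)" unfolding psi_ok_def
  proof (intro ballI conjI)
    fix i assume i: "i \<in> U - {k}"
    show "1 + - t * psi k t a i k \<noteq> 0" "1 + - t * psi k t a k i \<noteq> 0"
      using i o[of i] inv[of "a i k"] inv[of "a k i"] pk[of i] by auto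
  qed
  show "agree U (psi k (- t) (psi k t a)) a" unfolding agree_def
  proof (intro ballI impI)
    fix i j assume ij: "i \<in> U" "j \<in> U" "i \<noteq> j"
    have undo: "(x / (1 + t * x)) / (1 + - t * (x / (1 + t * x))) = x" if "1 + t * x \<noteq> 0" for x :: 'b
      using inv[OF that] that by simp
    show "psi k (- t) (psi k t a) i j = a i j"
    proof (cases "i = k \<or> j = k")
      case True
      thus ?thesis using undo[of "a k j"] undo[of "a i k"] o[of i] o[of j] pk[of i] pk[of j] ij
        by (auto simp: psi_def)
    next
      case False
      have n: "1 + t * a i k \<noteq> 0" "1 + t * a k j \<noteq> 0" using o ij False by auto
      have "psi k (- t) (psi k t a) i j = (psi k t a i j + - t * (a i k / (1 + t * a i k) * (a k j / (1 + t * a k j)))) *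
          ((1 + t * a i k) * (1 + t * a k j))"
        using False n inv pk[of i] pk[of j] by (simp add: psi_def[of k "- t"])
      also have "\<dots> = a i j"
      proof -
        have "(x + t * (u * v)) / D + - t * (u * v / D) = x / D" for x u v D :: 'b
          by (simp add: add_divide_distrib)
        thus ?thesis using False n by (simp add: psi_def[of k t])
      qed
      finally show ?thesis .
    qed
  qed
qed

lemma reach_psi:
  "reach U b a m \<Longrightarrow> k \<in> U \<Longrightarrow> psi_ok U k t a \<Longrightarrow> reach U (psi k t b) (psi k t a) m"
proof (induction rule: reach.induct)
  case (reach_eq a m) thus ?case using psi_agree reach.reach_eq by metis
next
  case (reach_transp a m)
  hence "agree U (psi k t a) (transposed (psi k t b))"
    using psi_agree[of U a "transposed b" k t] unfolding psi_transp[of k t b] by blast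
  thus ?case by (rule reach.reach_transp)
next
  case (reach_flip a X m)
  note ok = reach_flip.prems(2) and k = reach_flip.prems(1) and c = reach_flip.hyps(1)
  have "reach U (psi k t b) (flip X (psi k t a)) m"
    by (rule reach_agree[OF reach_flip.IH[OF k psi_ok_flip[OF ok]] psi_flip[OF c k ok]])
  thus ?case by (rule reach.reach_flip[OF clan_psi[OF c k ok] reach_flip.hyps(2,3)])
qed

text \<open>A solution for the updated structures solves the original problem with the same
  sets.\<close>

lemma reach_psi_rev:
  assumes r: "reach U (psi k t b) (psi k t a) m" and k: "k \<in> U" and ok: "psi_ok U k t a" "psi_ok U k t b"
  shows "reach U b a m"
proof -
  have "reach U (psi k (- t) (psi k t b)) (psi k (- t) (psi k t a)) m"
    by (rule reach_psi[OF r k psi_inverse(2)[OF ok(1) k]])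
  from reach_agree_target[OF reach_agree[OF this psi_inverse(1)[OF ok(1) k]] psi_inverse(1)[OF ok(2) k]]
  show ?thesis .
qed

section \<open>Gluing along a clan and its quotient\<close>

lemma clan_restrict_trans:
  assumes "clan U a X" "clan X a Z" shows "clan U a Z"
  unfolding clan_def
proof (intro conjI ballI)
  show "Z \<subseteq> U" using assms by (auto simp: clan_def)
  fix i j k assume ijk: "i \<in> Z" "j \<in> Z" "k \<in> U - Z"
  show "undistinguished a i j k"
  proof (cases "k \<in> X")
    case True thus ?thesis using clanD[OF assms(2)] ijk by blast
  next
    case False
    have "i \<in> X" "j \<in> X" "k \<in> U" using ijk clan_subset[OF assms(2)] by auto
    thus ?thesis using clanD[OF assms(1)] False by blast
  qed
qed

lemma clan_lift:
  assumes X: "clan U a X" "x \<in> X" and Z: "clan (insert x (U - X)) a Z"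
  shows "clan U a (if x \<in> Z then Z \<union> X else Z)"
proof (cases "x \<in> Z")
  case True
  have "clan U a (Z \<union> X)" unfolding clan_def
  proof (intro conjI ballI)
    show "Z \<union> X \<subseteq> U" using clan_subset[OF X(1)] clan_subset[OF Z] X by auto
    fix i j k assume i: "i \<in> Z \<union> X" and j: "j \<in> Z \<union> X" and k: "k \<in> U - (Z \<union> X)"
    have "undistinguished a i x k" if "i \<in> Z \<union> X" for i
      using that clanD[OF X(1) _ X(2), of i k] clanD[OF Z _ True, of i k] k by auto
    thus "undistinguished a i j k" using i j undist_trans undist_sym by metis
  qed
  thus ?thesis using True by simp
next
  case False
  have "clan U a Z" unfolding clan_def
  proof (intro conjI ballI)
    show "Z \<subseteq> U" using clan_subset[OF X(1)] clan_subset[OF Z] X by auto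
    fix i j k assume i: "i \<in> Z" and j: "j \<in> Z" and k: "k \<in> U - Z"
    have iX: "i \<in> U" "j \<in> U" "i \<notin> X" "j \<notin> X" using i j clan_subset[OF Z] clan_subset[OF X(1)] False X by auto
    show "undistinguished a i j k"
    proof (cases "k \<in> X")
      case True
      have "undistinguished a i j x" using clanD[OF Z i j _ False] by simp
      thus ?thesis using clan_eq[OF X(1) True X(2)] iX by (simp add: undistinguished_def)
    next
      case False
      thus ?thesis using clanD[OF Z i j] k by blast
    qed
  qed
  thus ?thesis using False by simp
qed

text \<open>Since \<open>X\<close> is a clan of both, labels across its boundary can be read off at
  the representative \<open>x\<close>.\<close>

lemma agree_glue:
  assumes "clan U a X" "clan U c X" "x \<in> X" "agree X a c" "agree (insert x (U - X)) a c"
  shows "agree U a c"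
  unfolding agree_def
proof (intro ballI impI)
  fix i j assume ij: "i \<in> U" "j \<in> U" "i \<noteq> j"
  have e: "a i' j' = c i' j' \<and> a j' i' = c j' i'" if "i' \<in> X" "j' \<in> U" "j' \<notin> X" for i' j'
  proof -
    have "a x j' = c x j'" "a j' x = c j' x" using assms(5) that assms(3) unfolding agree_def by auto
    thus ?thesis using clan_eq[OF assms(1) that(1) assms(3) that(2,3)] clan_eq[OF assms(2) that(1) assms(3) that(2,3)] by simp
  qed
  consider "i \<in> X" "j \<in> X" | "i \<notin> X" "j \<notin> X" | "i \<in> X" "j \<notin> X" | "i \<notin> X" "j \<in> X" by blast
  thus "a i j = c i j"
    by cases (use assms(4,5) ij e[of i j] e[of j i] in \<open>auto simp: agree_def\<close>)
qed

text \<open>A reversal in the quotient is carried out on \<open>U\<close> with the set enlarged by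
  \<open>X\<close> if it contains \<open>x\<close>. This may transpose the inside of
  \<open>X\<close>, which thus stays \<open>b\<close> or its transpose but can finally face the
  wrong way; reversing \<open>X\<close> then costs the additional step.\<close>

lemma reach_glue_outer_aux:
  assumes "reach (insert x (U - X)) b a m" and X: "clan U b X" "x \<in> X" "2 \<le> card X" "X \<noteq> U" "finite U"
    and "agree (insert x (U - X)) a a'" "clan U a' X" "agree X a' b \<or> agree X a' (transposed b)"
  shows "reach U b a' (Suc m)"
  using assms(1,7,8,9)
proof (induction arbitrary: a' rule: reach.induct)
  case (reach_eq a m)
  have ag: "agree (insert x (U - X)) a' b" using reach_eq(1,2) agree_trans agree_sym by metis
  show ?case
  proof (cases "agree X a' b")
    case True
    thus ?thesis using agree_glue[OF reach_eq(3) X(1,2) True ag] reach.reach_eq by metis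
  next
    case False
    have "agree X (flip X a') b" using reach_eq(4) False by (auto simp: agree_def flip_def)
    moreover have "agree (insert x (U - X)) (flip X a') b" using ag X by (auto simp: agree_def flip_def)
    moreover have "clan U (flip X a') X" using clan_flip[OF reach_eq(3)] by blast
    ultimately have "agree U (flip X a') b" using agree_glue[OF _ X(1,2)] by blast
    thus ?thesis using reach.reach_flip[OF reach_eq(3) X(3,4)] reach.reach_eq by metis
  qed
next
  case (reach_transp a m)
  have ag: "agree (insert x (U - X)) a' (transposed b)" using reach_transp(1,2) agree_trans agree_sym by metis
  have c: "clan U (transposed b) X" using X(1) clan_transp[of U b X] by simp
  show ?case
  proof (cases "agree X a' (transposed b)")
    case True
    thus ?thesis using agree_glue[OF reach_transp(3) c X(2) True ag] reach.reach_transp by metis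
  next
    case False
    have "agree X (flip X a') (transposed b)" using reach_transp(4) False by (auto simp: agree_def flip_def)
    moreover have "agree (insert x (U - X)) (flip X a') (transposed b)" using ag X by (auto simp: agree_def flip_def)
    moreover have "clan U (flip X a') X" using clan_flip[OF reach_transp(3)] by blast
    ultimately have "agree U (flip X a') (transposed b)" using agree_glue[OF _ c X(2)] by blast
    thus ?thesis using reach.reach_flip[OF reach_transp(3) X(3,4)] reach.reach_transp by metis
  qed
next
  case (reach_flip a Z m)
  let ?U = "insert x (U - X)"
  define Z' where "Z' = (if x \<in> Z then Z \<union> X else Z)"
  have "clan ?U a' Z" using clan_agree reach_flip.hyps(1) reach_flip.prems(1) by metis
  hence cl: "clan U a' Z'" unfolding Z'_def by (rule clan_lift[OF reach_flip.prems(2) X(2)])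
  have ZU: "Z \<subseteq> ?U" using clan_subset[OF reach_flip.hyps(1)] .
  have XU: "X \<subseteq> U" using clan_subset[OF X(1)] .
  have XZ': "X \<subseteq> Z' \<or> X \<inter> Z' = {}" using ZU by (auto simp: Z'_def)
  have "agree ?U (flip Z a) (flip Z a')" using reach_flip.prems(1) by (rule agree_flip)
  moreover have "agree ?U (flip Z a') (flip Z' a')" using ZU X(2) by (auto simp: agree_def flip_def Z'_def)
  ultimately have "agree ?U (flip Z a) (flip Z' a')" by (rule agree_trans)
  moreover have "agree X (flip Z' a') b \<or> agree X (flip Z' a') (transposed b)"
    using XZ'
  proof
    assume "X \<subseteq> Z'"
    hence "agree X (flip Z' a') (transposed a')" by (auto simp: agree_def flip_def)
    moreover have "agree X (transposed a') b \<or> agree X (transposed a') (transposed b)"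
      using reach_flip.prems(3) agree_transp[of X a' b] agree_transp[of X a' "transposed b"] by blast
    ultimately show ?thesis using agree_trans[of X "flip Z' a'" "transposed a'"] by blast
  next
    assume "X \<inter> Z' = {}"
    hence "agree X (flip Z' a') a'" by (auto simp: agree_def flip_def)
    thus ?thesis using reach_flip.prems(3) agree_trans by metis
  qed
  moreover have "clan U (flip Z' a') X" using clan_flip[OF reach_flip.prems(2)] XZ' by blast
  ultimately have r: "reach U b (flip Z' a') (Suc m)" using reach_flip.IH by blast
  have "2 \<le> card Z'"
  proof -
    have "finite Z'" using cl X(5) finite_subset by (auto simp: clan_def)
    hence "card Z \<le> card Z'" by (rule card_mono) (auto simp: Z'_def)
    thus ?thesis using reach_flip.hyps(2) by simp
  qed
  moreover have "Z' \<noteq> U" using reach_flip.hyps(3) ZU XU X(2,4) by (auto simp: Z'_def split: if_splits)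
  ultimately show ?case using reach.reach_flip[OF cl _ _ r] by blast
qed

lemma reach_glue_outer:
  assumes "reach (insert x (U - X)) b a m" and "clan U a X" and X: "clan U b X" "x \<in> X" "2 \<le> card X" "X \<noteq> U" "finite U"
    and "agree X a b \<or> agree X a (transposed b)"
  shows "reach U b a (Suc m)"
  using reach_glue_outer_aux[OF assms(1) X agree_refl assms(2,8)] .

text \<open>Reversals of proper clans of \<open>X\<close> leave the quotient untouched, so they come
  first; the summand 1 is the corrective reversal of \<open>X\<close>.\<close>

lemma reach_glue:
  assumes "reach X b a m" and "clan U a X" and X: "clan U b X" "x \<in> X" "2 \<le> card X" "X \<noteq> U" "finite U"
    and "reach (insert x (U - X)) b a m'"
  shows "reach U b a (m + m' + 1)"
  using assms(1,2,8)
proof (induction rule: reach.induct)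
  case (reach_eq a m)
  have "reach U b a (Suc m')" using reach_glue_outer[OF reach_eq(3,2) X] reach_eq(1) by blast
  thus ?case by (rule reach_mono) simp
next
  case (reach_transp a m)
  have "reach U b a (Suc m')" using reach_glue_outer[OF reach_transp(3,2) X] reach_transp(1) by blast
  thus ?case by (rule reach_mono) simp
next
  case (reach_flip a Z m)
  let ?U = "insert x (U - X)"
  have ZX: "Z \<subseteq> X" "Z \<noteq> X" using clan_subset[OF reach_flip.hyps(1)] reach_flip.hyps(3) by auto
  have "agree ?U a (flip Z a)" using ZX by (auto simp: agree_def flip_def)
  hence "reach ?U b (flip Z a) m'" using reach_agree reach_flip.prems(2) by metis
  hence r: "reach U b (flip Z a) (m + m' + 1)"
    using reach_flip.IH[OF clan_flip[OF reach_flip.prems(1)]] ZX by blast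
  have "Z \<noteq> U" using ZX clan_subset[OF X(1)] by blast
  thus ?case
    using reach.reach_flip[OF clan_restrict_trans[OF reach_flip.prems(1) reach_flip.hyps(1)] reach_flip.hyps(2) _ r] by simp
qed

section \<open>Clans common to two equivalent structures\<close>

context pm_relation
begin

lemma colouring_target:
  assumes h: "H U a b" and st: "stable U b"
  shows "clan_colouring U b (red a b) (blue a b)"
proof -
  have "clan_colouring U b (red b a) (blue b a)" by (rule colouring[OF H_sym[OF h] st])
  moreover have "red b a = red a b" "blue b a = blue a b" by (auto simp: red_def blue_def fun_eq_iff)
  ultimately show ?thesis by simp
qed

text \<open>As \<open>b\<close> does not separate \<open>i\<close> and \<open>j\<close> at
  \<open>k\<close>, exactly one of their pairs with \<open>k\<close> is reversed. The twin relation
  of this triangle puts \<open>k\<close> between \<open>i\<close> and \<open>j\<close>: one label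
  runs from \<open>i\<close> to \<open>k\<close>, from \<open>k\<close> to \<open>j\<close> and from
  \<open>i\<close> to \<open>j\<close>.\<close>

lemma split_clan:
  assumes h: "H U a b" and c: "clan_colouring U a (red a b) (blue a b)"
    and X: "clan U b X" and ij: "i \<in> X" "j \<in> X" and k: "k \<in> U" "k \<notin> X" and d: "\<not> undistinguished a i j k"
  shows "(red a b i k \<and> blue a b j k) \<or> (blue a b i k \<and> red a b j k)"
    "a i j = a i k" "a k j = a i k" "a j i = a k i" "a j k = a k i"
proof -
  interpret c: clan_colouring U a "red a b" "blue a b" by (rule c)
  have U: "i \<in> U" "j \<in> U" using ij clan_subset[OF X] by auto
  have n: "i \<noteq> k" "j \<noteq> k" using ij k by auto
  have e: "b i k = b j k" "b k i = b k j" using clan_eq[OF X ij k] .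
  note pi = pair_cases[OF h U(1) k(1) n(1)] and pj = pair_cases[OF h U(2) k(1) n(2)]
  show col: "(red a b i k \<and> blue a b j k) \<or> (blue a b i k \<and> red a b j k)"
    using pi pj e d unfolding red_def blue_def undistinguished_def by metis
  hence "undistinguished a k j i \<or> undistinguished a k i j"
    using c.T[of k i j] c.T[of k j i] U k c.R_sym c.B_sym by blast
  moreover have "a j k = a k i" "a k j = a i k" using col e by (auto simp: red_def blue_def)
  ultimately show "a i j = a i k" "a k j = a i k" "a j i = a k i" "a j k = a k i"
    by (auto simp: undistinguished_def)
qed

lemma monochromatic_agree:
  assumes h: "H U a b"
  shows "(\<And>i j. i \<in> U \<Longrightarrow> j \<in> U \<Longrightarrow> \<not> red a b i j) \<Longrightarrow> agree U a b"
    "(\<And>i j. i \<in> U \<Longrightarrow> j \<in> U \<Longrightarrow> \<not> blue a b i j) \<Longrightarrow> agree U a (transposed b)"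
  using pair_cases[OF h] unfolding agree_def red_def blue_def by metis+

text \<open>\<open>K\<close> consists of the points between \<open>i\<close> and \<open>j\<close> in
  the sense of \<open>split_clan\<close>. Reversing \<open>K\<close> together with \<open>i\<close>
  moves \<open>i\<close> past them, next to \<open>j\<close>.\<close>

lemma small_common_clan:
  assumes h: "H U a b" and c: "clan_colouring U a (red a b) (blue a b)"
    and X: "clan U b {i, j}" "i \<noteq> j" "{i, j} \<noteq> U"
  shows "clan U a {i, j} \<or> (\<exists>Z. clan U a Z \<and> 2 \<le> card Z \<and> Z \<noteq> U \<and> clan U (flip Z a) {i, j})"
proof -
  interpret c: clan_colouring U a "red a b" "blue a b" by (rule c)
  define K where "K = {k\<in>U - {i, j}. \<not> undistinguished a i j k}"
  have U: "i \<in> U" "j \<in> U" using clan_subset[OF X(1)] by auto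
  have und: "undistinguished a i j l" if "l \<in> U" "l \<noteq> i" "l \<noteq> j" "l \<notin> K" for l
    using that by (auto simp: K_def)
  show ?thesis
  proof (cases "K = {}")
    case True
    have "undistinguished a p q l" if "p \<in> {i, j}" "q \<in> {i, j}" "l \<in> U - {i, j}" for p q l
      using und[of l] that True undist_sym[of a i j l] by auto
    hence "clan U a {i, j}" using U unfolding clan_def by auto
    thus ?thesis by blast
  next
    case False
    have sp: "(red a b i k \<and> blue a b j k) \<or> (blue a b i k \<and> red a b j k)"
      "a i j = a i k" "a k j = a i k" "a j i = a k i" "a j k = a k i" if "k \<in> K" for k
      using split_clan[OF h c X(1), of i j k] that by (auto simp: K_def)
    define Z where "Z = insert i K"
    have KU: "K \<subseteq> U" "i \<notin> K" "j \<notin> K" by (auto simp: K_def)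
    \<comment> \<open>For \<open>l = j\<close> the labels of \<open>split_clan\<close> suffice, a
      point flat to \<open>i\<close> is handled by \<open>S\<close>, and a coloured one by
      \<open>main\<close>.\<close>
    have ui: "undistinguished a p i l" if p: "p \<in> K" and l: "l \<in> U" "l \<notin> Z" for p l
    proof (cases "l = j")
      case True
      thus ?thesis using sp(2-5)[OF p] by (simp add: undistinguished_def)
    next
      case False
      have lK: "l \<noteq> i" "l \<notin> K" "l \<noteq> p" using l p by (auto simp: Z_def)
      have pU: "p \<in> U" "p \<noteq> i" "p \<noteq> j" using p KU by auto
      have eij: "undistinguished a i j l" using und[OF l(1) lK(1) False lK(2)] .
      have bij: "b i l = b j l" "b l i = b l j" using clan_eq[OF X(1), of i j l] l lK False by auto
      note s = sp[OF p]
      \<comment> \<open>Colours and ends are left open: \<open>l\<close> has a common colour towards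
        \<open>i\<close> and \<open>j\<close>, which may be either one, and exactly one of
        \<open>i\<close>, \<open>j\<close> has this colour towards \<open>p\<close>.\<close>
      have main: "undistinguished a p i l"
        if k: "clan_colouring U a R' B'" and ef: "(e = i \<and> f = j) \<or> (e = j \<and> f = i)"
          and cl: "R' e l" "R' f l" "B' e p" "R' f p" for R' B' e f
      proof -
        interpret k: clan_colouring U a R' B' by (rule k)
        have efU: "e \<in> U" "f \<in> U" using ef U by auto
        have ef': "a f p = a p e" "a p f = a e p" using ef s(2-5) by auto
        from k.T[OF efU(1) l(1) pU(1) cl(1,3)] have "undistinguished a p f l \<or> undistinguished a p e l"
        proof
          assume "R' l p \<and> undistinguished a e p l"
          thus ?thesis using undist_sym by metis
        next
          assume B: "B' l p \<and> undistinguished a e l p"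
          have "undistinguished a l p f" using k.odd_right[of l f p] l efU pU cl B k.R_sym by blast
          hence "undistinguished a p f l" using B ef' by (simp add: undistinguished_def)
          thus ?thesis by blast
        qed
        thus ?thesis using ef eij undist_trans undist_sym by metis
      qed
      show ?thesis
      proof (cases "a i l = a l i")
        case True
        have lp: "a l p = a p l"
        proof (rule ccontr)
          assume "a l p \<noteq> a p l"
          hence "red a b p l \<or> blue a b p l" using c.nonflat[of p l] l pU lK by metis
          hence "a l i \<noteq> a i l \<or> a l j \<noteq> a j l"
            using s(1) no_rainbow[OF h pU(1) l(1), of i] no_rainbow[OF h pU(1) l(1), of j]
              no_rainbow[OF h pU(1) U(1) l(1)] no_rainbow[OF h pU(1) U(2) l(1)] U c.R_sym c.B_sym by metis
          thus False using True eij by (auto simp: undistinguished_def)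
        qed
        have "undistinguished a j p l"
          by (rule c.S) (use U l pU lK False True lp eij s(1) c.nonflat[of j p] in \<open>auto simp: undistinguished_def\<close>)
        thus ?thesis using eij undist_trans undist_sym by metis
      next
        case nf: False
        have "red a b i l \<and> red a b j l \<or> blue a b i l \<and> blue a b j l"
          using nf eij bij pair_cases[OF h U(1) l(1)] lK by (auto simp: undistinguished_def red_def blue_def)
        thus ?thesis
          using main[OF c, of i j] main[OF c, of j i] main[OF c.swap_colours, of i j] main[OF c.swap_colours, of j i] s(1)
          by blast
      qed
    qed
    have cZ: "clan U a Z" unfolding clan_def
    proof (intro conjI ballI)
      show "Z \<subseteq> U" using KU U by (auto simp: Z_def)
      fix p q l assume pq: "p \<in> Z" "q \<in> Z" "l \<in> U - Z"
      have "undistinguished a p i l" "undistinguished a q i l"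
        using pq ui[of p l] ui[of q l] by (auto simp: Z_def)
      thus "undistinguished a p q l" using undist_trans undist_sym by metis
    qed
    moreover have "2 \<le> card Z"
    proof -
      obtain k where "k \<in> K" using False by blast
      thus ?thesis using card_two_le[of Z i k] KU H_fin[OF h] U finite_subset[of Z U] by (auto simp: Z_def)
    qed
    moreover have "Z \<noteq> U" using KU U X(2) by (auto simp: Z_def)
    moreover have "undistinguished (flip Z a) i j k" if "k \<in> U" "k \<noteq> i" "k \<noteq> j" for k
    proof (cases "k \<in> K")
      case True
      thus ?thesis using sp(2-5)[OF True] KU X(2) by (simp add: flip_def undistinguished_def Z_def)
    next
      case False
      thus ?thesis using und[OF that False] that by (simp add: flip_def undistinguished_def Z_def)
    qed
    hence "undistinguished (flip Z a) p q k" if "p \<in> {i, j}" "q \<in> {i, j}" "k \<in> U - {i, j}" for p q k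
      using that undist_sym[of "flip Z a" i j k] by auto
    hence "clan U (flip Z a) {i, j}" using U unfolding clan_def by auto
    ultimately show ?thesis by blast
  qed
qed

text \<open>A smallest clan \<open>X\<close> of \<open>b\<close> is primitive, hence of one colour
  if it has three points or more; as both colours occur, it is not \<open>U\<close>. A point
  splitting such an \<open>X\<close> in \<open>a\<close> would divide it into two clans, against
  primitivity.\<close>

lemma common_clan:
  assumes h: "H U a b" and st: "stable U a" "stable U b" and n: "\<not> agree U a b" "\<not> agree U a (transposed b)"
  shows "\<exists>X. 2 \<le> card X \<and> X \<noteq> U \<and> clan U b X \<and>
    (clan U a X \<or> (\<exists>Z. clan U a Z \<and> 2 \<le> card Z \<and> Z \<noteq> U \<and> clan U (flip Z a) X))"
proof -
  note ca = colouring[OF h st(1)] and cb = colouring_target[OF h st(2)] and fin = H_fin[OF h]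
  interpret ca: clan_colouring U a "red a b" "blue a b" by (rule ca)
  interpret cb: clan_colouring U b "red a b" "blue a b" by (rule cb)
  obtain r r' where r: "r \<in> U" "r' \<in> U" "red a b r r'" using monochromatic_agree(1)[OF h] n by blast
  obtain s s' where s: "s \<in> U" "s' \<in> U" "blue a b s s'" using monochromatic_agree(2)[OF h] n by blast
  have card2: "2 \<le> card U" using card_two_le[OF fin r(1,2)] r(3) by (auto simp: red_def)
  define P where "P X \<longleftrightarrow> clan U b X \<and> 2 \<le> card X" for X
  have "P U" using card2 by (auto simp: P_def clan_def)
  then obtain X where X: "P X" and Xmin: "\<And>Y. P Y \<Longrightarrow> card X \<le> card Y"
    using ex_has_least_nat[of P U card] by blast
  have cX: "clan U b X" "2 \<le> card X" "X \<subseteq> U" using X clan_subset[of U b X] by (auto simp: P_def)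
  have finX: "finite X" using cX fin finite_subset by blast
  have prim: "primitive X b" unfolding primitive_def
  proof (intro allI impI)
    fix Z assume Z: "clan X b Z" "2 \<le> card Z"
    have "P Z" using clan_restrict_trans[OF cX(1) Z(1)] Z(2) by (simp add: P_def)
    hence "card X \<le> card Z" by (rule Xmin)
    thus "Z = X" using clan_subset[OF Z(1)] finX by (metis card_seteq)
  qed
  interpret cx: clan_colouring X b "red a b" "blue a b" by (rule cb.restrict_colouring[OF cX(3)])
  have mono: "(\<forall>i\<in>X. \<forall>j\<in>X. \<not> red a b i j) \<or> (\<forall>i\<in>X. \<forall>j\<in>X. \<not> blue a b i j)" if "3 \<le> card X"
    using cx.primitive_monochromatic[OF prim that] by blast
  have XU: "X \<noteq> U"
  proof
    assume XU: "X = U"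
    show False
    proof (cases "3 \<le> card X")
      case True thus False using mono r s XU by blast
    next
      case False
      hence "card U = 2" using cX(2) XU by simp
      then obtain p q where pq: "U = {p, q}" "p \<noteq> q" by (meson card_2_iff)
      have "red a b p q" using r pq ca.R_irr ca.R_sym by blast
      moreover have "blue a b p q" using s pq ca.B_irr ca.B_sym by blast
      ultimately show False using ca.RB by blast
    qed
  qed
  show ?thesis
  proof (cases "3 \<le> card X")
    case False
    hence "card X = 2" using cX by simp
    then obtain i j where ij: "X = {i, j}" "i \<noteq> j" by (meson card_2_iff)
    show ?thesis using small_common_clan[OF h ca, of i j] ij cX XU by blast
  next
    case True
    have "clan U a X" unfolding clan_def
    proof (intro conjI ballI, rule cX(3), rule ccontr)
      fix i j k assume i: "i \<in> X" and j: "j \<in> X" and k: "k \<in> U - X" and d: "\<not> undistinguished a i j k"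
      have kU: "k \<in> U" "k \<notin> X" using k by auto
      define X1 where "X1 = {z\<in>X. red a b z k}"
      define X2 where "X2 = {z\<in>X. blue a b z k}"
      have sp: "\<not> undistinguished a z z' k" if "z \<in> X1" "z' \<in> X2" for z z'
        using that clan_eq[OF cX(1) _ _ kU, of z z'] unfolding X1_def X2_def red_def blue_def undistinguished_def by auto
      \<comment> \<open>The point \<open>k\<close> lies between any \<open>z\<close> and
        \<open>z'\<close>, so the labels from \<open>X1\<close> to \<open>X2\<close> are those which
        \<open>b\<close> has between \<open>k\<close> and \<open>X\<close>.\<close>
      have lab: "a z z' = b k i" "a z' z = b i k" if z: "z \<in> X1" "z' \<in> X2" for z z'
      proof -
        have zX: "z \<in> X" "z' \<in> X" using z by (auto simp: X1_def X2_def)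
        have "a z k = b k i" "a k z = b i k"
          using z clan_eq[OF cX(1) zX(1) i kU] by (auto simp: X1_def red_def)
        thus "a z z' = b k i" "a z' z = b i k" using split_clan(2,4)[OF h ca cX(1) zX kU sp[OF z]] by auto
      qed
      have ne: "X1 \<noteq> {}" "X2 \<noteq> {}"
        using split_clan(1)[OF h ca cX(1) i j kU d] i j by (auto simp: X1_def X2_def)
      have nf: "b i k \<noteq> b k i" using split_clan(1)[OF h ca cX(1) i j kU d] by (auto simp: red_def blue_def)
      have XX: "X = X1 \<union> X2" "X1 \<inter> X2 = {}"
      proof -
        have "z \<in> X1 \<or> z \<in> X2" if z: "z \<in> X" for z
        proof -
          have "b z k \<noteq> b k z" "z \<noteq> k" using nf clan_eq[OF cX(1) z i kU] z kU by auto
          thus ?thesis using cb.nonflat[of z k] z kU cX(3) by (auto simp: X1_def X2_def)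
        qed
        thus "X = X1 \<union> X2" by (auto simp: X1_def X2_def)
        show "X1 \<inter> X2 = {}" using ca.RB by (auto simp: X1_def X2_def)
      qed
      have und: "undistinguished a z1 z2 z" if "z1 \<in> X1 \<and> z2 \<in> X1 \<and> z \<in> X2 \<or> z1 \<in> X2 \<and> z2 \<in> X2 \<and> z \<in> X1" for z1 z2 z
        using that lab by (auto simp: undistinguished_def)
      have ca12: "clan X a X1" "clan X a X2" using XX und unfolding clan_def by auto
      \<comment> \<open>Within \<open>X\<close> only one colour occurs, so there \<open>a\<close>
        and \<open>b\<close> have the same clans.\<close>
      have "agree X a b \<or> agree X a (transposed b)"
        using mono[OF True] monochromatic_agree[OF H_mono[OF h cX(3)]] by blast
      hence "clan X b X1 \<and> clan X b X2"
        using ca12 clan_agree[of X a _ b] clan_agree[of X a _ "transposed b"] clan_transp[of X b X1] clan_transp[of X b X2] by blast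
      moreover have "2 \<le> card X1 \<or> 2 \<le> card X2"
        using True XX card_Un_disjoint[of X1 X2] finX by (auto simp: not_le)
      ultimately have "X1 = X \<or> X2 = X" using prim unfolding primitive_def by blast
      thus False using ne XX by auto
    qed
    thus ?thesis using cX XU by blast
  qed
qed

lemma flat_pairs_eq: "H U a b \<Longrightarrow> flat_pairs U a = flat_pairs U b"
  using pair_cases[of U a b] unfolding flat_pairs_def by (auto, metis+)

lemma psi_ok_target: "H U a b \<Longrightarrow> k \<in> U \<Longrightarrow> psi_ok U k t a \<Longrightarrow> psi_ok U k t b"
  using pair_cases[of U a b _ k] unfolding psi_ok_def by (metis DiffE singletonI)

text \<open>\<open>a\<close> and \<open>b\<close> have the same flat pairs and admit the same
  updates, so one measure serves to make both stable.\<close>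

lemma unstable_step:
  assumes h: "H U a b" and n: "\<not> (stable U a \<and> stable U b)"
  shows "\<exists>k\<in>U. \<exists>t. psi_ok U k t a \<and> psi_ok U k t b \<and> card (flat_pairs U (psi k t a)) < card (flat_pairs U a)"
proof (cases "stable U a")
  case False
  thus ?thesis using fewer_flat_pairs[OF h] psi_ok_target[OF h] by blast
next
  case True
  hence "\<not> stable U b" using n by blast
  then obtain k t where k: "k \<in> U" "psi_ok U k t b" "card (flat_pairs U (psi k t b)) < card (flat_pairs U b)"
    using fewer_flat_pairs[OF H_sym[OF h]] by blast
  have ok: "psi_ok U k t a" using psi_ok_target[OF H_sym[OF h] k(1,2)] .
  thus ?thesis using k flat_pairs_eq[OF h] flat_pairs_eq[OF H_psi[OF h k(1) ok]] by metis
qed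

text \<open>The outer induction splits along a common clan. The inner one, over the number of flat
  pairs, first makes both structures stable, so that the colouring axioms hold.\<close>

theorem reach_bound: "H U a b \<Longrightarrow> reach U b a (2 * (card U - 2))"
proof (induction "card U" arbitrary: U a b rule: less_induct)
  case less
  have inner: "H U a b \<Longrightarrow> reach U b a (2 * (card U - 2))" for a b
  proof (induction "card (flat_pairs U a)" arbitrary: a b rule: less_induct)
    case inner: less
    note h = inner.prems
    show ?case
    proof (cases "stable U a \<and> stable U b")
      case False
      then obtain k t where k: "k \<in> U" "psi_ok U k t a" "psi_ok U k t b"
        "card (flat_pairs U (psi k t a)) < card (flat_pairs U a)" using unstable_step[OF h] by blast
      show ?thesis
        by (rule reach_psi_rev[OF inner.hyps[OF k(4) H_psi[OF h k(1,2)]] k(1-3)])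
    next
      case st: True
      show ?thesis
      proof (cases "agree U a b \<or> agree U a (transposed b)")
        case True
        thus ?thesis using reach.reach_eq reach.reach_transp by blast
      next
        case False
        have fin: "finite U" using H_fin[OF h] .
        from common_clan[OF h] st False obtain X where X: "2 \<le> card X" "X \<noteq> U" "clan U b X"
          and alt: "clan U a X \<or> (\<exists>Z. clan U a Z \<and> 2 \<le> card Z \<and> Z \<noteq> U \<and> clan U (flip Z a) X)" by blast
        have XU: "X \<subseteq> U" "finite X" using clan_subset[OF X(3)] fin finite_subset by auto
        obtain x where x: "x \<in> X" using X(1) by fastforce
        let ?U = "insert x (U - X)"
        have cX: "card X < card U" using X XU fin by (simp add: psubset_card_mono psubsetI)
        \<comment> \<open>The representative \<open>x\<close> is counted in both parts, so their
          sizes add up to \<open>card U + 1\<close>.\<close>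
        have cU: "card ?U = Suc (card U - card X)" using XU x fin by (simp add: card_Diff_subset)
        have sub: "?U \<subseteq> U" using x XU by auto
        have glue: "reach U b a' (2 * (card X - 2) + 2 * (card ?U - 2) + 1)" if h': "H U a' b" "clan U a' X" for a'
        proof (rule reach_glue[OF _ h'(2) X(3) x X(1,2) fin])
          show "reach X b a' (2 * (card X - 2))" using less.hyps[OF cX H_mono[OF h'(1) XU(1)]] .
          show "reach ?U b a' (2 * (card ?U - 2))"
            using less.hyps[OF _ H_mono[OF h'(1) sub]] cU cX X(1) by simp
        qed
        have bound: "2 * (card X - 2) + 2 * (card ?U - 2) + 2 \<le> 2 * (card U - 2)"
          using cU cX X(1) by simp
        from alt show ?thesis
        proof
          assume "clan U a X"
          thus ?thesis using reach_mono[OF glue[OF h]] bound by simp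
        next
          assume "\<exists>Z. clan U a Z \<and> 2 \<le> card Z \<and> Z \<noteq> U \<and> clan U (flip Z a) X"
          then obtain Z where Z: "clan U a Z" "2 \<le> card Z" "Z \<noteq> U" "clan U (flip Z a) X" by blast
          have "reach U b a (Suc (2 * (card X - 2) + 2 * (card ?U - 2) + 1))"
            by (rule reach.reach_flip[OF Z(1-3) glue[OF H_flip[OF h Z(1)] Z(4)]])
          thus ?thesis using reach_mono bound by simp
        qed
      qed
    qed
  qed
  show ?case by (rule inner[OF less.prems])
qed

end


section \<open>Principal minors\<close>

text \<open>Rows and columns outside \<open>S\<close> are replaced by unit vectors, so that all principal minors are
  determinants of the same size.\<close>

definition pminor :: "nat \<Rightarrow> nat set \<Rightarrow> (nat \<Rightarrow> nat \<Rightarrow> 'a) \<Rightarrow> 'a::field" where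
  "pminor n S A = det (mat n n (\<lambda>(i, j). if i \<in> S \<and> j \<in> S then A i j else if i = j then 1 else 0))"

lemma pminor_cong:
  assumes "\<And>i j. i \<in> S \<Longrightarrow> j \<in> S \<Longrightarrow> A i j = B i j"
  shows "pminor n S A = pminor n S B"
proof -
  have "(\<lambda>(i, j). if i \<in> S \<and> j \<in> S then A i j else if i = j then 1 else 0) =
        (\<lambda>(i, j). if i \<in> S \<and> j \<in> S then B i j else if i = j then 1 else 0)"
    using assms by (auto simp: fun_eq_iff)
  thus ?thesis by (simp add: pminor_def)
qed

lemma pminor_empty [simp]: "pminor n {} A = 1"
proof -
  have "mat n n (\<lambda>(i, j). if i \<in> {} \<and> j \<in> {} then A i j else if i = j then 1 else 0) = 1\<^sub>m n"
    by (intro eq_matI) auto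
  thus ?thesis by (simp add: pminor_def)
qed

lemma det_unit_row:
  fixes M :: "'a::comm_ring_1 mat"
  assumes M: "M \<in> carrier_mat n n" and k: "k < n" and r: "\<And>j. j < n \<Longrightarrow> j \<noteq> k \<Longrightarrow> M $$ (k, j) = 0"
  shows "det M = M $$ (k, k) * det (mat_delete M k k)"
proof -
  have "det M = (\<Sum>j<n. M $$ (k, j) * cofactor M k j)"
    using laplace_expansion_row[OF M k] .
  also have "\<dots> = (\<Sum>j<n. if j = k then M $$ (k, k) * cofactor M k k else 0)"
    by (intro sum.cong) (auto simp: r)
  also have "\<dots> = M $$ (k, k) * det (mat_delete M k k)"
    using k by (simp add: cofactor_def)
  finally show ?thesis .
qed

lemma det_unit_column:
  fixes M :: "'a::comm_ring_1 mat"
  assumes M: "M \<in> carrier_mat n n" and k: "k < n" and r: "\<And>i. i < n \<Longrightarrow> i \<noteq> k \<Longrightarrow> M $$ (i, k) = 0"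
  shows "det M = M $$ (k, k) * det (mat_delete M k k)"
proof -
  have "det M = (\<Sum>i<n. M $$ (i, k) * cofactor M i k)"
    using laplace_expansion_column[OF M k] .
  also have "\<dots> = (\<Sum>i<n. if i = k then M $$ (k, k) * cofactor M k k else 0)"
    by (intro sum.cong) (auto simp: r)
  also have "\<dots> = M $$ (k, k) * det (mat_delete M k k)"
    using k by (simp add: cofactor_def)
  finally show ?thesis .
qed

text \<open>The determinant is affine in a diagonal entry, with the minor without \<open>k\<close>
  as its slope.\<close>

lemma pminor_set_diagonal:
  assumes k: "k < n" "k \<notin> S"
  shows "pminor n (insert k S) A = pminor n (insert k S) (\<lambda>i j. if i = k \<and> j = k then c else A i j) + (A k k - c) * pminor n S A"
proof -
  let ?M = "\<lambda>A S. mat n n (\<lambda>(i, j). if i \<in> S \<and> j \<in> S then A i j else if i = j then 1 else (0::'a))"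
  let ?B = "\<lambda>i j. if i = k \<and> j = k then c else A i j"
  define M1 M2 M3 where "M1 = ?M A (insert k S)" and "M2 = ?M ?B (insert k S)" and "M3 = ?M A S"
  have car: "M1 \<in> carrier_mat n n" "M2 \<in> carrier_mat n n" "M3 \<in> carrier_mat n n"
    by (auto simp: M1_def M2_def M3_def)
  have del: "mat_delete M1 k j = mat_delete M2 k j" "mat_delete M1 k k = mat_delete M3 k k" if "j < n" for j
    using k that by (auto simp: M1_def M2_def M3_def mat_delete_def intro!: eq_matI)
  have d3: "det M3 = det (mat_delete M1 k k)"
    using det_unit_row[OF car(3) k(1)] del(2)[OF k(1)] k by (simp add: M3_def)
  have "det M1 - det M2 = (\<Sum>j<n. (M1 $$ (k, j) - M2 $$ (k, j)) * cofactor M1 k j)"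
    using laplace_expansion_row[OF car(1) k(1)] laplace_expansion_row[OF car(2) k(1)] del(1)
    by (simp add: cofactor_def sum_subtractf[symmetric] left_diff_distrib)
  also have "\<dots> = (\<Sum>j<n. if j = k then (A k k - c) * cofactor M1 k k else 0)"
    by (intro sum.cong) (use k in \<open>auto simp: M1_def M2_def\<close>)
  also have "\<dots> = (A k k - c) * det M3" using k(1) d3 by (simp add: cofactor_def)
  finally show ?thesis unfolding pminor_def M1_def[symmetric] M2_def[symmetric] M3_def[symmetric]
    by (simp add: algebra_simps)
qed

text \<open>Schur complement: multiplication by \<open>L\<close> subtracts multiples of row
  \<open>k\<close> and clears the rest of column \<open>k\<close>.\<close>

lemma pminor_eliminate:
  assumes k: "k < n" "k \<notin> S" and nz: "A k k \<noteq> 0"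
  shows "pminor n (insert k S) A = A k k * pminor n S (\<lambda>i j. A i j - A i k * A k j / A k k)"
proof -
  let ?M = "\<lambda>A S. mat n n (\<lambda>(i, j). if i \<in> S \<and> j \<in> S then A i j else if i = j then 1 else (0::'a))"
  let ?B = "\<lambda>i j. A i j - A i k * A k j / A k k"
  define L where "L = mat n n (\<lambda>(i, j). (if i = j then 1 else 0) + (if j = k \<and> i \<in> S then - A i k / A k k else 0))"
  define M1 M3 where "M1 = ?M A (insert k S)" and "M3 = ?M ?B S"
  define M2 where "M2 = mat n n (\<lambda>(i, j). if i = k \<and> j \<in> insert k S then A k j else if i \<in> S \<and> j \<in> insert k S then ?B i j else if i = j then 1 else 0)"
  have car: "L \<in> carrier_mat n n" "M1 \<in> carrier_mat n n" "M2 \<in> carrier_mat n n" "M3 \<in> carrier_mat n n"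
    by (auto simp: M1_def M2_def M3_def L_def)
  have "mat_delete L k k = 1\<^sub>m (n - 1)"
    using k by (auto simp: L_def mat_delete_def intro!: eq_matI)
  hence dL: "det L = 1"
    using det_unit_row[OF car(1) k(1)] k by (simp add: L_def)
  have "L * M1 = M2"
  proof (rule eq_matI)
    fix i j assume "i < dim_row M2" "j < dim_col M2"
    hence ij: "i < n" "j < n" by (auto simp: M2_def)
    have "(L * M1) $$ (i, j) = (\<Sum>l<n. L $$ (i, l) * M1 $$ (l, j))"
    proof -
      have "(L * M1) $$ (i, j) = row L i \<bullet> col M1 j" using ij car(1,2) by (intro index_mult_mat(1)) auto
      also have "\<dots> = (\<Sum>l<n. row L i $ l * col M1 j $ l)"
        using carrier_matD[OF car(2)] by (simp add: scalar_prod_def atLeast0LessThan)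
      also have "\<dots> = (\<Sum>l<n. L $$ (i, l) * M1 $$ (l, j))"
        using ij carrier_matD[OF car(1)] carrier_matD[OF car(2)] by (intro sum.cong) simp_all
      finally show ?thesis .
    qed
    also have "\<dots> = (\<Sum>l<n. (if l = i then M1 $$ (i, j) else 0) +
        (if l = k then (if i \<in> S then - A i k / A k k else 0) * M1 $$ (k, j) else 0))"
      using ij by (intro sum.cong) (auto simp: L_def algebra_simps)
    also have "\<dots> = M1 $$ (i, j) + (if i \<in> S then - A i k / A k k else 0) * M1 $$ (k, j)"
      using ij k by (simp add: sum.distrib)
    also have "\<dots> = M2 $$ (i, j)" using ij k by (auto simp: M1_def M2_def)
    finally show "(L * M1) $$ (i, j) = M2 $$ (i, j)" .
  qed (auto simp: L_def M1_def M2_def)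
  hence "det M1 = det M2" using det_mult[OF car(1,2)] dL by simp
  also have "\<dots> = A k k * det (mat_delete M2 k k)"
    using det_unit_column[OF car(3) k(1)] k nz by (simp add: M2_def)
  also have "mat_delete M2 k k = mat_delete M3 k k"
    using k by (auto simp: M2_def M3_def mat_delete_def intro!: eq_matI)
  also have "det (mat_delete M3 k k) = det M3"
    using det_unit_row[OF car(4) k(1)] k by (simp add: M3_def)
  finally show ?thesis unfolding pminor_def M1_def[symmetric] M3_def[symmetric] .
qed

text \<open>This recursion determines all principal minors; the facts below follow from it by induction.\<close>

lemma pminor_insert:
  assumes k: "k < n" "k \<notin> S"
  shows "pminor n (insert k S) A = pminor n S (\<lambda>i j. A i j - A i k * A k j) + (A k k - 1) * pminor n S A"
proof -
  \<comment> \<open>Pivot 1 makes the elimination free of division and of conditions on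
    \<open>A k k\<close>; the affine term pays for the changed diagonal entry.\<close>
  let ?B = "\<lambda>i j. if i = k \<and> j = k then 1 else A i j"
  have "pminor n (insert k S) ?B = pminor n S (\<lambda>i j. ?B i j - ?B i k * ?B k j / ?B k k)"
    using pminor_eliminate[OF k, of ?B] by simp
  also have "\<dots> = pminor n S (\<lambda>i j. A i j - A i k * A k j)"
    by (rule pminor_cong) (use k in auto)
  finally show ?thesis using pminor_set_diagonal[OF k, of A 1] by simp
qed

lemma pminor_singleton: "k < n \<Longrightarrow> pminor n {k} A = A k k"
  using pminor_insert[of k n "{}" A] by simp

lemma pminor_reindex:
  fixes A :: "nat \<Rightarrow> nat \<Rightarrow> 'a::field"
  assumes "finite T" "T \<subseteq> {..<m}" "inj_on e T" "e ` T \<subseteq> {..<n}"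
  shows "pminor m T (\<lambda>i j. A (e i) (e j)) = pminor n (e ` T) A"
  using assms
proof (induction arbitrary: A rule: finite_induct)
  case (insert k T)
  have k: "k < m" "e k < n" "e k \<notin> e ` T" using insert.prems insert.hyps by auto
  have IH: "pminor m T (\<lambda>i j. A (e i) (e j)) = pminor n (e ` T) A" for A :: "nat \<Rightarrow> nat \<Rightarrow> 'a"
    using insert.IH[of A] insert.prems by simp
  show ?case
    unfolding image_insert pminor_insert[OF k(1) insert.hyps(2)] pminor_insert[OF k(2,3)]
    using IH[of A] IH[of "\<lambda>i j. A i j - A i (e k) * A (e k) j"] by simp
qed simp

lemma det_submatrix_eq_pminor:
  fixes A :: "'a::field mat"
  assumes A: "A \<in> carrier_mat n n" and S: "S \<subseteq> {..<n}"
  shows "det (submatrix A S S) = pminor n S (\<lambda>i j. A $$ (i, j))"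
proof -
  let ?m = "card S"
  have fin: "finite S" using S finite_subset by blast
  have S': "{i. i < n \<and> i \<in> S} = S" using S by auto
  have p: "pick S i \<in> S" if "i < ?m" for i using pick_in_set_le that by blast
  have "submatrix A S S = mat ?m ?m (\<lambda>(i, j). if i \<in> {..<?m} \<and> j \<in> {..<?m} then A $$ (pick S i, pick S j) else if i = j then 1 else 0)"
    using A by (intro eq_matI) (auto simp: submatrix_def S')
  hence "det (submatrix A S S) = pminor ?m {..<?m} (\<lambda>i j. A $$ (pick S i, pick S j))"
    by (simp add: pminor_def)
  moreover have inj: "inj_on (pick S) {..<?m}"
  proof (rule inj_onI)
    fix i j assume "i \<in> {..<?m}" "j \<in> {..<?m}" "pick S i = pick S j"
    note ij = this
    have "card {a\<in>S. a < pick S i} = i" "card {a\<in>S. a < pick S j} = j"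
      using card_pick_le ij(1,2) by (blast dest: iffD1[OF lessThan_iff])+
    thus "i = j" unfolding ij(3) by (rule trans[OF sym])
  qed
  moreover have "pick S ` {..<?m} = S"
  proof (rule card_subset_eq[OF fin])
    show "pick S ` {..<?m} \<subseteq> S" using p by blast
    show "card (pick S ` {..<?m}) = card S" using card_image[OF inj] by simp
  qed
  ultimately show ?thesis
    using pminor_reindex[of "{..<?m}" ?m "pick S" n "\<lambda>i j. A $$ (i, j)"] S by simp
qed

lemma pminor_transpose:
  assumes "finite S" "S \<subseteq> {..<n}"
  shows "pminor n S (\<lambda>i j. A j i) = pminor n S A"
  using assms
proof (induction arbitrary: A rule: finite_induct)
  case (insert k S)
  have k: "k < n" using insert.prems by auto
  have "pminor n S (\<lambda>i j. A j i - A k i * A j k) = pminor n S (\<lambda>i j. A i j - A i k * A k j)"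
    using insert.IH[of "\<lambda>i j. A i j - A i k * A k j"] insert.prems by (simp add: mult.commute)
  thus ?case using insert.prems insert.IH[of A] by (simp add: pminor_insert[OF k insert.hyps(2)])
qed simp

lemma pminor_diagonal_similar:
  assumes "finite S" "S \<subseteq> {..<n}" "\<And>i. i \<in> S \<Longrightarrow> d i \<noteq> 0"
  shows "pminor n S (\<lambda>i j. d i * A i j / d j) = pminor n S A"
  using assms
proof (induction arbitrary: A rule: finite_induct)
  case (insert k S)
  have k: "k < n" "d k \<noteq> 0" using insert.prems by auto
  have "(\<lambda>i j. d i * A i j / d j - d i * A i k / d k * (d k * A k j / d j)) = (\<lambda>i j. d i * (A i j - A i k * A k j) / d j)"
    using k(2) by (simp add: fun_eq_iff right_diff_distrib diff_divide_distrib mult.assoc)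
  hence "pminor n S (\<lambda>i j. d i * A i j / d j - d i * A i k / d k * (d k * A k j / d j)) = pminor n S (\<lambda>i j. A i j - A i k * A k j)"
    using insert.IH[of "\<lambda>i j. A i j - A i k * A k j"] insert.prems by simp
  thus ?case using k insert.prems insert.IH[of A] by (simp add: pminor_insert[OF k(1) insert.hyps(2)])
qed simp

text \<open>For invertible \<open>A\<close> this changes the \<open>k\<close>-th diagonal entry of the inverse of \<open>A\<close>.\<close>

definition shift :: "nat \<Rightarrow> 'a \<Rightarrow> (nat \<Rightarrow> nat \<Rightarrow> 'a) \<Rightarrow> nat \<Rightarrow> nat \<Rightarrow> 'a::field" where
  "shift k c A i j = A i j + c * (A i k * A k j)"

text \<open>If the diagonal entry at \<open>k\<close> is replaced by \<open>- 1 / c\<close>,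
  eliminating \<open>k\<close> performs exactly the update.\<close>

lemma pminor_shift_out:
  assumes k: "k < n" "k \<notin> S"
  shows "pminor n S (shift k c A) = (1 + c * A k k) * pminor n S A - c * pminor n (insert k S) A"
proof (cases "c = 0")
  case True
  thus ?thesis by (simp add: shift_def[abs_def])
next
  case False
  let ?B = "\<lambda>i j. if i = k \<and> j = k then - 1 / c else A i j"
  have "pminor n (insert k S) ?B = - 1 / c * pminor n S (\<lambda>i j. ?B i j - ?B i k * ?B k j / ?B k k)"
    using pminor_eliminate[OF k, of ?B] False by simp
  also have "pminor n S (\<lambda>i j. ?B i j - ?B i k * ?B k j / ?B k k) = pminor n S (shift k c A)"
    by (rule pminor_cong) (use k False in \<open>auto simp: shift_def\<close>)
  finally have "pminor n S (shift k c A) = - c * pminor n (insert k S) ?B" using False by simp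
  also have "pminor n (insert k S) ?B = pminor n (insert k S) A - (A k k + 1 / c) * pminor n S A"
    using pminor_set_diagonal[OF k, of A "- 1 / c"] by (simp add: algebra_simps)
  finally show ?thesis using False by (simp add: algebra_simps)
qed

text \<open>Row and column \<open>k\<close> of the update are those of \<open>A\<close> times
  \<open>l\<close>, so eliminating \<open>k\<close> with pivot 1 yields the update of
  \<open>A\<close> with coefficient \<open>c - l * l\<close>.\<close>

lemma pminor_shift_in:
  assumes k: "k < n" "k \<notin> S"
  shows "pminor n (insert k S) (shift k c A) = (1 + c * A k k) * pminor n (insert k S) A"
proof -
  define l where "l = 1 + c * A k k"
  have e: "(\<lambda>i j. shift k c A i j - shift k c A i k * shift k c A k j) = shift k (c - l * l) A"
    by (auto simp: fun_eq_iff shift_def l_def algebra_simps)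
  have "pminor n (insert k S) (shift k c A) = pminor n S (shift k (c - l * l) A) + (A k k * l - 1) * pminor n S (shift k c A)"
    unfolding pminor_insert[OF k] e by (simp add: shift_def l_def algebra_simps)
  thus ?thesis unfolding pminor_shift_out[OF k] l_def by (simp add: algebra_simps)
qed

definition pm_equivalent :: "nat \<Rightarrow> nat set \<Rightarrow> (nat \<Rightarrow> nat \<Rightarrow> 'a::field) \<Rightarrow> (nat \<Rightarrow> nat \<Rightarrow> 'a) \<Rightarrow> bool" where
  "pm_equivalent n V A B \<longleftrightarrow> (\<forall>S\<subseteq>V. pminor n S A = pminor n S B)"

lemma pm_equivalentD: "pm_equivalent n V A B \<Longrightarrow> S \<subseteq> V \<Longrightarrow> pminor n S A = pminor n S B"
  by (simp add: pm_equivalent_def)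

lemma pm_equivalent_diagonal:
  "pm_equivalent n V A B \<Longrightarrow> V \<subseteq> {..<n} \<Longrightarrow> k \<in> V \<Longrightarrow> A k k = B k k"
  using pm_equivalentD[of n V A B "{k}"] pminor_singleton[of k n A] pminor_singleton[of k n B] by auto

lemma pm_equivalent_shift:
  assumes e: "pm_equivalent n V A B" and V: "V \<subseteq> {..<n}" and k: "k \<in> V"
  shows "pm_equivalent n V (shift k c A) (shift k c B)"
  unfolding pm_equivalent_def
proof (intro allI impI)
  fix S assume S: "S \<subseteq> V"
  have kk: "A k k = B k k" "k < n" using pm_equivalent_diagonal[OF e V k] V k by auto
  show "pminor n S (shift k c A) = pminor n S (shift k c B)"
  proof (cases "k \<in> S")
    case True
    then obtain T where T: "S = insert k T" "k \<notin> T" by (meson Set.set_insert)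
    show ?thesis using pminor_shift_in[OF kk(2) T(2), of c A] pminor_shift_in[OF kk(2) T(2), of c B]
        pm_equivalentD[OF e S] kk T(1) by simp
  next
    case False
    have "insert k S \<subseteq> V" using S k by auto
    thus ?thesis using pminor_shift_out[OF kk(2) False, of c A] pminor_shift_out[OF kk(2) False, of c B]
        pm_equivalentD[OF e S] pm_equivalentD[OF e, of "insert k S"] kk by simp
  qed
qed

text \<open>The product is read off from a diagonal entry of an update; the next lemma reads off
  3-cycles from the pair products of an update in the same way.\<close>

lemma pm_equivalent_pair:
  assumes e: "pm_equivalent n V A B" and V: "V \<subseteq> {..<n}" and ij: "i \<in> V" "j \<in> V"
  shows "A i j * A j i = B i j * B j i"
  using pm_equivalent_diagonal[OF pm_equivalent_shift[OF e V ij(2), of 1] V ij(1)]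
    pm_equivalent_diagonal[OF e V ij(1)] by (simp add: shift_def)

lemma pm_equivalent_triple:
  assumes e: "pm_equivalent n V A B" and V: "V \<subseteq> {..<n}" and ijk: "i \<in> V" "j \<in> V" "k \<in> V"
  shows "A i j * A j k * A k i + A j i * A i k * A k j = B i j * B j k * B k i + B j i * B i k * B k j"
proof -
  have "(C i j + C i k * C k j) * (C j i + C j k * C k i) =
    C i j * C j i + (C i j * C j k * C k i + C j i * C i k * C k j) + (C i k * C k i) * (C j k * C k j)" for C :: "nat \<Rightarrow> nat \<Rightarrow> 'a"
    by (simp add: algebra_simps)
  thus ?thesis
    using pm_equivalent_pair[OF pm_equivalent_shift[OF e V ijk(3), of 1] V ijk(1,2)]
      pm_equivalent_pair[OF e V ijk(1,2)] pm_equivalent_pair[OF e V ijk(1,3)] pm_equivalent_pair[OF e V ijk(2,3)]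
    by (simp add: shift_def)
qed


section \<open>Cut-transposes up to diagonal similarity\<close>

text \<open>Unlike \<open>tw\<close>, this does not normalise the factors of the two rank-one blocks, so \<open>M\<close> is determined
  only up to diagonal similarity.\<close>

definition cut_twist :: "'i set \<Rightarrow> 'i set \<Rightarrow> ('i \<Rightarrow> 'i \<Rightarrow> 'a::field) \<Rightarrow> ('i \<Rightarrow> 'i \<Rightarrow> 'a) \<Rightarrow> bool" where
  "cut_twist V X A M \<longleftrightarrow> X \<subseteq> V \<and>
     (\<exists>p q u w. \<forall>x\<in>X. \<forall>y\<in>V - X. A x y = p x * q y \<and> A y x = u y * w x \<and> M x y = p x * u y \<and> M y x = q y * w x) \<and>
     (\<forall>x\<in>X. \<forall>x'\<in>X. M x x' = A x x') \<and> (\<forall>y\<in>V - X. \<forall>y'\<in>V - X. M y y' = A y' y)"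

definition irreducible_on :: "'i set \<Rightarrow> ('i \<Rightarrow> 'i \<Rightarrow> 'a::zero) \<Rightarrow> bool" where
  "irreducible_on V A \<longleftrightarrow> connected_in (\<lambda>x y. A x y \<noteq> 0) V"

definition dsim :: "'i set \<Rightarrow> ('i \<Rightarrow> 'i \<Rightarrow> 'a::field) \<Rightarrow> ('i \<Rightarrow> 'i \<Rightarrow> 'a) \<Rightarrow> bool" where
  "dsim V A B \<longleftrightarrow> (\<exists>d. (\<forall>i\<in>V. d i \<noteq> 0) \<and> (\<forall>i\<in>V. \<forall>j\<in>V. B i j = d i * A i j / d j))"

inductive tw_reach :: "'i set \<Rightarrow> ('i \<Rightarrow> 'i \<Rightarrow> 'a::field) \<Rightarrow> ('i \<Rightarrow> 'i \<Rightarrow> 'a) \<Rightarrow> nat \<Rightarrow> bool" for V B where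
  tw_reach_sim: "dsim V A B \<Longrightarrow> tw_reach V B A m"
| tw_reach_sim_transp: "dsim V A (transposed B) \<Longrightarrow> tw_reach V B A m"
| tw_reach_twist: "cut_twist V X A M \<Longrightarrow> 2 \<le> card X \<Longrightarrow> 2 \<le> card (V - X) \<Longrightarrow> tw_reach V B M m \<Longrightarrow> tw_reach V B A (Suc m)"

lemma cut_twistI:
  assumes "X \<subseteq> V"
    and "\<And>x y. x \<in> X \<Longrightarrow> y \<in> V \<Longrightarrow> y \<notin> X \<Longrightarrow>
      A x y = p x * q y \<and> A y x = u y * w x \<and> M x y = p x * u y \<and> M y x = q y * w x"
    and "\<And>x x'. x \<in> X \<Longrightarrow> x' \<in> X \<Longrightarrow> M x x' = A x x'"
    and "\<And>y y'. y \<in> V \<Longrightarrow> y \<notin> X \<Longrightarrow> y' \<in> V \<Longrightarrow> y' \<notin> X \<Longrightarrow> M y y' = A y' y"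
  shows "cut_twist V X A M"
proof -
  have "\<forall>x\<in>X. \<forall>y\<in>V - X. A x y = p x * q y \<and> A y x = u y * w x \<and> M x y = p x * u y \<and> M y x = q y * w x"
    using assms(2) by simp
  thus ?thesis unfolding cut_twist_def using assms(1,3,4) by auto
qed

lemma finite_of_bounded: "insert v U \<subseteq> {..<n::nat} \<Longrightarrow> finite U"
  by (meson finite_insert finite_lessThan finite_subset)

lemma cut_twist_diagonal: "cut_twist V X A M \<Longrightarrow> k \<in> V \<Longrightarrow> M k k = A k k"
  unfolding cut_twist_def by blast

text \<open>An update at \<open>k\<close> in \<open>X\<close> changes only the factors
  \<open>p\<close> and \<open>w\<close> of the rank-one blocks, an update outside only
  \<open>q\<close> and \<open>u\<close>, and it changes them in the twist in the same way.\<close>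

lemma cut_twist_shift:
  assumes t: "cut_twist V X A M" and k: "k \<in> V"
  shows "cut_twist V X (shift k c A) (shift k c M)"
proof -
  obtain p q u w where f: "\<And>x y. x \<in> X \<Longrightarrow> y \<in> V \<Longrightarrow> y \<notin> X \<Longrightarrow>
      A x y = p x * q y \<and> A y x = u y * w x \<and> M x y = p x * u y \<and> M y x = q y * w x"
    and XV: "X \<subseteq> V" and MX: "\<And>x x'. x \<in> X \<Longrightarrow> x' \<in> X \<Longrightarrow> M x x' = A x x'"
    and MY: "\<And>y y'. y \<in> V \<Longrightarrow> y \<notin> X \<Longrightarrow> y' \<in> V \<Longrightarrow> y' \<notin> X \<Longrightarrow> M y y' = A y' y"
    using t unfolding cut_twist_def by blast
  show ?thesis
  proof (cases "k \<in> X")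
    case True
    let ?p = "\<lambda>x. p x + c * (A x k * p k)" and ?w = "\<lambda>x. w x + c * (w k * A k x)"
    have "shift k c A x y = ?p x * q y \<and> shift k c A y x = u y * ?w x \<and> shift k c M x y = ?p x * u y \<and> shift k c M y x = q y * ?w x"
      if "x \<in> X" "y \<in> V" "y \<notin> X" for x y
      using f[OF that] f[OF True that(2,3)] MX[OF that(1) True] MX[OF True that(1)]
      by (simp add: shift_def algebra_simps)
    moreover have "shift k c M x x' = shift k c A x x'" if "x \<in> X" "x' \<in> X" for x x'
      using MX that True by (simp add: shift_def)
    moreover have "shift k c M y y' = shift k c A y' y" if "y \<in> V" "y \<notin> X" "y' \<in> V" "y' \<notin> X" for y y'
      using MY[OF that] f[OF True that(1,2)] f[OF True that(3,4)] by (simp add: shift_def algebra_simps)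
    ultimately show ?thesis by (rule cut_twistI[OF XV])
  next
    case False
    let ?q = "\<lambda>y. q y + c * (q k * A k y)" and ?u = "\<lambda>y. u y + c * (A y k * u k)"
    have "shift k c A x y = p x * ?q y \<and> shift k c A y x = ?u y * w x \<and> shift k c M x y = p x * ?u y \<and> shift k c M y x = ?q y * w x"
      if "x \<in> X" "y \<in> V" "y \<notin> X" for x y
      using f[OF that] f[OF that(1) k False] MY[OF that(2,3) k False] MY[OF k False that(2,3)]
      by (simp add: shift_def algebra_simps)
    moreover have "shift k c M x x' = shift k c A x x'" if "x \<in> X" "x' \<in> X" for x x'
      using MX[OF that] f[OF that(1) k False] f[OF that(2) k False] by (simp add: shift_def algebra_simps)
    moreover have "shift k c M y y' = shift k c A y' y" if "y \<in> V" "y \<notin> X" "y' \<in> V" "y' \<notin> X" for y y'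
      using MY[OF that] MY[OF that(1,2) k False] MY[OF k False that(3,4)] by (simp add: shift_def mult.commute)
    ultimately show ?thesis by (rule cut_twistI[OF XV])
  qed
qed

lemma shift_minus_one: "shift k (- 1) A = (\<lambda>i j. A i j - A i k * A k j)"
  by (simp add: fun_eq_iff shift_def)

text \<open>Elimination with pivot 1 is the update with coefficient -1, under which twists stay
  twists; \<open>pminor_insert\<close> then needs no expansion of block determinants.\<close>

lemma pminor_cut_twist:
  assumes "finite S" "S \<subseteq> V" "V \<subseteq> {..<n}" "cut_twist V X A M"
  shows "pminor n S M = pminor n S A"
  using assms
proof (induction arbitrary: A M rule: finite_induct)
  case (insert k S)
  have k: "k \<in> V" "k < n" using insert.prems by auto
  have "pminor n S (shift k (- 1) M) = pminor n S (shift k (- 1) A)" "pminor n S M = pminor n S A"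
    using insert.IH[of A M] insert.IH[of "shift k (- 1) A" "shift k (- 1) M"] insert.prems
      cut_twist_shift[OF insert.prems(3) k(1)] by simp_all
  thus ?case
    using cut_twist_diagonal[OF insert.prems(3) k(1)]
    by (simp add: pminor_insert[OF k(2) insert.hyps(2)] shift_minus_one)
qed simp

lemma pm_equivalent_cut_twist:
  assumes "pm_equivalent n V A B" "V \<subseteq> {..<n}" "cut_twist V X A M"
  shows "pm_equivalent n V M B"
  unfolding pm_equivalent_def
proof (intro allI impI)
  fix S assume S: "S \<subseteq> V"
  have "finite S" using S assms(2) by (meson finite_lessThan finite_subset subset_trans)
  thus "pminor n S M = pminor n S B" using pminor_cut_twist[OF _ S assms(2,3)] pm_equivalentD[OF assms(1) S] by simp
qed

text \<open>The first update multiplies row and column \<open>k\<close> by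
  \<open>1 + c * A k k\<close>, hence the square.\<close>

lemma shift_shift: "shift k c' (shift k c A) i j = A i j + (c + c' * (1 + c * A k k)^2) * (A i k * A k j)"
  by (simp add: shift_def algebra_simps power2_eq_square)

lemma shift_inverse:
  assumes "1 + c * A k k \<noteq> 0"
  shows "shift k (- c / (1 + c * A k k)^2) (shift k c A) = A"
  using assms by (simp add: fun_eq_iff shift_shift)

lemma shift_transp: "shift k c (transposed A) = (\<lambda>i j. shift k c A j i)"
  by (simp add: fun_eq_iff shift_def mult.commute)

text \<open>\<open>A\<close> is an update of its update. If no edge of the latter leaves
  \<open>C\<close>, one factor of the correction at \<open>x\<close>, \<open>y\<close> vanishes, as
  \<open>k\<close> lies inside or outside \<open>C\<close>; so no edge of \<open>A\<close> would
  leave \<open>C\<close>.\<close>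

lemma irreducible_on_shift:
  assumes irr: "irreducible_on V A" and k: "k \<in> V" and c: "1 + c * A k k \<noteq> 0"
  shows "irreducible_on V (shift k c A)"
  unfolding irreducible_on_def connected_in_def
proof (intro allI impI, rule ccontr)
  fix C assume C: "C \<subseteq> V" "C \<noteq> {}" "C \<noteq> V"
    and "\<not> (\<exists>x\<in>C. \<exists>y\<in>V - C. shift k c A x y \<noteq> 0)"
  hence z: "shift k c A x y = 0" if "x \<in> C" "y \<in> V - C" for x y using that by blast
  obtain x y where xy: "x \<in> C" "y \<in> V - C" "A x y \<noteq> 0"
    using irr C unfolding irreducible_on_def connected_in_def by blast
  have "shift k c A x k * shift k c A k y = 0" using z[of x k] z[of k y] xy k by (cases "k \<in> C") auto
  hence "shift k d (shift k c A) x y = 0" for d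
    using z[of x y] xy(1,2) by (auto simp: shift_def[of k d "shift k c A" x y])
  thus False using shift_inverse[of c A k, OF c] xy by metis
qed

lemma irreducible_on_transp: "irreducible_on V A \<Longrightarrow> irreducible_on V (transposed A)"
  unfolding irreducible_on_def connected_in_def
proof (intro allI impI)
  fix C assume a: "\<forall>C\<subseteq>V. C \<noteq> {} \<longrightarrow> C \<noteq> V \<longrightarrow> (\<exists>x\<in>C. \<exists>y\<in>V - C. A x y \<noteq> 0)" and C: "C \<subseteq> V" "C \<noteq> {}" "C \<noteq> V"
  have "\<exists>x\<in>V - C. \<exists>y\<in>V - (V - C). A x y \<noteq> 0" using a[rule_format, of "V - C"] C by blast
  thus "\<exists>x\<in>C. \<exists>y\<in>V - C. A y x \<noteq> 0" by blast
qed

text \<open>A set \<open>C\<close> without outgoing edges in the twist yields such sets for the original matrix.\<close>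

lemma irreducible_on_cut_twist:
  assumes irr: "irreducible_on V A" and t: "cut_twist V X A M" and X: "X \<noteq> {}" "X \<noteq> V"
  shows "irreducible_on V M"
  unfolding irreducible_on_def connected_in_def
proof (intro allI impI, rule ccontr)
  fix C assume C: "C \<subseteq> V" "C \<noteq> {}" "C \<noteq> V" and "\<not> (\<exists>x\<in>C. \<exists>y\<in>V - C. M x y \<noteq> 0)"
  hence z: "M x y = 0" if "x \<in> C" "y \<in> V" "y \<notin> C" for x y using that by blast
  obtain p q u w where f: "\<And>x y. x \<in> X \<Longrightarrow> y \<in> V \<Longrightarrow> y \<notin> X \<Longrightarrow>
      A x y = p x * q y \<and> A y x = u y * w x \<and> M x y = p x * u y \<and> M y x = q y * w x"
    and XV: "X \<subseteq> V" and MX: "\<And>x x'. x \<in> X \<Longrightarrow> x' \<in> X \<Longrightarrow> M x x' = A x x'"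
    and MY: "\<And>y y'. y \<in> V \<Longrightarrow> y \<notin> X \<Longrightarrow> y' \<in> V \<Longrightarrow> y' \<notin> X \<Longrightarrow> M y y' = A y' y"
    using t unfolding cut_twist_def by blast
  have edge: "\<exists>x\<in>D. \<exists>y\<in>V - D. A x y \<noteq> 0" if "D \<subseteq> V" "D \<noteq> {}" "D \<noteq> V" for D
    using irr that unfolding irreducible_on_def connected_in_def by blast
  define C1 C2 D1 D2 where "C1 = C \<inter> X" and "C2 = C - X" and "D1 = X - C" and "D2 = V - X - C"
  \<comment> \<open>A product block vanishes only if one of its factors does; the four combinations
    with \<open>qw\<close> are refuted separately.\<close>
  have pu: "(\<forall>x\<in>C1. p x = 0) \<or> (\<forall>y\<in>D2. u y = 0)"
    using z f unfolding C1_def D2_def by (metis DiffE Int_iff mult_eq_0_iff)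
  have qw: "(\<forall>y\<in>C2. q y = 0) \<or> (\<forall>x\<in>D1. w x = 0)"
  proof -
    have "q y * w x = 0" if "y \<in> C2" "x \<in> D1" for x y
    proof -
      have "y \<in> C" "y \<in> V" "y \<notin> X" "x \<in> X" "x \<notin> C" "x \<in> V" using that C(1) XV by (auto simp: C2_def D1_def)
      thus ?thesis using z[of y x] f[of x y] by simp
    qed
    thus ?thesis by (metis mult_eq_0_iff)
  qed
  have e1: "A x y = 0" if "x \<in> C1" "y \<in> D1" for x y
    using z[of x y] MX[of x y] that XV by (auto simp: C1_def D1_def)
  have e2: "A y x = 0" if "x \<in> C2" "y \<in> D2" for x y
    using z[of x y] MY[of x y] that C by (auto simp: C2_def D2_def)
  have closed1: "C1 = {}" if p0: "\<forall>x\<in>C1. p x = 0"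
  proof (rule ccontr)
    assume "C1 \<noteq> {}"
    then obtain x y where xy: "x \<in> C1" "y \<in> V - C1" "A x y \<noteq> 0" using edge[of C1] XV X unfolding C1_def by blast
    show False
    proof (cases "y \<in> X")
      case True thus ?thesis using e1[of x y] xy by (auto simp: C1_def D1_def)
    next
      case False
      thus ?thesis using f[of x y] xy p0 by (auto simp: C1_def)
    qed
  qed
  have closed2: "C2 = {}" if q0: "\<forall>y\<in>C2. q y = 0"
  proof (rule ccontr)
    assume n: "C2 \<noteq> {}"
    have "V - C2 \<noteq> {}" "V - C2 \<noteq> V" using n X C XV unfolding C2_def by blast+
    then obtain x y where xy: "x \<in> V - C2" "y \<in> V - (V - C2)" "A x y \<noteq> 0" using edge[of "V - C2"] by blast
    hence y: "y \<in> C2" by blast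
    show False
    proof (cases "x \<in> X")
      case True thus ?thesis using f[of x y] xy y q0 by (auto simp: C2_def)
    next
      case False
      thus ?thesis using e2[of y x] xy y by (auto simp: C2_def D2_def)
    qed
  qed
  have nzX: "\<exists>x\<in>X. \<exists>y\<in>V - X. p x \<noteq> 0 \<and> q y \<noteq> 0" "\<exists>x\<in>X. \<exists>y\<in>V - X. u y \<noteq> 0 \<and> w x \<noteq> 0"
  proof -
    obtain x y where "x \<in> X" "y \<in> V - X" "A x y \<noteq> 0" using edge[OF XV X] by blast
    thus "\<exists>x\<in>X. \<exists>y\<in>V - X. p x \<noteq> 0 \<and> q y \<noteq> 0" using f[of x y] by auto
    obtain y x where "y \<in> V - X" "x \<in> V - (V - X)" "A y x \<noteq> 0" using edge[of "V - X"] X XV by blast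
    moreover hence "x \<in> X" by blast
    ultimately show "\<exists>x\<in>X. \<exists>y\<in>V - X. u y \<noteq> 0 \<and> w x \<noteq> 0" using f[of x y] by auto
  qed
  have CC: "C = C1 \<union> C2" "X = C1 \<union> D1" "V = C1 \<union> C2 \<union> D1 \<union> D2" using C XV by (auto simp: C1_def C2_def D1_def D2_def)
  from pu show False
  proof
    assume p0: "\<forall>x\<in>C1. p x = 0"
    have C1: "C1 = {}" using closed1[OF p0] .
    from qw show False
    proof
      assume "\<forall>y\<in>C2. q y = 0"
      thus False using closed2 C1 CC C by auto
    next
      assume "\<forall>x\<in>D1. w x = 0"
      thus False using nzX(2) CC C1 by auto
    qed
  next
    assume u0: "\<forall>y\<in>D2. u y = 0"
    from qw show False
    proof
      assume "\<forall>y\<in>C2. q y = 0"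
      hence "C2 = {}" by (rule closed2)
      thus False using nzX(2) u0 by (auto simp: C2_def D2_def)
    next
      assume w0: "\<forall>x\<in>D1. w x = 0"
      have D1: "D1 = {}"
      proof (rule ccontr)
        assume n: "D1 \<noteq> {}"
        have "V - D1 \<noteq> {}" "V - D1 \<noteq> V" using n X XV unfolding D1_def by blast+
        then obtain x y where xy: "x \<in> V - D1" "y \<in> V - (V - D1)" "A x y \<noteq> 0" using edge[of "V - D1"] by blast
        hence y: "y \<in> D1" by blast
        show False
        proof (cases "x \<in> X")
          case True thus ?thesis using e1[of x y] xy y by (auto simp: C1_def D1_def)
        next
          case False
          thus ?thesis using f[of y x] xy y w0 by (auto simp: D1_def)
        qed
      qed
      \<comment> \<open>Now \<open>C\<close> contains \<open>X\<close>. As the twist transposes the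
        block outside \<open>X\<close>, the set without outgoing edges in \<open>A\<close> is the
        complement of \<open>C\<close>.\<close>
      have D2: "D2 \<noteq> {}" using D1 CC C by auto
      have "D2 \<subseteq> V" "D2 \<noteq> V" using X XV by (auto simp: D2_def)
      then obtain x y where xy: "x \<in> D2" "y \<in> V - D2" "A x y \<noteq> 0" using edge[of D2] D2 by blast
      show False
      proof (cases "y \<in> X")
        case True
        thus ?thesis using f[of y x] xy u0 by (auto simp: D2_def)
      next
        case False
        thus ?thesis using e2[of y x] xy by (auto simp: C2_def D2_def)
      qed
    qed
  qed
qed

lemma dsim_shift: "dsim V A B \<Longrightarrow> k \<in> V \<Longrightarrow> dsim V (shift k c A) (shift k c B)"
proof -
  assume "dsim V A B" "k \<in> V"
  then obtain d where d: "\<And>i. i \<in> V \<Longrightarrow> d i \<noteq> 0" "\<And>i j. i \<in> V \<Longrightarrow> j \<in> V \<Longrightarrow> B i j = d i * A i j / d j"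
    unfolding dsim_def by blast
  have "shift k c B i j = d i * shift k c A i j / d j" if "i \<in> V" "j \<in> V" for i j
    using d(1)[OF \<open>k \<in> V\<close>] d(2)[OF that] d(2)[OF that(1) \<open>k \<in> V\<close>] d(2)[OF \<open>k \<in> V\<close> that(2)]
    by (simp add: shift_def distrib_left add_divide_distrib)
  thus ?thesis using d(1) unfolding dsim_def by blast
qed

lemma tw_reach_shift:
  "tw_reach V B A m \<Longrightarrow> k \<in> V \<Longrightarrow> tw_reach V (shift k c B) (shift k c A) m"
proof (induction rule: tw_reach.induct)
  case (tw_reach_sim A m)
  thus ?case using dsim_shift tw_reach.tw_reach_sim by blast
next
  case (tw_reach_sim_transp A m)
  hence "dsim V (shift k c A) (transposed (shift k c B))"
    using dsim_shift[of V A "transposed B" k c] unfolding shift_transp[of k c B] by blast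
  thus ?case by (rule tw_reach.tw_reach_sim_transp)
next
  case (tw_reach_twist X A M m)
  thus ?case using cut_twist_shift tw_reach.tw_reach_twist by blast
qed

lemma tw_reach_shift_rev:
  assumes r: "tw_reach V (shift k c B) (shift k c A) m" and k: "k \<in> V" and e: "A k k = B k k" and c: "1 + c * A k k \<noteq> 0"
  shows "tw_reach V B A m"
  using tw_reach_shift[OF r k, of "- c / (1 + c * A k k)^2"] shift_inverse[of c A k] shift_inverse[of c B k] c e by simp

section \<open>Ratios with respect to a base index\<close>

text \<open>Compares the edge from \<open>i\<close> to \<open>j\<close> with the detour through
  \<open>v\<close>. The quotient is invariant under diagonal similarity, and for distinct
  \<open>i\<close>, \<open>j\<close> other than \<open>v\<close> it does not involve the
  diagonal.\<close>

definition alpha :: "'i \<Rightarrow> ('i \<Rightarrow> 'i \<Rightarrow> 'a::field) \<Rightarrow> 'i \<Rightarrow> 'i \<Rightarrow> 'a" where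
  "alpha v A i j = A i j / (A i v * A v j)"

definition linked :: "'i \<Rightarrow> 'i set \<Rightarrow> ('i \<Rightarrow> 'i \<Rightarrow> 'a::field) \<Rightarrow> bool" where
  "linked v U A \<longleftrightarrow> (\<forall>i\<in>U. A i v \<noteq> 0 \<and> A v i \<noteq> 0)"

definition pm_alpha :: "nat \<Rightarrow> nat \<Rightarrow> nat set \<Rightarrow> (nat \<Rightarrow> nat \<Rightarrow> 'a::field) \<Rightarrow> (nat \<Rightarrow> nat \<Rightarrow> 'a) \<Rightarrow> bool" where
  "pm_alpha n v U a b \<longleftrightarrow> v \<notin> U \<and> insert v U \<subseteq> {..<n} \<and>
     (\<exists>A B. pm_equivalent n (insert v U) A B \<and> linked v U A \<and> linked v U B \<and> agree U a (alpha v A) \<and> agree U b (alpha v B))"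

lemma pm_equivalent_sym: "pm_equivalent n V A B \<Longrightarrow> pm_equivalent n V B A"
  by (simp add: pm_equivalent_def)

lemma pm_equivalent_mono: "pm_equivalent n V A B \<Longrightarrow> W \<subseteq> V \<Longrightarrow> pm_equivalent n W A B"
  by (auto simp: pm_equivalent_def)

lemma pm_equivalent_set_diagonal:
  assumes e: "pm_equivalent n V A B" and V: "V \<subseteq> {..<n}" and k: "k \<in> V"
  shows "pm_equivalent n V (\<lambda>i j. if i = k \<and> j = k then c else A i j) (\<lambda>i j. if i = k \<and> j = k then c else B i j)"
    (is "pm_equivalent n V ?A ?B")
  unfolding pm_equivalent_def
proof (intro allI impI)
  fix S assume S: "S \<subseteq> V"
  have kk: "A k k = B k k" "k < n" using pm_equivalent_diagonal[OF e V k] V k by auto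
  show "pminor n S ?A = pminor n S ?B"
  proof (cases "k \<in> S")
    case True
    then obtain T where T: "S = insert k T" "k \<notin> T" by (meson Set.set_insert)
    have "T \<subseteq> V" using S T by auto
    thus ?thesis using pminor_set_diagonal[OF kk(2) T(2), of A c] pminor_set_diagonal[OF kk(2) T(2), of B c]
        pm_equivalentD[OF e S] pm_equivalentD[OF e, of T] kk T(1) by simp
  next
    case False
    have "pminor n S ?A = pminor n S A" "pminor n S ?B = pminor n S B" by (rule pminor_cong, use False in auto)+
    thus ?thesis using pm_equivalentD[OF e S] by simp
  qed
qed

text \<open>With \<open>A k k = 0\<close> the update fixes row and column \<open>k\<close>, and
  \<open>c\<close> is chosen so that the entries in the row and column of \<open>v\<close> acquire
  the factors that are the denominators of \<open>psi\<close>.\<close>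

lemma alpha_shift:
  assumes l: "linked v U A" and k: "k \<in> U" "v \<notin> U" and A0: "A k k = 0" and ok: "psi_ok U k t (alpha v A)"
  defines "c \<equiv> t / (A k v * A v k)"
  shows "linked v U (shift k c A)" "agree U (psi k t (alpha v A)) (alpha v (shift k c A))"
proof -
  have nz: "A i v \<noteq> 0" "A v i \<noteq> 0" if "i \<in> U" for i using l that by (auto simp: linked_def)
  have t: "t = c * (A k v * A v k)" using nz[OF k(1)] by (simp add: c_def)
  have kc: "shift k c A k j = A k j" "shift k c A j k = A j k" for j using A0 by (simp_all add: shift_def)
  have e: "shift k c A i v = A i v * (1 + t * alpha v A i k)" "shift k c A v i = A v i * (1 + t * alpha v A k i)" if "i \<in> U" for i
    using nz[OF that] nz[OF k(1)] by (simp_all add: shift_def alpha_def t field_simps)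
  have o: "1 + t * alpha v A i k \<noteq> 0" "1 + t * alpha v A k i \<noteq> 0" if "i \<in> U" "i \<noteq> k" for i
    using ok that by (auto simp: psi_ok_def)
  show "linked v U (shift k c A)" unfolding linked_def
  proof (intro ballI)
    fix i assume i: "i \<in> U"
    show "shift k c A i v \<noteq> 0 \<and> shift k c A v i \<noteq> 0"
      using e[OF i] o[OF i] nz[OF i] kc by (cases "i = k") auto
  qed
  show "agree U (psi k t (alpha v A)) (alpha v (shift k c A))" unfolding agree_def
  proof (intro ballI impI)
    fix i j assume ij: "i \<in> U" "j \<in> U" "i \<noteq> j"
    consider "i = k" | "j = k" | "i \<noteq> k" "j \<noteq> k" by blast
    thus "psi k t (alpha v A) i j = alpha v (shift k c A) i j"
    proof cases
      case 1
      have "alpha v (shift k c A) k j = A k j / (A k v * (A v j * (1 + t * alpha v A k j)))"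
        unfolding alpha_def[of v "shift k c A"] kc e(2)[OF ij(2)] by simp
      thus ?thesis using 1 by (simp add: psi_def alpha_def[of v A k j])
    next
      case 2
      have "alpha v (shift k c A) i k = A i k / ((A i v * (1 + t * alpha v A i k)) * A v k)"
        unfolding alpha_def[of v "shift k c A"] kc e(1)[OF ij(1)] by simp
      thus ?thesis using 2 ij by (simp add: psi_def alpha_def[of v A i k] mult.commute mult.left_commute)
    next
      case 3
      have "shift k c A i j = (A i v * A v j) * (alpha v A i j + t * (alpha v A i k * alpha v A k j))"
        using nz[OF ij(1)] nz[OF ij(2)] nz[OF k(1)] by (simp add: shift_def alpha_def t field_simps)
      hence "alpha v (shift k c A) i j = (A i v * A v j) * (alpha v A i j + t * (alpha v A i k * alpha v A k j)) /
        ((A i v * A v j) * ((1 + t * alpha v A i k) * (1 + t * alpha v A k j)))"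
        unfolding alpha_def[of v "shift k c A"] e(1)[OF ij(1)] e(2)[OF ij(2)] by (simp add: ac_simps)
      thus ?thesis using 3 nz[OF ij(1)] nz[OF ij(2)] by (simp add: psi_def)
    qed
  qed
qed

text \<open>For a clan \<open>X\<close> the ratio \<open>a x y\<close> across the boundary does not
  depend on \<open>x\<close>, so the blocks have rank one. The twist keeps the complement of
  \<open>X\<close>, which contains \<open>v\<close>, and transposes \<open>X\<close> together with
  its entries at \<open>v\<close>; so exactly the ratios inside \<open>X\<close> are
  reversed.\<close>

lemma flip_cut_twist:
  assumes l: "linked v U A" and v: "v \<notin> U" and a: "agree U a (alpha v A)" and cl: "clan U a X"
  shows "\<exists>M. cut_twist (insert v U) (insert v U - X) A M \<and> linked v U M \<and> agree U (flip X a) (alpha v M)"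
proof -
  let ?V = "insert v U"
  have nz: "A i v \<noteq> 0" "A v i \<noteq> 0" if "i \<in> U" for i using l that by (auto simp: linked_def)
  have XU: "X \<subseteq> U" using clan_subset[OF cl] .
  have A_eq: "A i j = A i v * a i j * A v j" if "i \<in> U" "j \<in> U" "i \<noteq> j" for i j
    using a that nz[OF that(1)] nz[OF that(2)] by (auto simp: agree_def alpha_def)
  define x0 where "x0 = (SOME x. x \<in> X)"
  have x0: "x0 \<in> X" if "x \<in> X" for x using that someI[of "\<lambda>x. x \<in> X"] by (simp add: x0_def)
  have cx: "a x y = a x0 y" "a y x = a y x0" if "x \<in> X" "y \<in> U" "y \<notin> X" for x y
    using clan_eq[OF cl that(1) x0[OF that(1)] that(2,3)] by auto
  \<comment> \<open>At \<open>y = v\<close> the block consists of the entries at \<open>v\<close>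
    themselves, hence the factor 1.\<close>
  define p where "p y = (if y = v then 1 else A y v * a y x0)" for y
  define w where "w y = (if y = v then 1 else A v y * a x0 y)" for y
  define M where "M i j = (if i \<in> X then (if j \<in> X then A j i else A v i * w j) else (if j \<in> X then p i * A j v else A i j))" for i j
  have Apw: "A y x = p y * A v x" "A x y = A x v * w y" if "x \<in> X" "y \<in> ?V" "y \<notin> X" for x y
  proof -
    have "x \<in> U" "x \<noteq> y" using that XU by auto
    thus "A y x = p y * A v x" "A x y = A x v * w y"
      using that A_eq[of y x] A_eq[of x y] cx[of x y] by (auto simp: p_def w_def)
  qed
  have VX: "x \<in> X" if "x \<in> ?V" "x \<notin> ?V - X" for x using that by blast
  have "cut_twist ?V (?V - X) A M"
  proof (rule cut_twistI[where p = p and q = "\<lambda>x. A v x" and u = "\<lambda>x. A x v" and w = w])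
    fix y x assume y: "y \<in> ?V - X" and x: "x \<in> ?V" "x \<notin> ?V - X"
    have x': "x \<in> X" by (rule VX[OF x])
    show "A y x = p y * A v x \<and> A x y = A x v * w y \<and> M y x = p y * A x v \<and> M x y = A v x * w y"
      using Apw[OF x'] y x' by (simp add: M_def)
  next
    fix y y' assume "y \<in> ?V" "y \<notin> ?V - X" "y' \<in> ?V" "y' \<notin> ?V - X"
    hence "y \<in> X" "y' \<in> X" using VX by blast+
    thus "M y y' = A y' y" by (simp add: M_def)
  qed (auto simp: M_def)
  moreover have Mv: "M i v = (if i \<in> X then A v i else A i v)" "M v i = (if i \<in> X then A i v else A v i)" if "i \<in> U" for i
    using that v XU by (auto simp: M_def w_def p_def)
  hence "linked v U M" using nz unfolding linked_def by auto
  moreover have "agree U (flip X a) (alpha v M)" unfolding agree_def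
  proof (intro ballI impI)
    fix i j assume ij: "i \<in> U" "j \<in> U" "i \<noteq> j"
    have aij: "a i j = alpha v A i j" "a j i = alpha v A j i" using a ij by (auto simp: agree_def)
    have vv: "i \<noteq> v" "j \<noteq> v" using ij v by auto
    consider "i \<in> X" "j \<in> X" | "i \<notin> X" "j \<notin> X" | "i \<in> X" "j \<notin> X" | "i \<notin> X" "j \<in> X" by blast
    thus "flip X a i j = alpha v M i j"
    proof cases
      case 1 thus ?thesis unfolding alpha_def Mv(1)[OF ij(1)] Mv(2)[OF ij(2)]
        using aij by (simp add: flip_def M_def alpha_def mult.commute)
    next
      case 2 thus ?thesis unfolding alpha_def Mv(1)[OF ij(1)] Mv(2)[OF ij(2)]
        using aij by (simp add: flip_def M_def alpha_def)
    next
      case 3 thus ?thesis unfolding alpha_def Mv(1)[OF ij(1)] Mv(2)[OF ij(2)]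
        using cx[of i j] ij nz[OF ij(1)] nz[OF ij(2)] vv by (simp add: flip_def M_def w_def)
    next
      case 4 thus ?thesis unfolding alpha_def Mv(1)[OF ij(1)] Mv(2)[OF ij(2)]
        using cx[of j i] ij nz[OF ij(1)] nz[OF ij(2)] vv by (simp add: flip_def M_def p_def)
    qed
  qed
  ultimately show ?thesis by blast
qed

text \<open>The sum is the weight of the two 3-cycles on \<open>i\<close>, \<open>j\<close>,
  \<open>v\<close>, the product that of the 2-cycle on \<open>i\<close>, \<open>j\<close>, both
  divided by 2-cycles through \<open>v\<close>. Principal minors determine all these
  weights.\<close>

lemma pm_alpha_pair:
  assumes h: "pm_alpha n v U a b" and ij: "i \<in> U" "j \<in> U" "i \<noteq> j"
  shows "a i j + a j i = b i j + b j i \<and> a i j * a j i = b i j * b j i"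
proof -
  obtain A B where v: "v \<notin> U" "insert v U \<subseteq> {..<n}" and e: "pm_equivalent n (insert v U) A B"
    and l: "linked v U A" "linked v U B" and ag: "agree U a (alpha v A)" "agree U b (alpha v B)"
    using h unfolding pm_alpha_def by blast
  have nz: "A i v \<noteq> 0" "A v i \<noteq> 0" "A j v \<noteq> 0" "A v j \<noteq> 0" "B i v \<noteq> 0" "B v i \<noteq> 0" "B j v \<noteq> 0" "B v j \<noteq> 0"
    using l ij by (auto simp: linked_def)
  have V: "i \<in> insert v U" "j \<in> insert v U" "v \<in> insert v U" using ij by auto
  have wi: "A i v * A v i = B i v * B v i" and wj: "A j v * A v j = B j v * B v j" and wij: "A i j * A j i = B i j * B j i"
    using pm_equivalent_pair[OF e v(2)] V by blast+
  have tr: "A i j * A j v * A v i + A j i * A i v * A v j = B i j * B j v * B v i + B j i * B i v * B v j"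
    using pm_equivalent_triple[OF e v(2) V] .
  have s: "C i j / (C i v * C v j) + C j i / (C j v * C v i) =
      (C i j * C j v * C v i + C j i * C i v * C v j) / ((C i v * C v i) * (C j v * C v j))"
    and p: "C i j / (C i v * C v j) * (C j i / (C j v * C v i)) = (C i j * C j i) / ((C i v * C v i) * (C j v * C v j))"
    if "C i v \<noteq> 0" "C v i \<noteq> 0" "C j v \<noteq> 0" "C v j \<noteq> 0" for C :: "nat \<Rightarrow> nat \<Rightarrow> 'a"
    using that by (simp_all add: field_simps)
  have ab: "a i j = A i j / (A i v * A v j)" "a j i = A j i / (A j v * A v i)"
    "b i j = B i j / (B i v * B v j)" "b j i = B j i / (B j v * B v i)"
    using ag ij by (auto simp: agree_def alpha_def)
  show ?thesis
    unfolding ab s[of A, OF nz(1-4)] s[of B, OF nz(5-8)] p[of A, OF nz(1-4)] p[of B, OF nz(5-8)] wi wj wij tr by simp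
qed

lemma pm_alpha_relation:
  assumes "infinite (UNIV :: 'a::field set)"
  shows "pm_relation (pm_alpha n v :: nat set \<Rightarrow> (nat \<Rightarrow> nat \<Rightarrow> 'a) \<Rightarrow> (nat \<Rightarrow> nat \<Rightarrow> 'a) \<Rightarrow> bool)"
proof
  fix U :: "nat set" and a b :: "nat \<Rightarrow> nat \<Rightarrow> 'a"
  show "infinite (UNIV :: 'a set)" by fact
  assume h: "pm_alpha n v U a b"
  then obtain A B where v: "v \<notin> U" "insert v U \<subseteq> {..<n}" and e: "pm_equivalent n (insert v U) A B"
    and l: "linked v U A" "linked v U B" and ag: "agree U a (alpha v A)" "agree U b (alpha v B)"
    unfolding pm_alpha_def by blast
  show "finite U" by (rule finite_of_bounded[OF v(2)])
  show "a i j + a j i = b i j + b j i \<and> a i j * a j i = b i j * b j i" if "i \<in> U" "j \<in> U" "i \<noteq> j" for i j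
    using pm_alpha_pair[OF h that] .
  show "pm_alpha n v U b a" using v e l ag pm_equivalent_sym unfolding pm_alpha_def by blast
  show "pm_alpha n v W a b" if "W \<subseteq> U" for W
    unfolding pm_alpha_def
    by (intro conjI exI[of _ A] exI[of _ B])
      (use that v l ag agree_mono pm_equivalent_mono[OF e, of "insert v W"] in \<open>auto simp: linked_def\<close>)
  show "pm_alpha n v U (flip X a) b" if cl: "clan U a X" for X
  proof -
    obtain M where M: "cut_twist (insert v U) (insert v U - X) A M" "linked v U M" "agree U (flip X a) (alpha v M)"
      using flip_cut_twist[OF l(1) v(1) ag(1) cl] by blast
    thus ?thesis using pm_equivalent_cut_twist[OF e v(2) M(1)] v l ag unfolding pm_alpha_def by blast
  qed
  show "pm_alpha n v U (psi k t a) (psi k t b)" if k: "k \<in> U" and ok: "psi_ok U k t a" for k t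
  proof -
    \<comment> \<open>The ratios on \<open>U\<close> off the diagonal do not change, and
      \<open>alpha_shift\<close> becomes applicable.\<close>
    let ?A = "\<lambda>i j. if i = k \<and> j = k then 0 else A i j" and ?B = "\<lambda>i j. if i = k \<and> j = k then 0 else B i j"
    have kv: "k \<noteq> v" using k v by auto
    have e': "pm_equivalent n (insert v U) ?A ?B" by (rule pm_equivalent_set_diagonal[OF e v(2)]) (use k in simp)
    have l': "linked v U ?A" "linked v U ?B" using l kv by (auto simp: linked_def)
    have ag': "agree U a (alpha v ?A)" "agree U b (alpha v ?B)" using ag kv by (auto simp: agree_def alpha_def)
    have oka: "psi_ok U k t (alpha v ?A)" using ok ag'(1) k unfolding psi_ok_def agree_def by auto
    have okb: "psi_ok U k t (alpha v ?B)"
      unfolding psi_ok_def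
    proof (rule ballI)
      fix i assume i: "i \<in> U - {k}"
      have eb: "b i k = alpha v ?B i k" "b k i = alpha v ?B k i" using ag'(2) i k by (auto simp: agree_def)
      have "(b i k = a i k \<and> b k i = a k i) \<or> (b i k = a k i \<and> b k i = a i k)"
        using two_roots pm_alpha_pair[OF h, of i k] i k by (metis DiffE insertI1)
      thus "1 + t * alpha v ?B i k \<noteq> 0 \<and> 1 + t * alpha v ?B k i \<noteq> 0"
        using ok i unfolding psi_ok_def eb[symmetric] by auto
    qed
    \<comment> \<open>The same coefficient arises from both matrices, because
      \<open>A k v * A v k\<close> is a pair product.\<close>
    define c where "c = t / (?A k v * ?A v k)"
    have "?A k v * ?A v k = ?B k v * ?B v k"
      using pm_equivalent_pair[OF e' v(2), of k v] k by simp
    hence cB: "c = t / (?B k v * ?B v k)" by (simp only: c_def)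
    have kk: "?A k k = 0" "?B k k = 0" by simp_all
    have "linked v U (shift k c ?A)" "agree U (psi k t (alpha v ?A)) (alpha v (shift k c ?A))"
      using alpha_shift[OF l'(1) k v(1) kk(1) oka] unfolding c_def by blast+
    moreover have "linked v U (shift k c ?B)" "agree U (psi k t (alpha v ?B)) (alpha v (shift k c ?B))"
      using alpha_shift[OF l'(2) k v(1) kk(2) okb] unfolding cB by blast+
    moreover have "agree U (psi k t a) (psi k t (alpha v ?A))" "agree U (psi k t b) (psi k t (alpha v ?B))"
      using psi_agree[OF ag'(1) k] psi_agree[OF ag'(2) k] by auto
    ultimately have "agree U (psi k t a) (alpha v (shift k c ?A))" "agree U (psi k t b) (alpha v (shift k c ?B))"
      "linked v U (shift k c ?A)" "linked v U (shift k c ?B)" using agree_trans by blast+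
    moreover have "pm_equivalent n (insert v U) (shift k c ?A) (shift k c ?B)"
      using pm_equivalent_shift[OF e' v(2)] k by blast
    ultimately show ?thesis using v unfolding pm_alpha_def by blast
  qed
qed

text \<open>\<open>d\<close> matches the columns of \<open>v\<close>; pair products then match the
  rows of \<open>v\<close>, and equal ratios the other entries off the diagonal.\<close>

lemma dsim_of_alpha:
  assumes v: "v \<notin> U" "insert v U \<subseteq> {..<n}" and e: "pm_equivalent n (insert v U) A B"
    and l: "linked v U A" "linked v U B" and ag: "agree U (alpha v A) (alpha v B)"
  shows "dsim (insert v U) A B"
proof -
  define d where "d i = (if i = v then 1 else B i v / A i v)" for i
  have nz: "A i v \<noteq> 0" "A v i \<noteq> 0" "B i v \<noteq> 0" "B v i \<noteq> 0" if "i \<in> U" for i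
    using l that by (auto simp: linked_def)
  have w: "B v i = A i v * A v i / B i v" if "i \<in> U" for i
    using pm_equivalent_pair[OF e v(2), of i v] that nz[OF that] by (simp add: field_simps)
  have "B i j = d i * A i j / d j" if ij: "i \<in> insert v U" "j \<in> insert v U" for i j
  proof -
    consider "i = j" | "i = v" "j \<in> U" | "j = v" "i \<in> U" | "i \<noteq> j" "i \<in> U" "j \<in> U" using ij by blast
    thus ?thesis
    proof cases
      case 1
      have "d i \<noteq> 0" using ij(1) nz by (auto simp: d_def)
      thus ?thesis using 1 pm_equivalent_diagonal[OF e v(2) ij(1)] by simp
    next
      case 2
      thus ?thesis using w[of j] v by (auto simp: d_def)
    next
      case 3
      thus ?thesis using nz[of i] v by (auto simp: d_def)
    next
      case 4
      have "A i j / (A i v * A v j) = B i j / (B i v * B v j)" using ag 4 by (auto simp: agree_def alpha_def)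
      hence "B i j = A i j / (A i v * A v j) * (B i v * B v j)" using nz[OF 4(2)] nz[OF 4(3)] by (simp add: field_simps)
      moreover have "i \<noteq> v" "j \<noteq> v" using 4 v by auto
      ultimately show ?thesis using nz[OF 4(2)] nz[OF 4(3)] w[OF 4(3)] by (simp add: d_def field_simps)
    qed
  qed
  moreover have "\<forall>i\<in>insert v U. d i \<noteq> 0" using nz by (auto simp: d_def)
  ultimately show ?thesis unfolding dsim_def by blast
qed

lemma pm_equivalent_transp:
  assumes "pm_equivalent n V A B" "V \<subseteq> {..<n}" shows "pm_equivalent n V A (transposed B)"
  unfolding pm_equivalent_def
proof (intro allI impI)
  fix S assume S: "S \<subseteq> V"
  hence "S \<subseteq> {..<n}" using assms(2) by blast
  moreover from this have "finite S" by (meson finite_lessThan finite_subset)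
  ultimately show "pminor n S A = pminor n S (transposed B)" using pminor_transpose[of S n B] pm_equivalentD[OF assms(1) S] by simp
qed

lemma tw_reach_of_reach:
  assumes "reach U b a m" and v: "v \<notin> U" "insert v U \<subseteq> {..<n}" and e: "pm_equivalent n (insert v U) A B"
    and l: "linked v U A" "linked v U B" and ag: "agree U a (alpha v A)" "agree U b (alpha v B)"
  shows "tw_reach (insert v U) B A m"
  using assms(1) e l(1) ag(1)
proof (induction arbitrary: A rule: reach.induct)
  case (reach_eq a m)
  have "agree U (alpha v A) (alpha v B)" using reach_eq ag(2) agree_sym agree_trans by metis
  thus ?case using dsim_of_alpha[OF v reach_eq(2,3) l(2)] tw_reach.tw_reach_sim by blast
next
  case (reach_transp a m)
  have t: "alpha v (transposed B) = transposed (alpha v B)" by (simp add: fun_eq_iff alpha_def mult.commute)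
  have "agree U (alpha v A) (transposed b)" using reach_transp agree_sym agree_trans by metis
  moreover have "agree U (transposed b) (transposed (alpha v B))" using ag(2) agree_transp[of U b "alpha v B"] by simp
  ultimately have "agree U (alpha v A) (alpha v (transposed B))" unfolding t using agree_trans by metis
  moreover have "linked v U (transposed B)" using l(2) by (auto simp: linked_def)
  ultimately have "dsim (insert v U) A (transposed B)"
    using dsim_of_alpha[OF v pm_equivalent_transp[OF reach_transp(2) v(2)] reach_transp(3)] by blast
  thus ?case by (rule tw_reach.tw_reach_sim_transp)
next
  case (reach_flip a X m)
  let ?V = "insert v U"
  have fin: "finite U" by (rule finite_of_bounded[OF v(2)])
  have XU: "X \<subseteq> U" using clan_subset[OF reach_flip.hyps(1)] .
  obtain M where M: "cut_twist ?V (?V - X) A M" "linked v U M" "agree U (flip X a) (alpha v M)"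
    using flip_cut_twist[OF reach_flip.prems(2) v(1) reach_flip.prems(3) reach_flip.hyps(1)] by blast
  have r: "tw_reach ?V B M m"
    by (rule reach_flip.IH[OF pm_equivalent_cut_twist[OF reach_flip.prems(1) v(2) M(1)] M(2,3)])
  \<comment> \<open>The complement of \<open>X\<close> contains \<open>v\<close> and
    \<open>y\<close>, so it is large enough for a cut.\<close>
  obtain y where "y \<in> U - X" using XU reach_flip.hyps(3) by blast
  hence "2 \<le> card (?V - X)" using card_two_le[of "?V - X" v y] fin v XU by auto
  moreover have "?V - (?V - X) = X" using XU by blast
  hence "2 \<le> card (?V - (?V - X))" using reach_flip.hyps(2) by simp
  ultimately show ?case using tw_reach.tw_reach_twist[OF M(1) _ _ r] by blast
qed

text \<open>Generic updates fill the row and the column of \<open>v\<close>; \<open>zero_column\<close> measures what is missing.\<close>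

definition zero_column :: "'i \<Rightarrow> 'i set \<Rightarrow> ('i \<Rightarrow> 'i \<Rightarrow> 'a::zero) \<Rightarrow> 'i set" where
  "zero_column v U A = {i\<in>U. A i v = 0}"

lemma affine_eventually_nonzero:
  fixes x y :: "'a::field"
  assumes "x \<noteq> 0 \<or> y \<noteq> 0" shows "\<forall>\<^sub>F c in cofinite. x + c * y \<noteq> 0"
  using poly_eventually_nonzero[of "[:x, y:]"] assms by simp

lemma zero_column_shift:
  assumes "finite U" shows "\<forall>\<^sub>F c in cofinite. zero_column v U (shift k c A) \<subseteq> zero_column v U A"
proof -
  have "\<forall>\<^sub>F c in cofinite. \<forall>i\<in>U. A i v \<noteq> 0 \<longrightarrow> shift k c A i v \<noteq> 0"
  proof (intro eventually_ball_finite[OF assms] ballI)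
    fix i
    show "\<forall>\<^sub>F c in cofinite. A i v \<noteq> 0 \<longrightarrow> shift k c A i v \<noteq> 0"
    proof (cases "A i v = 0")
      case True thus ?thesis by simp
    next
      case False
      thus ?thesis using affine_eventually_nonzero[of "A i v" "A i k * A k v"] by (simp add: shift_def)
    qed
  qed
  thus ?thesis by eventually_elim (auto simp: zero_column_def)
qed

text \<open>Irreducibility gives an edge from a zero \<open>x\<close> to some \<open>y\<close>
  outside the zero set. Here \<open>y\<close> is not \<open>v\<close>, because
  \<open>A x v = 0\<close>, and the update at \<open>y\<close> adds a nonzero multiple of
  \<open>c\<close> to that entry.\<close>

lemma zero_column_shift_strict:
  assumes fin: "finite U" and v: "v \<notin> U" and irr: "irreducible_on (insert v U) A" and z: "zero_column v U A \<noteq> {}"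
  shows "\<exists>k\<in>U. \<forall>\<^sub>F c in cofinite. zero_column v U (shift k c A) \<subset> zero_column v U A"
proof -
  let ?C = "zero_column v U A"
  have "?C \<subseteq> insert v U" "?C \<noteq> insert v U" using v by (auto simp: zero_column_def)
  then obtain x y where xy: "x \<in> ?C" "y \<in> insert v U - ?C" "A x y \<noteq> 0"
    using irr z unfolding irreducible_on_def connected_in_def by blast
  have y: "y \<in> U" "A y v \<noteq> 0" using xy by (auto simp: zero_column_def)
  have "\<forall>\<^sub>F c in cofinite. shift y c A x v \<noteq> 0"
    using affine_eventually_nonzero[of "A x v" "A x y * A y v"] xy y by (simp add: shift_def)
  hence "\<forall>\<^sub>F c in cofinite. zero_column v U (shift y c A) \<subset> ?C"
    using zero_column_shift[OF fin, of v y A]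
  proof eventually_elim
    case (elim c)
    have "x \<notin> zero_column v U (shift y c A)" using elim(1) by (simp add: zero_column_def)
    thus ?case using elim(2) xy(1) by blast
  qed
  thus ?thesis using y by blast
qed

text \<open>Induction over the number of zeros in the row and the column of \<open>v\<close>.
  Pulling a solution back from the updated matrices asks for \<open>1 + c * A k k\<close> to be
  nonzero, which again holds for generic \<open>c\<close>.\<close>

lemma tw_reach_irreducible:
  fixes A B :: "nat \<Rightarrow> nat \<Rightarrow> 'a::field"
  assumes inf: "infinite (UNIV :: 'a set)" and V: "V \<subseteq> {..<n}" "v \<in> V"
    and e: "pm_equivalent n V A B" and irr: "irreducible_on V A" "irreducible_on V B"
  shows "tw_reach V B A (2 * (card V - 3))"
proof -
  interpret pm_relation "pm_alpha n v :: nat set \<Rightarrow> (nat \<Rightarrow> nat \<Rightarrow> 'a) \<Rightarrow> (nat \<Rightarrow> nat \<Rightarrow> 'a) \<Rightarrow> bool"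
    by (rule pm_alpha_relation[OF inf])
  define U where "U = V - {v}"
  have U: "V = insert v U" "v \<notin> U" "finite U" using V finite_subset[of V "{..<n}"] by (auto simp: U_def)
  define z where "z A = card (zero_column v U A) + card (zero_column v U (transposed A))" for A :: "nat \<Rightarrow> nat \<Rightarrow> 'a"
  show ?thesis using e irr
  proof (induction "z A + z B" arbitrary: A B rule: less_induct)
    case less
    note e = less.prems(1) and irr = less.prems(2,3)
    show ?case
    proof (cases "linked v U A \<and> linked v U B")
      case True
      have h: "pm_alpha n v U (alpha v A) (alpha v B)"
        unfolding pm_alpha_def using U V e True by (metis agree_refl)
      have "tw_reach V B A (2 * (card U - 2))"
        using tw_reach_of_reach[OF reach_bound[OF h], of v n A B] U V e True by simp
      moreover have "card V = Suc (card U)" using U by simp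
      ultimately show ?thesis by simp
    next
      case False
      have fin: "finite (zero_column v U C)" for C :: "nat \<Rightarrow> nat \<Rightarrow> 'a" using U by (simp add: zero_column_def)
      have zl: "z C = 0 \<longleftrightarrow> linked v U C" for C :: "nat \<Rightarrow> nat \<Rightarrow> 'a"
        using fin[of C] fin[of "transposed C"] by (auto simp: z_def linked_def zero_column_def)
      have le: "\<forall>\<^sub>F c in cofinite. z (shift k c C) \<le> z C" for C k
        using zero_column_shift[OF U(3), of v k C] zero_column_shift[OF U(3), of v k "transposed C"]
      proof eventually_elim
        case (elim c)
        thus ?case using card_mono[OF fin elim(1)] card_mono[OF fin elim(2)] unfolding z_def shift_transp[of k c C] by simp
      qed
      have lt: "\<exists>k\<in>U. \<forall>\<^sub>F c in cofinite. z (shift k c C) < z C" if C: "irreducible_on V C" "\<not> linked v U C" for C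
      proof -
        from C(2) have "zero_column v U C \<noteq> {} \<or> zero_column v U (transposed C) \<noteq> {}"
          by (auto simp: linked_def zero_column_def)
        thus ?thesis
        proof
          assume "zero_column v U C \<noteq> {}"
          then obtain k where k: "k \<in> U" "\<forall>\<^sub>F c in cofinite. zero_column v U (shift k c C) \<subset> zero_column v U C"
            using zero_column_shift_strict[OF U(3,2)] C(1) U(1) by blast
          have "\<forall>\<^sub>F c in cofinite. z (shift k c C) < z C"
            using k(2) zero_column_shift[OF U(3), of v k "transposed C"]
          proof eventually_elim
            case (elim c)
            thus ?case using psubset_card_mono[OF fin elim(1)] card_mono[OF fin elim(2)]
              unfolding z_def shift_transp[of k c C] by simp
          qed
          thus ?thesis using k by blast
        next
          assume "zero_column v U (transposed C) \<noteq> {}"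
          then obtain k where k: "k \<in> U" "\<forall>\<^sub>F c in cofinite. zero_column v U (shift k c (transposed C)) \<subset> zero_column v U (transposed C)"
            using zero_column_shift_strict[OF U(3,2), of "transposed C"] irreducible_on_transp[OF C(1)] U(1) by blast
          have "\<forall>\<^sub>F c in cofinite. z (shift k c C) < z C"
            using k(2) zero_column_shift[OF U(3), of v k C]
          proof eventually_elim
            case (elim c)
            thus ?case using psubset_card_mono[OF fin elim(1)] card_mono[OF fin elim(2)]
              unfolding z_def shift_transp[of k c C] by simp
          qed
          thus ?thesis using k by blast
        qed
      qed
      have "\<exists>k\<in>U. \<forall>\<^sub>F c in cofinite. z (shift k c A) + z (shift k c B) < z A + z B"
      proof (cases "linked v U A")
        case True
        then obtain k where k: "k \<in> U" "\<forall>\<^sub>F c in cofinite. z (shift k c B) < z B" using lt[OF irr(2)] False by blast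
        have "\<forall>\<^sub>F c in cofinite. z (shift k c A) + z (shift k c B) < z A + z B"
          using k(2) le[of k A] by eventually_elim simp
        thus ?thesis using k by blast
      next
        case False
        then obtain k where k: "k \<in> U" "\<forall>\<^sub>F c in cofinite. z (shift k c A) < z A" using lt[OF irr(1)] by blast
        have "\<forall>\<^sub>F c in cofinite. z (shift k c A) + z (shift k c B) < z A + z B"
          using k(2) le[of k B] by eventually_elim simp
        thus ?thesis using k by blast
      qed
      then obtain k where k: "k \<in> U" "\<forall>\<^sub>F c in cofinite. z (shift k c A) + z (shift k c B) < z A + z B" by blast
      have kV: "k \<in> V" using k U by simp
      have kk: "A k k = B k k" using pm_equivalent_diagonal[OF e V(1) kV] .
      have "\<forall>\<^sub>F c in cofinite. z (shift k c A) + z (shift k c B) < z A + z B \<and> 1 + c * A k k \<noteq> 0"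
        using k(2) affine_eventually_nonzero[of 1 "A k k"] by (simp add: eventually_conj)
      then obtain c where c: "z (shift k c A) + z (shift k c B) < z A + z B" "1 + c * A k k \<noteq> 0"
        using cofinite_ex[OF inf] by blast
      have "tw_reach V (shift k c B) (shift k c A) (2 * (card V - 3))"
        by (rule less.hyps[OF c(1) pm_equivalent_shift[OF e V(1) kV] irreducible_on_shift[OF irr(1) kV c(2)]
            irreducible_on_shift[OF irr(2) kV]]) (use c(2) kk in simp)
      thus ?thesis by (rule tw_reach_shift_rev[where A = A and B = B and c = c, OF _ kV kk c(2)])
    qed
  qed
qed


section \<open>Matrices over an arbitrary field\<close>

abbreviation (input) entries :: "'a mat \<Rightarrow> nat \<Rightarrow> nat \<Rightarrow> 'a" where
  "entries A \<equiv> \<lambda>i j. A $$ (i, j)"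

abbreviation (input) lift :: "(nat \<Rightarrow> nat \<Rightarrow> 'a::field) \<Rightarrow> nat \<Rightarrow> nat \<Rightarrow> 'a fls" where
  "lift A \<equiv> \<lambda>i j. fls_const (A i j)"

lemma fls_const_eq_iff: "fls_const x = fls_const y \<longleftrightarrow> x = y"
  by (metis fls_const_nth)

lemma infinite_fls: "infinite (UNIV :: 'a::field fls set)"
proof -
  have "inj (\<lambda>n::nat. (fls_X ^ n :: 'a fls))"
  proof (rule injI)
    fix m n :: nat assume "(fls_X ^ m :: 'a fls) = fls_X ^ n"
    hence "fls_subdegree (fls_X ^ m :: 'a fls) = fls_subdegree (fls_X ^ n :: 'a fls)" by simp
    thus "m = n" by simp
  qed
  thus ?thesis by (metis finite_imageD finite_subset infinite_UNIV_nat subset_UNIV)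
qed

lemma pminor_lift:
  fixes A :: "nat \<Rightarrow> nat \<Rightarrow> 'a::field"
  assumes "finite S" "S \<subseteq> {..<n}"
  shows "pminor n S (lift A) = fls_const (pminor n S A)"
  using assms
proof (induction arbitrary: A rule: finite_induct)
  case (insert k S)
  have k: "k < n" and S: "S \<subseteq> {..<n}" using insert.prems by auto
  have "(\<lambda>i j. fls_const (A i j) - fls_const (A i k) * fls_const (A k j)) = lift (\<lambda>i j. A i j - A i k * A k j)"
    by (simp add: fun_eq_iff fls_minus_const)
  hence "pminor n S (\<lambda>i j. fls_const (A i j) - fls_const (A i k) * fls_const (A k j)) =
      fls_const (pminor n S (\<lambda>i j. A i j - A i k * A k j))"
    using insert.IH[OF S, of "\<lambda>i j. A i j - A i k * A k j"] by simp
  moreover have "fls_const (A k k) - 1 = fls_const (A k k - 1)"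
    using fls_minus_const[of "A k k" 1] by simp
  ultimately show ?case
    by (simp add: pminor_insert[OF k insert.hyps(2)] insert.IH[OF S, of A] fls_plus_const)
qed simp

lemma pm_equivalent_lift:
  assumes "pm_equivalent n V A B" "V \<subseteq> {..<n}"
  shows "pm_equivalent n V (lift A) (lift B)"
  unfolding pm_equivalent_def
proof (intro allI impI)
  fix S assume S: "S \<subseteq> V"
  hence S': "S \<subseteq> {..<n}" using assms(2) by blast
  hence "finite S" by (meson finite_lessThan finite_subset)
  thus "pminor n S (lift A) = pminor n S (lift B)"
    using pminor_lift[OF _ S', of A] pminor_lift[OF _ S', of B] pm_equivalentD[OF assms(1) S] by simp
qed

lemma irreducible_on_lift: "irreducible_on V (lift A) \<longleftrightarrow> irreducible_on V A"
  by (simp add: irreducible_on_def)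

lemma principal_minor_equivalent_iff:
  assumes "A \<in> carrier_mat n n" "B \<in> carrier_mat n n"
  shows "principal_minor_equivalent n A B \<longleftrightarrow> pm_equivalent n {..<n} (entries A) (entries B)"
  unfolding principal_minor_equivalent_def pm_equivalent_def
  using det_submatrix_eq_pminor[OF assms(1)] det_submatrix_eq_pminor[OF assms(2)] by simp

lemma irreducible_mat_iff: "irreducible_mat n A \<longleftrightarrow> irreducible_on {..<n} (entries A)"
proof
  assume irr: "irreducible_mat n A"
  show "irreducible_on {..<n} (entries A)"
    unfolding irreducible_on_def connected_in_def using irreducible_block_nonzero[OF irr] by blast
next
  assume irr: "irreducible_on {..<n} (entries A)"
  let ?E = "{(a, b). a < n \<and> b < n \<and> a \<noteq> b \<and> A $$ (a, b) \<noteq> 0}"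
  show "irreducible_mat n A" unfolding irreducible_iff_strongly_connected
  proof (intro allI impI, rule ccontr)
    fix i j assume ij: "i < n" "j < n" "(i, j) \<notin> ?E\<^sup>*"
    define K where "K = {k. k < n \<and> (i, k) \<in> ?E\<^sup>*}"
    have K: "K \<subseteq> {..<n}" "i \<in> K" "j \<in> {..<n}" "j \<notin> K" using ij by (auto simp: K_def)
    obtain u v where "u \<in> K" "v \<in> {..<n}" "v \<notin> K" "A $$ (u, v) \<noteq> 0"
      by (rule connected_inE[OF irr[unfolded irreducible_on_def] K])
    hence uv: "u < n" "(i, u) \<in> ?E\<^sup>*" "v < n" "(i, v) \<notin> ?E\<^sup>*" "A $$ (u, v) \<noteq> 0"
      by (simp_all add: K_def)
    have "(u, v) \<in> ?E" using uv by auto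
    thus False using uv(2,4) rtrancl_into_rtrancl[of i u ?E v] by blast
  qed
qed

section \<open>Descent from Laurent series\<close>

lemma dsim_trans: "dsim V A B \<Longrightarrow> dsim V B C \<Longrightarrow> dsim V A C"
proof -
  assume "dsim V A B" "dsim V B C"
  then obtain d e where d: "\<And>i. i \<in> V \<Longrightarrow> d i \<noteq> 0" "\<And>i j. i \<in> V \<Longrightarrow> j \<in> V \<Longrightarrow> B i j = d i * A i j / d j"
    and e: "\<And>i. i \<in> V \<Longrightarrow> e i \<noteq> 0" "\<And>i j. i \<in> V \<Longrightarrow> j \<in> V \<Longrightarrow> C i j = e i * B i j / e j"
    unfolding dsim_def by metis
  have "e i * (d i * A i j / d j) / e j = (e i * d i) * A i j / (e j * d j)" for i j
    by (simp add: ac_simps)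
  hence "\<forall>i\<in>V. \<forall>j\<in>V. C i j = (e i * d i) * A i j / (e j * d j)" using d(2) e(2) by simp
  moreover have "\<forall>i\<in>V. e i * d i \<noteq> 0" using d e by simp
  ultimately show ?thesis unfolding dsim_def by (intro exI[of _ "\<lambda>i. e i * d i"]) blast
qed

lemma dsim_refl: "dsim V A A"
  unfolding dsim_def by (rule exI[of _ "\<lambda>_. 1"]) simp

lemma pm_equivalent_dsim:
  assumes "dsim V A B" "V \<subseteq> {..<n}" shows "pm_equivalent n V A B"
  unfolding pm_equivalent_def
proof (intro allI impI)
  fix S assume S: "S \<subseteq> V"
  obtain d where d: "\<And>i. i \<in> V \<Longrightarrow> d i \<noteq> 0" "\<And>i j. i \<in> V \<Longrightarrow> j \<in> V \<Longrightarrow> B i j = d i * A i j / d j"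
    using assms(1) unfolding dsim_def by metis
  have S': "S \<subseteq> {..<n}" using S assms(2) by blast
  hence fin: "finite S" by (meson finite_lessThan finite_subset)
  have "pminor n S B = pminor n S (\<lambda>i j. d i * A i j / d j)"
    by (rule pminor_cong) (use d(2) S in blast)
  also have "\<dots> = pminor n S A" by (rule pminor_diagonal_similar[OF fin S']) (use d(1) S in blast)
  finally show "pminor n S A = pminor n S B" by simp
qed

text \<open>Along a nonzero entry \<open>A x y\<close> the quotient of \<open>d y\<close> and
  \<open>d x\<close> is a constant. Irreducibility connects all indices to \<open>v\<close>, so
  \<open>d\<close> is \<open>d v\<close> times constants, and \<open>d v\<close> cancels.\<close>

lemma dsim_descend:
  assumes s: "dsim V (lift A) (lift B)" and irr: "irreducible_on V A" and v: "v \<in> V"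
  shows "dsim V A B"
proof -
  obtain d where d: "\<And>i. i \<in> V \<Longrightarrow> d i \<noteq> 0"
    "\<And>i j. i \<in> V \<Longrightarrow> j \<in> V \<Longrightarrow> fls_const (B i j) = d i * fls_const (A i j) / d j"
    using s unfolding dsim_def by metis
  have "\<exists>e. d i = d v * fls_const e" if i: "i \<in> V" for i
  proof (rule connected_in_class[where P = "\<lambda>i. \<exists>e. d i = d v * fls_const e",
        OF irr[unfolded irreducible_on_def] v i])
    show "\<exists>e. d v = d v * fls_const e" by (rule exI[of _ 1]) simp
    fix x y assume xy: "x \<in> V" "y \<in> V" "A x y \<noteq> 0" "\<exists>e. d x = d v * fls_const e"
    then obtain e where e: "d x = d v * fls_const e" by blast
    have nz: "fls_const (A x y) \<noteq> 0" using xy(3) by simp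
    hence bnz: "fls_const (B x y) \<noteq> 0" using d(1)[OF xy(1)] d(1)[OF xy(2)] d(2)[OF xy(1,2)] by simp
    have "d y = d x * fls_const (A x y) / fls_const (B x y)"
    proof -
      have "fls_const (B x y) * d y = d x * fls_const (A x y)"
        using d(1)[OF xy(2)] d(2)[OF xy(1,2)] by simp
      thus ?thesis using bnz by (metis nonzero_mult_div_cancel_left)
    qed
    also have "\<dots> = d v * fls_const (e * A x y / B x y)"
      unfolding e fls_const_divide_const[symmetric] fls_const_mult_const[symmetric] by (simp add: mult.assoc)
    finally show "\<exists>e. d y = d v * fls_const e" by blast
  qed
  then obtain e where e: "\<And>i. i \<in> V \<Longrightarrow> d i = d v * fls_const (e i)" by metis
  have e0: "e i \<noteq> 0" if "i \<in> V" for i using e[OF that] d(1)[OF that] by auto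
  have "B i j = e i * A i j / e j" if ij: "i \<in> V" "j \<in> V" for i j
  proof -
    have "fls_const (B i j) = (d v * fls_const (e i)) * fls_const (A i j) / (d v * fls_const (e j))"
      using d(2)[OF ij] e[OF ij(1)] e[OF ij(2)] by simp
    also have "\<dots> = fls_const (e i) * fls_const (A i j) / fls_const (e j)"
      using d(1)[OF v] by (simp add: mult.assoc)
    also have "\<dots> = fls_const (e i * A i j / e j)" by (simp add: fls_const_divide_const)
    finally show ?thesis by (simp only: fls_const_eq_iff)
  qed
  thus ?thesis unfolding dsim_def using e0 by blast
qed

text \<open>Irreducibility makes both blocks nonzero, so their factors are unique up to scalars
  \<open>l\<close> and \<open>m\<close>. The twists are related by \<open>d\<close> on
  \<open>X\<close> and, since the other block is transposed, by the inverse of \<open>d\<close>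
  outside, corrected by \<open>l * m\<close>.\<close>

lemma cut_twist_unique:
  assumes t: "cut_twist V X A M" "cut_twist V X A' M'" and s: "dsim V A A'"
    and irr: "irreducible_on V A" and X: "X \<noteq> {}" "X \<noteq> V"
  shows "dsim V M M'"
proof -
  obtain p q u w where f: "\<And>x y. x \<in> X \<Longrightarrow> y \<in> V \<Longrightarrow> y \<notin> X \<Longrightarrow>
      A x y = p x * q y \<and> A y x = u y * w x \<and> M x y = p x * u y \<and> M y x = q y * w x"
    and XV: "X \<subseteq> V" and MX: "\<And>x x'. x \<in> X \<Longrightarrow> x' \<in> X \<Longrightarrow> M x x' = A x x'"
    and MY: "\<And>y y'. y \<in> V \<Longrightarrow> y \<notin> X \<Longrightarrow> y' \<in> V \<Longrightarrow> y' \<notin> X \<Longrightarrow> M y y' = A y' y"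
    using t(1) unfolding cut_twist_def by blast
  obtain p' q' u' w' where f': "\<And>x y. x \<in> X \<Longrightarrow> y \<in> V \<Longrightarrow> y \<notin> X \<Longrightarrow>
      A' x y = p' x * q' y \<and> A' y x = u' y * w' x \<and> M' x y = p' x * u' y \<and> M' y x = q' y * w' x"
    and MX': "\<And>x x'. x \<in> X \<Longrightarrow> x' \<in> X \<Longrightarrow> M' x x' = A' x x'"
    and MY': "\<And>y y'. y \<in> V \<Longrightarrow> y \<notin> X \<Longrightarrow> y' \<in> V \<Longrightarrow> y' \<notin> X \<Longrightarrow> M' y y' = A' y' y"
    using t(2) unfolding cut_twist_def by blast
  obtain d where d: "\<And>i. i \<in> V \<Longrightarrow> d i \<noteq> 0" "\<And>i j. i \<in> V \<Longrightarrow> j \<in> V \<Longrightarrow> A' i j = d i * A i j / d j"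
    using s unfolding dsim_def by metis
  have edge: "\<exists>x\<in>D. \<exists>y\<in>V - D. A x y \<noteq> 0" if "D \<subseteq> V" "D \<noteq> {}" "D \<noteq> V" for D
    using irr that unfolding irreducible_on_def connected_in_def by blast
  obtain x0 y0 where 0: "x0 \<in> X" "y0 \<in> V" "y0 \<notin> X" "A x0 y0 \<noteq> 0" using edge[OF XV X] by blast
  obtain x1 y1 where 1: "x1 \<in> X" "y1 \<in> V" "y1 \<notin> X" "A y1 x1 \<noteq> 0" using edge[of "V - X"] X XV by blast
  have nz: "q y0 \<noteq> 0" "p x0 \<noteq> 0" "q' y0 \<noteq> 0" "p' x0 \<noteq> 0" "u y1 \<noteq> 0" "w x1 \<noteq> 0" "u' y1 \<noteq> 0" "w' x1 \<noteq> 0"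
    using f[OF 0(1-3)] f'[OF 0(1-3)] f[OF 1(1-3)] f'[OF 1(1-3)] 0 1 XV d(1) d(2)[of x0 y0] d(2)[of y1 x1] by auto
  define l where "l = q y0 / (d y0 * q' y0)"
  define m where "m = w x1 / (d x1 * w' x1)"
  have lm: "l \<noteq> 0" "m \<noteq> 0" using nz d(1)[OF 0(2)] d(1)[of x1] 1 XV by (auto simp: l_def m_def)
  have p': "p' x = l * d x * p x" if x: "x \<in> X" for x
  proof -
    have "p' x * q' y0 = d x * (p x * q y0) / d y0"
      using f[OF x 0(2,3)] f'[OF x 0(2,3)] d(2)[of x y0] x 0 XV by auto
    thus ?thesis using nz d(1)[OF 0(2)] by (simp add: l_def field_simps)
  qed
  have q': "q' y = q y / (l * d y)" if y: "y \<in> V" "y \<notin> X" for y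
  proof -
    have "p' x0 * q' y = d x0 * (p x0 * q y) / d y"
      using f[OF 0(1) y] f'[OF 0(1) y] d(2)[of x0 y] y 0 XV by auto
    thus ?thesis using p'[OF 0(1)] nz lm d(1)[OF y(1)] d(1)[of x0] 0 XV by (auto simp: field_simps)
  qed
  have u': "u' y = m * d y * u y" if y: "y \<in> V" "y \<notin> X" for y
  proof -
    have "u' y * w' x1 = d y * (u y * w x1) / d x1"
      using f[OF 1(1) y] f'[OF 1(1) y] d(2)[of y x1] y 1 XV by auto
    thus ?thesis using nz d(1)[of x1] 1 XV by (auto simp: m_def field_simps)
  qed
  have w': "w' x = w x / (m * d x)" if x: "x \<in> X" for x
  proof -
    have "u' y1 * w' x = d y1 * (u y1 * w x) / d x"
      using f[OF x 1(2,3)] f'[OF x 1(2,3)] d(2)[of y1 x] x 1 XV by auto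
    thus ?thesis using u'[OF 1(2,3)] nz lm d(1)[OF 1(2)] d(1)[of x] x XV by (auto simp: field_simps)
  qed
  define e where "e i = (if i \<in> X then d i else 1 / (l * m * d i))" for i
  have "M' i j = e i * M i j / e j" if ij: "i \<in> V" "j \<in> V" for i j
  proof -
    note dn = d(1)[OF ij(1)] d(1)[OF ij(2)]
    consider "i \<in> X" "j \<in> X" | "i \<notin> X" "j \<notin> X" | "i \<in> X" "j \<notin> X" | "i \<notin> X" "j \<in> X" by blast
    thus ?thesis
    proof cases
      case 1
      thus ?thesis using MX[OF 1] MX'[OF 1] d(2)[OF ij] by (simp add: e_def)
    next
      case 2
      thus ?thesis using MY[OF ij(1) 2(1) ij(2) 2(2)] MY'[OF ij(1) 2(1) ij(2) 2(2)] d(2)[OF ij(2,1)] dn lm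
        by (simp add: e_def)
    next
      case 3
      thus ?thesis using f[OF 3(1) ij(2) 3(2)] f'[OF 3(1) ij(2) 3(2)] p'[OF 3(1)] u'[OF ij(2) 3(2)] dn lm
        by (simp add: e_def)
    next
      case 4
      thus ?thesis using f[OF 4(2) ij(1) 4(1)] f'[OF 4(2) ij(1) 4(1)] q'[OF ij(1) 4(1)] w'[OF 4(2)] dn lm
        by (simp add: e_def)
    qed
  qed
  moreover have "\<forall>i\<in>V. e i \<noteq> 0" using d(1) lm by (simp add: e_def)
  ultimately show ?thesis unfolding dsim_def by blast
qed

lemma cut_twist_lift:
  assumes "cut_twist V X A M" shows "cut_twist V X (lift A) (lift M)"
proof -
  obtain p q u w where "\<And>x y. x \<in> X \<Longrightarrow> y \<in> V \<Longrightarrow> y \<notin> X \<Longrightarrow>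
      A x y = p x * q y \<and> A y x = u y * w x \<and> M x y = p x * u y \<and> M y x = q y * w x"
    and "X \<subseteq> V" and "\<And>x x'. x \<in> X \<Longrightarrow> x' \<in> X \<Longrightarrow> M x x' = A x x'"
    and "\<And>y y'. y \<in> V \<Longrightarrow> y \<notin> X \<Longrightarrow> y' \<in> V \<Longrightarrow> y' \<notin> X \<Longrightarrow> M y y' = A y' y"
    using assms unfolding cut_twist_def by blast
  thus ?thesis
    by (intro cut_twistI[where p = "\<lambda>x. fls_const (p x)" and q = "\<lambda>x. fls_const (q x)"
          and u = "\<lambda>x. fls_const (u x)" and w = "\<lambda>x. fls_const (w x)"]) simp_all
qed

section \<open>Cuts, cut-transposes and diagonal similarity of matrices\<close>

lemma submatrix_entry:
  assumes "A \<in> carrier_mat n n" "i < n" "j < n" "i \<in> I" "j \<in> J"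
  shows "submatrix A I J $$ (pos_in I i, pos_in J j) = A $$ (i, j)"
  using submatrix_index_card[of i A j I J] assms by simp

lemma is_cut_bounds:
  assumes "is_cut n A X"
  shows "X \<subseteq> {..<n}" "X \<noteq> {}" "X \<noteq> {..<n}"
  using assms by (auto simp: is_cut_def)

lemma tw_cut_twist:
  fixes A :: "'a::field mat"
  assumes A: "A \<in> carrier_mat n n" and irr: "irreducible_mat n A" and cut: "is_cut n A X"
  shows "tw n A X \<in> carrier_mat n n" "cut_twist {..<n} X (entries A) (entries (tw n A X))"
proof -
  define Y where "Y = {..<n} - X"
  define M where "M = tw n A X"
  have XY: "X \<subseteq> {..<n}" "Y \<subseteq> {..<n}" "finite X" "finite Y"
    using is_cut_bounds[OF cut] finite_subset[of X "{..<n}"] by (auto simp: Y_def)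
  have "is_cut_transpose n A X M"
    unfolding M_def tw_def by (rule theI'[OF cut_transpose_unique[OF A irr cut]])
  then obtain p q u w where e: "submatrix A X Y = outer_prod p q" "submatrix A Y X = outer_prod u w"
    "submatrix M X X = submatrix A X X" "submatrix M X Y = outer_prod p u"
    "submatrix M Y X = outer_prod q w" "submatrix M Y Y = transpose_mat (submatrix A Y Y)"
    and M: "M \<in> carrier_mat n n"
    unfolding is_cut_transpose_def Let_def Y_def by blast
  show "tw n A X \<in> carrier_mat n n" using M by (simp add: M_def)
  have dims: "dim_vec p = card X" "dim_vec q = card Y" "dim_vec u = card Y" "dim_vec w = card X"
    using submatrix_carrier[OF A XY(1,2)] submatrix_carrier[OF A XY(2,1)] unfolding e outer_prod_def by auto
  have o: "outer_prod a b $$ (pos_in I i, pos_in J j) = a $ pos_in I i * b $ pos_in J j"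
    if "dim_vec a = card I" "dim_vec b = card J" "finite I" "finite J" "i \<in> I" "j \<in> J"
    for a b :: "'a vec" and I J :: "nat set" and i j
    using that pos_in_less[of I i] pos_in_less[of J j] by (simp add: outer_prod_def)
  have "cut_twist {..<n} X (entries A) (entries M)"
  proof (rule cut_twistI[where p = "\<lambda>x. p $ pos_in X x" and q = "\<lambda>y. q $ pos_in Y y"
        and u = "\<lambda>y. u $ pos_in Y y" and w = "\<lambda>x. w $ pos_in X x"])
    fix x y assume x: "x \<in> X" and y': "y \<in> {..<n}" "y \<notin> X"
    hence y: "y \<in> Y" by (simp add: Y_def)
    have n: "x < n" "y < n" using x y XY by auto
    show "A $$ (x, y) = p $ pos_in X x * q $ pos_in Y y \<and> A $$ (y, x) = u $ pos_in Y y * w $ pos_in X x \<and>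
      M $$ (x, y) = p $ pos_in X x * u $ pos_in Y y \<and> M $$ (y, x) = q $ pos_in Y y * w $ pos_in X x"
      using submatrix_entry[OF A n x y] submatrix_entry[OF A n(2,1) y x] submatrix_entry[OF M n x y]
        submatrix_entry[OF M n(2,1) y x] o[OF dims(1,2) XY(3,4) x y] o[OF dims(3,4) XY(4,3) y x]
        o[OF dims(1,3) XY(3,4) x y] o[OF dims(2,4) XY(4,3) y x] unfolding e by simp
  next
    fix x x' assume x: "x \<in> X" "x' \<in> X"
    have n: "x < n" "x' < n" using x XY by auto
    show "M $$ (x, x') = A $$ (x, x')"
      using submatrix_entry[OF A n x] submatrix_entry[OF M n x] unfolding e by simp
  next
    fix y y' assume "y \<in> {..<n}" "y \<notin> X" "y' \<in> {..<n}" "y' \<notin> X"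
    hence n: "y < n" "y' < n" and y: "y \<in> Y" "y' \<in> Y" by (auto simp: Y_def)
    have "pos_in Y y < dim_col (submatrix A Y Y)" "pos_in Y y' < dim_row (submatrix A Y Y)"
      using pos_in_less[OF XY(4)] y submatrix_carrier[OF A XY(2,2)] by auto
    thus "M $$ (y, y') = A $$ (y', y)"
      using submatrix_entry[OF A n(2,1) y(2,1)] submatrix_entry[OF M n y] unfolding e by simp
  qed (rule XY)
  thus "cut_twist {..<n} X (entries A) (entries (tw n A X))" by (simp add: M_def)
qed

lemma is_cutI:
  fixes A :: "'a::field mat"
  assumes A: "A \<in> carrier_mat n n" and X: "X \<subseteq> {..<n}" "2 \<le> card X" "2 \<le> card ({..<n} - X)"
    and r: "\<And>x y. x \<in> X \<Longrightarrow> y \<in> {..<n} - X \<Longrightarrow> A $$ (x, y) = p x * q y"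
      "\<And>x y. x \<in> X \<Longrightarrow> y \<in> {..<n} - X \<Longrightarrow> A $$ (y, x) = u y * w x"
  shows "is_cut n A X"
proof -
  let ?Y = "{..<n} - X"
  have fin: "finite X" using X(1) by (meson finite_lessThan finite_subset)
  have c: "card ?Y = n - card X" "card X \<le> n" using X fin card_mono[of "{..<n}" X] by (auto simp: card_Diff_subset)
  have rk: "vec_space.rank (card I) (submatrix A I J) \<le> 1"
    if I: "I \<subseteq> {..<n}" "J \<subseteq> {..<n}" and e: "\<And>x y. x \<in> I \<Longrightarrow> y \<in> J \<Longrightarrow> A $$ (x, y) = f x * g y" for I J f g
  proof (rule vec_space.rank_le_1_product_entries[where f = "\<lambda>i. f (pick I i)" and g = "\<lambda>j. g (pick J j)"])
    show car: "submatrix A I J \<in> carrier_mat (card I) (card J)" by (rule submatrix_carrier[OF A I])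
    fix i j assume "i < dim_row (submatrix A I J)" "j < dim_col (submatrix A I J)"
    hence ij: "i < card I" "j < card J" using car by auto
    have s: "{i. i < n \<and> i \<in> I} = I" "{i. i < n \<and> i \<in> J} = J" using I by auto
    have "submatrix A I J $$ (i, j) = A $$ (pick I i, pick J j)"
      using ij s A by (subst submatrix_index) auto
    also have "\<dots> = f (pick I i) * g (pick J j)"
      by (rule e) (use ij pick_in_set_le in blast)+
    finally show "submatrix A I J $$ (i, j) = f (pick I i) * g (pick J j)" .
  qed
  have "vec_space.rank (card X) (submatrix A X ?Y) \<le> 1" by (rule rk[OF X(1) _ r(1)]) auto
  moreover have "vec_space.rank (card ?Y) (submatrix A ?Y X) \<le> 1" by (rule rk[OF _ X(1) r(2)]) auto
  moreover have "X \<subset> {..<n}"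
  proof -
    have "?Y \<noteq> {}" using X(3) by (metis card.empty not_numeral_le_zero)
    thus ?thesis using X(1) by blast
  qed
  ultimately show ?thesis using X c unfolding is_cut_def by auto
qed

lemma diagonally_similar_iff:
  assumes A: "A \<in> carrier_mat n n" and B: "B \<in> carrier_mat n n"
  shows "diagonally_similar A B \<longleftrightarrow> dsim {..<n} (entries A) (entries B)"
proof
  have prod: "(D * A * E) $$ (i, j) = D $$ (i, i) * A $$ (i, j) * E $$ (j, j)"
    if D: "D \<in> carrier_mat n n" "E \<in> carrier_mat n n" and z: "\<And>i j. i < n \<Longrightarrow> j < n \<Longrightarrow> i \<noteq> j \<Longrightarrow> D $$ (i, j) = 0"
        "\<And>i j. i < n \<Longrightarrow> j < n \<Longrightarrow> i \<noteq> j \<Longrightarrow> E $$ (i, j) = 0" and ij: "i < n" "j < n" for D E i j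
  proof -
    have DA: "(D * A) $$ (i, k) = D $$ (i, i) * A $$ (i, k)" if "k < n" for k
    proof -
      have "(D * A) $$ (i, k) = (\<Sum>l\<in>{0..<n}. D $$ (i, l) * A $$ (l, k))"
        using D A ij that by (simp add: scalar_prod_def)
      also have "\<dots> = (\<Sum>l\<in>{0..<n}. if l = i then D $$ (i, i) * A $$ (i, k) else 0)"
        by (intro sum.cong) (use z(1) ij in auto)
      finally show ?thesis using ij by simp
    qed
    have "(D * A * E) $$ (i, j) = (\<Sum>l\<in>{0..<n}. (D * A) $$ (i, l) * E $$ (l, j))"
      using D A ij by (simp add: scalar_prod_def del: assoc_mult_mat)
    also have "\<dots> = (\<Sum>l\<in>{0..<n}. if l = j then (D * A) $$ (i, j) * E $$ (j, j) else 0)"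
      by (intro sum.cong) (use z(2) ij in auto)
    finally show ?thesis using ij DA by simp
  qed
  {
    assume "diagonally_similar A B"
    then obtain D E where dD: "diagonal_mat D" and w: "similar_mat_wit B A D E"
      unfolding diagonally_similar_def by blast
    have car: "D \<in> carrier_mat n n" "E \<in> carrier_mat n n" and DE: "D * E = 1\<^sub>m n" "B = D * A * E"
      using w B unfolding similar_mat_wit_def Let_def by auto
    have z: "D $$ (i, j) = 0" if "i < n" "j < n" "i \<noteq> j" for i j
      using dD car that unfolding diagonal_mat_def by auto
    \<comment> \<open>Row \<open>i\<close> of \<open>D * E\<close> is row \<open>i\<close> of
      \<open>E\<close> times \<open>D $$ (i, i)\<close>, so \<open>E\<close> is diagonal
      too.\<close>
    have de: "D $$ (i, i) * E $$ (i, j) = (if i = j then 1 else 0)" if ij: "i < n" "j < n" for i j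
    proof -
      have "(D * E) $$ (i, j) = (\<Sum>l\<in>{0..<n}. D $$ (i, l) * E $$ (l, j))"
        using car ij by (simp add: scalar_prod_def)
      also have "\<dots> = (\<Sum>l\<in>{0..<n}. if l = i then D $$ (i, i) * E $$ (i, j) else 0)"
        by (intro sum.cong) (use z ij in auto)
      finally show ?thesis using ij DE(1) by simp
    qed
    have d0: "D $$ (i, i) \<noteq> 0" "E $$ (i, i) = 1 / D $$ (i, i)" if "i < n" for i
    proof -
      have 1: "D $$ (i, i) * E $$ (i, i) = 1" using de[OF that that] by simp
      thus "D $$ (i, i) \<noteq> 0" by auto
      thus "E $$ (i, i) = 1 / D $$ (i, i)" using 1 by (metis nonzero_mult_div_cancel_left)
    qed
    have zE: "E $$ (i, j) = 0" if "i < n" "j < n" "i \<noteq> j" for i j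
      using de[OF that(1,2)] d0(1)[OF that(1)] that by simp
    have "B $$ (i, j) = D $$ (i, i) * A $$ (i, j) / D $$ (j, j)" if "i < n" "j < n" for i j
      using prod[OF car z zE that] d0(2)[OF that(2)] DE(2) by simp
    thus "dsim {..<n} (entries A) (entries B)"
      unfolding dsim_def using d0(1) by (intro exI[of _ "\<lambda>i. D $$ (i, i)"]) simp
  }
  assume "dsim {..<n} (entries A) (entries B)"
  then obtain d where d: "\<And>i. i < n \<Longrightarrow> d i \<noteq> 0" "\<And>i j. i < n \<Longrightarrow> j < n \<Longrightarrow> B $$ (i, j) = d i * A $$ (i, j) / d j"
    unfolding dsim_def by (metis lessThan_iff)
  define D where "D = mat n n (\<lambda>(i, j). if i = j then d i else 0)"
  define E where "E = mat n n (\<lambda>(i, j). if i = j then 1 / d i else 0)"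
  have car: "D \<in> carrier_mat n n" "E \<in> carrier_mat n n" by (auto simp: D_def E_def)
  have inv: "mat n n (\<lambda>(i, j). if i = j then f i else 0) * mat n n (\<lambda>(i, j). if i = j then g i else 0) = 1\<^sub>m n"
    if "\<And>i. i < n \<Longrightarrow> f i * g i = 1" for f g :: "nat \<Rightarrow> 'a"
  proof (rule eq_matI)
    fix i j assume "i < dim_row (1\<^sub>m n :: 'a mat)" "j < dim_col (1\<^sub>m n :: 'a mat)"
    hence ij: "i < n" "j < n" by auto
    have "(mat n n (\<lambda>(i, j). if i = j then f i else 0) * mat n n (\<lambda>(i, j). if i = j then g i else 0)) $$ (i, j) =
      (\<Sum>l\<in>{0..<n}. (if i = l then f i else 0) * (if l = j then g l else 0))"
      using ij by (simp add: scalar_prod_def)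
    also have "\<dots> = (\<Sum>l\<in>{0..<n}. if l = i then (if i = j then f i * g i else 0) else 0)"
      by (intro sum.cong) auto
    finally show "(mat n n (\<lambda>(i, j). if i = j then f i else 0) * mat n n (\<lambda>(i, j). if i = j then g i else 0)) $$ (i, j) = 1\<^sub>m n $$ (i, j)"
      using ij that by simp
  qed auto
  have "D * E = 1\<^sub>m n" "E * D = 1\<^sub>m n" unfolding D_def E_def by (rule inv, use d(1) in simp)+
  moreover have "B = D * A * E"
  proof (rule eq_matI)
    fix i j assume "i < dim_row (D * A * E)" "j < dim_col (D * A * E)"
    hence ij: "i < n" "j < n" using car by auto
    have "(D * A * E) $$ (i, j) = D $$ (i, i) * A $$ (i, j) * E $$ (j, j)"
      by (rule prod[OF car _ _ ij]) (auto simp: D_def E_def)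
    thus "B $$ (i, j) = (D * A * E) $$ (i, j)" using d(2)[OF ij] ij by (simp add: D_def E_def)
  qed (use B car in auto)
  ultimately have "similar_mat_wit B A D E"
    unfolding similar_mat_wit_def Let_def using A B car carrier_matD(1)[OF B] by auto
  moreover have "diagonal_mat D" by (auto simp: diagonal_mat_def D_def)
  ultimately show "diagonally_similar A B" unfolding diagonally_similar_def by blast
qed

section \<open>Sequences of cut-transposes\<close>

inductive tw_chain :: "nat \<Rightarrow> 'a::field mat \<Rightarrow> 'a mat \<Rightarrow> nat \<Rightarrow> bool" for n B where
  tw_chain_base: "A \<in> carrier_mat n n \<Longrightarrow> diagonally_equivalent A B \<Longrightarrow> tw_chain n B A m"
| tw_chain_step: "A \<in> carrier_mat n n \<Longrightarrow> is_cut n A X \<Longrightarrow> tw_chain n B (tw n A X) m \<Longrightarrow> tw_chain n B A (Suc m)"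

lemma tw_chain_sequence:
  "tw_chain n B A m \<Longrightarrow> \<exists>k As. k \<le> m \<and> (\<forall>i\<le>k. As i \<in> carrier_mat n n) \<and> As 0 = A \<and>
     (\<forall>i<k. \<exists>X. is_cut n (As i) X \<and> As (Suc i) = tw n (As i) X) \<and> diagonally_equivalent (As k) B"
proof (induction rule: tw_chain.induct)
  case (tw_chain_base A m)
  thus ?case by (intro exI[of _ 0] exI[of _ "\<lambda>_. A"]) simp
next
  case (tw_chain_step A X m)
  then obtain k As where k: "k \<le> m" "\<forall>i\<le>k. As i \<in> carrier_mat n n" "As 0 = tw n A X"
     "\<forall>i<k. \<exists>X. is_cut n (As i) X \<and> As (Suc i) = tw n (As i) X" "diagonally_equivalent (As k) B" by blast
  let ?As = "case_nat A As"
  have "\<forall>i\<le>Suc k. ?As i \<in> carrier_mat n n" using k(2) tw_chain_step.hyps(1) by (auto split: nat.split)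
  moreover have "\<forall>i<Suc k. \<exists>X. is_cut n (?As i) X \<and> ?As (Suc i) = tw n (?As i) X"
  proof (intro allI impI)
    fix i assume "i < Suc k"
    thus "\<exists>X. is_cut n (?As i) X \<and> ?As (Suc i) = tw n (?As i) X"
      using k(3,4) tw_chain_step.hyps(2) by (cases i) auto
  qed
  ultimately show ?case using k(1,5) by (intro exI[of _ "Suc k"] exI[of _ ?As]) simp
qed

text \<open>Only the sets of the twists over Laurent series are kept. \<open>A\<close> stays
  diagonally similar to the current \<open>A'\<close> over the larger field: its blocks inherit rank
  one, \<open>tw n A X\<close> is one of the possible twists, and \<open>cut_twist_unique\<close>
  compares it with \<open>M\<close>.\<close>

lemma tw_chain_of_reach:
  fixes B :: "'a::field mat"
  assumes "tw_reach {..<n} (lift (entries B)) A' m" and B: "B \<in> carrier_mat n n" and n: "1 \<le> n"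
    and "A \<in> carrier_mat n n" "irreducible_mat n A" "dsim {..<n} (lift (entries A)) A'"
  shows "tw_chain n B A m"
  using assms(1,4-6)
proof (induction arbitrary: A rule: tw_reach.induct)
  case (tw_reach_sim A' m)
  have "dsim {..<n} (lift (entries A)) (lift (entries B))" using dsim_trans tw_reach_sim by blast
  hence "dsim {..<n} (entries A) (entries B)"
    by (rule dsim_descend[where v = 0]) (use tw_reach_sim.prems(2) n in \<open>simp_all add: irreducible_mat_iff\<close>)
  hence "diagonally_equivalent A B"
    using diagonally_similar_iff tw_reach_sim.prems(1) B unfolding diagonally_equivalent_def by blast
  thus ?case using tw_chain_base tw_reach_sim.prems(1) by blast
next
  case (tw_reach_sim_transp A' m)
  have BT: "transpose_mat B \<in> carrier_mat n n" using B by simp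
  have "dsim {..<n} (lift (entries A)) (lift (\<lambda>i j. B $$ (j, i)))" using dsim_trans tw_reach_sim_transp by blast
  hence "dsim {..<n} (entries A) (\<lambda>i j. B $$ (j, i))"
    by (rule dsim_descend[where v = 0]) (use tw_reach_sim_transp.prems(2) n in \<open>simp_all add: irreducible_mat_iff\<close>)
  hence "dsim {..<n} (entries A) (entries (transpose_mat B))"
    using B unfolding dsim_def by auto
  hence "diagonally_equivalent A B"
    using diagonally_similar_iff[OF tw_reach_sim_transp.prems(1) BT] unfolding diagonally_equivalent_def by blast
  thus ?case using tw_chain_base tw_reach_sim_transp.prems(1) by blast
next
  case (tw_reach_twist X A' M m)
  note A = tw_reach_twist.prems(1) and irr = tw_reach_twist.prems(2) and s = tw_reach_twist.prems(3)
  have irr': "irreducible_on {..<n} (entries A)" using irr irreducible_mat_iff by blast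
  have XV: "X \<subseteq> {..<n}" using tw_reach_twist.hyps(1) by (simp add: cut_twist_def)
  have X: "X \<noteq> {}" "X \<noteq> {..<n}" using tw_reach_twist.hyps(2,3) by auto
  have edge: "\<exists>x\<in>D. \<exists>y\<in>{..<n} - D. A $$ (x, y) \<noteq> 0" if "D \<subseteq> {..<n}" "D \<noteq> {}" "D \<noteq> {..<n}" for D
    using irr' that unfolding irreducible_on_def connected_in_def by blast
  obtain p q u w where f: "\<And>x y. x \<in> X \<Longrightarrow> y \<in> {..<n} - X \<Longrightarrow> A' x y = p x * q y \<and> A' y x = u y * w x"
    using tw_reach_twist.hyps(1) unfolding cut_twist_def by blast
  obtain d where d: "\<And>i. i < n \<Longrightarrow> d i \<noteq> 0" "\<And>i j. i < n \<Longrightarrow> j < n \<Longrightarrow> A' i j = d i * fls_const (A $$ (i, j)) / d j"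
    using s unfolding dsim_def by (metis lessThan_iff)
  \<comment> \<open>Diagonal factors cancel in the vanishing of 2 by 2 minors, which therefore
    descends to \<open>A\<close>; the nonzero entry at \<open>x0\<close>, \<open>y0\<close> then
    exhibits the block as a product.\<close>
  have minor: "A $$ (x, y) = A $$ (x, y0) * (A $$ (x0, y) / A $$ (x0, y0))"
    if I: "I \<subseteq> {..<n}" "J \<subseteq> {..<n}" and g: "\<And>x y. x \<in> I \<Longrightarrow> y \<in> J \<Longrightarrow> A' x y = f x * g y"
      and m: "x \<in> I" "x0 \<in> I" "y \<in> J" "y0 \<in> J" "A $$ (x0, y0) \<noteq> 0" for I J f g x y x0 y0
  proof -
    have n: "x < n" "x0 < n" "y < n" "y0 < n" using I m by auto
    have "A' x y * A' x0 y0 = A' x y0 * A' x0 y" using g m by (simp add: ac_simps)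
    hence "fls_const (A $$ (x, y)) * fls_const (A $$ (x0, y0)) = fls_const (A $$ (x, y0)) * fls_const (A $$ (x0, y))"
      using d(1)[OF n(1)] d(1)[OF n(2)] d(1)[OF n(3)] d(1)[OF n(4)]
      by (simp add: d(2) n del: fls_const_mult_const) (simp add: field_simps del: fls_const_mult_const)
    hence "A $$ (x, y) * A $$ (x0, y0) = A $$ (x, y0) * A $$ (x0, y)" by (simp add: fls_const_eq_iff)
    thus ?thesis using m(5) by (simp add: field_simps)
  qed
  obtain x0 y0 where 0: "x0 \<in> X" "y0 \<in> {..<n} - X" "A $$ (x0, y0) \<noteq> 0" using edge[OF XV X] by blast
  obtain x1 y1 where 1: "x1 \<in> X" "y1 \<in> {..<n} - X" "A $$ (y1, x1) \<noteq> 0" using edge[of "{..<n} - X"] X XV by blast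
  have cut: "is_cut n A X"
  proof (rule is_cutI[OF A XV tw_reach_twist.hyps(2,3)])
    fix x y assume xy: "x \<in> X" "y \<in> {..<n} - X"
    show "A $$ (x, y) = A $$ (x, y0) * (A $$ (x0, y) / A $$ (x0, y0))"
      using minor[of X "{..<n} - X" p q x x0 y y0] f xy 0 XV by blast
    show "A $$ (y, x) = A $$ (y, x1) * (A $$ (y1, x) / A $$ (y1, x1))"
      using minor[of "{..<n} - X" X u w y y1 x x1] f xy 1 XV by blast
  qed
  let ?T = "tw n A X"
  note T = tw_cut_twist[OF A irr cut]
  have irrT: "irreducible_mat n ?T"
    using irreducible_on_cut_twist[OF irr' T(2) X] irreducible_mat_iff by blast
  have "dsim {..<n} (lift (entries ?T)) M"
    by (rule cut_twist_unique[OF cut_twist_lift[OF T(2)] tw_reach_twist.hyps(1) s _ X])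
      (use irr' irreducible_on_lift[of "{..<n}" "entries A"] in simp)
  hence "tw_chain n B ?T m" using tw_reach_twist.IH[OF T(1) irrT] by blast
  thus ?case by (rule tw_chain_step[OF A cut])
qed

text \<open>Irreducibility is carried along because \<open>tw_cut_twist\<close> asks for it at every
  step.\<close>

lemma sequence_pm_equivalent:
  assumes A: "A \<in> carrier_mat n n" "irreducible_mat n A" and As: "As 0 = A"
    and step: "\<forall>i<k. \<exists>X. is_cut n (As i) X \<and> As (Suc i) = tw n (As i) X"
  shows "i \<le> k \<Longrightarrow> As i \<in> carrier_mat n n \<and> irreducible_mat n (As i) \<and> pm_equivalent n {..<n} (entries (As i)) (entries A)"
proof (induction i)
  case 0
  thus ?case using A As by (simp add: pm_equivalent_def)
next
  case (Suc i)
  hence IH: "As i \<in> carrier_mat n n" "irreducible_mat n (As i)" "pm_equivalent n {..<n} (entries (As i)) (entries A)" by auto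
  obtain X where X: "is_cut n (As i) X" "As (Suc i) = tw n (As i) X" using step Suc.prems by (meson Suc_le_lessD)
  note T = tw_cut_twist[OF IH(1,2) X(1)]
  have "irreducible_on {..<n} (entries (tw n (As i) X))"
    using irreducible_on_cut_twist[OF _ T(2)] IH(2) irreducible_mat_iff is_cut_bounds[OF X(1)] by blast
  thus ?case using T(1) pm_equivalent_cut_twist[OF IH(3) _ T(2)] irreducible_mat_iff unfolding X(2) by blast
qed

theorem theorem1:
  fixes A B :: "'a::field mat" and n :: nat
  assumes "1 \<le> n"
    and "A \<in> carrier_mat n n" and "B \<in> carrier_mat n n"
    and "irreducible_mat n A" and "irreducible_mat n B"
  shows "principal_minor_equivalent n A B \<longleftrightarrow>
    (\<exists>(k::nat) (As :: nat \<Rightarrow> 'a mat).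
       k < 2 * n \<and>
       (\<forall>i\<le>k. As i \<in> carrier_mat n n) \<and>
       As 0 = A \<and>
       (\<forall>i<k. \<exists>X. is_cut n (As i) X \<and> As (Suc i) = tw n (As i) X) \<and>
       diagonally_equivalent (As k) B)"
proof
  assume "principal_minor_equivalent n A B"
  hence "pm_equivalent n {..<n} (lift (entries A)) (lift (entries B))"
    using principal_minor_equivalent_iff[OF assms(2,3)] pm_equivalent_lift by blast
  moreover have "irreducible_on {..<n} (lift (entries A))" "irreducible_on {..<n} (lift (entries B))"
    using assms(4,5) unfolding irreducible_mat_iff
    by (simp_all add: irreducible_on_lift[of _ "entries A"] irreducible_on_lift[of _ "entries B"])
  ultimately have "tw_reach {..<n} (lift (entries B)) (lift (entries A)) (2 * (card {..<n} - 3))"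
    using tw_reach_irreducible[OF infinite_fls, of "{..<n}" n 0] assms(1) by simp
  hence "tw_chain n B A (2 * (card {..<n} - 3))"
    using tw_chain_of_reach assms dsim_refl by blast
  from tw_chain_sequence[OF this] obtain k As where k: "k \<le> 2 * (n - 3)"
    and As: "(\<forall>i\<le>k. As i \<in> carrier_mat n n) \<and> As 0 = A \<and>
      (\<forall>i<k. \<exists>X. is_cut n (As i) X \<and> As (Suc i) = tw n (As i) X) \<and> diagonally_equivalent (As k) B" by auto
  \<comment> \<open>For \<open>n\<close> at most 3 the truncated subtraction gives
    \<open>k = 0\<close>, and \<open>1 \<le> n\<close> makes the inequality strict.\<close>
  have "k < 2 * n" using k assms(1) by linarith
  thus "\<exists>k As. k < 2 * n \<and> (\<forall>i\<le>k. As i \<in> carrier_mat n n) \<and> As 0 = A \<and>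
      (\<forall>i<k. \<exists>X. is_cut n (As i) X \<and> As (Suc i) = tw n (As i) X) \<and> diagonally_equivalent (As k) B"
    using As by blast
next
  assume "\<exists>k As. k < 2 * n \<and> (\<forall>i\<le>k. As i \<in> carrier_mat n n) \<and> As 0 = A \<and>
      (\<forall>i<k. \<exists>X. is_cut n (As i) X \<and> As (Suc i) = tw n (As i) X) \<and> diagonally_equivalent (As k) B"
  then obtain k As where As: "As 0 = A" "\<forall>i<k. \<exists>X. is_cut n (As i) X \<and> As (Suc i) = tw n (As i) X"
    and e: "diagonally_equivalent (As k) B" by blast
  have Ak: "As k \<in> carrier_mat n n" "pm_equivalent n {..<n} (entries (As k)) (entries A)"
    using sequence_pm_equivalent[OF assms(2,4) As, of k] by auto
  have "pm_equivalent n {..<n} (entries (As k)) (entries B)"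
    using e unfolding diagonally_equivalent_def
  proof
    assume "diagonally_similar (As k) B"
    thus ?thesis using diagonally_similar_iff[OF Ak(1) assms(3)] pm_equivalent_dsim by blast
  next
    assume s: "diagonally_similar (As k) (transpose_mat B)"
    have "transpose_mat B \<in> carrier_mat n n" using assms(3) by simp
    hence "dsim {..<n} (entries (As k)) (entries (transpose_mat B))" using s diagonally_similar_iff[OF Ak(1)] by blast
    \<comment> \<open>Entries of \<open>transpose_mat B\<close> are those of \<open>B\<close>
      exchanged only within the dimensions, so the change is made under \<open>dsim\<close>.\<close>
    hence "dsim {..<n} (entries (As k)) (\<lambda>i j. B $$ (j, i))" using assms(3) unfolding dsim_def by auto
    hence "pm_equivalent n {..<n} (entries (As k)) (\<lambda>i j. B $$ (j, i))" by (rule pm_equivalent_dsim) simp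
    thus ?thesis using pm_equivalent_transp[of n "{..<n}" "entries (As k)" "\<lambda>i j. B $$ (j, i)"] by simp
  qed
  thus "principal_minor_equivalent n A B"
    using Ak(2) principal_minor_equivalent_iff[OF assms(2,3)] by (simp add: pm_equivalent_def)
qed

end
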